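(* Let $(P^{(1)}_{s,t})_{t\ge s\ge0}$ and $(P^{(2)}_{s,t})_{t\ge s\ge0}$ be two non-explosive PDMP semigroups on $\mathsf M$ with characteristics $(\varphi,\lambda^{(1)},Q^{(1)})$ and $(\varphi,\lambda^{(2)},Q^{(2)})$ respectively (same flow $\varphi$). Suppose that there exists a measurable $g:\mathbb R_+\to\mathbb R_+$ satisfying for all $t\ge0$ $$g(t)\ \ge\ \sup_{x\in\mathsf M,\,A\in\mathcal B(\mathsf M)}\Big\{\big(\lambda^{(1)}(t,x)\wedge\lambda^{(2)}(t,x)\big)\,\big|Q^{(1)}(t,x,A)-Q^{(2)}(t,x,A)\big|\Big\}+\sup_{x\in\mathsf M}\big|\lambda^{(1)}(t,x)-\lambda^{(2)}(t,x)\big|,$$ or, alternatively, satisfying for all $t\ge 0$ $$g(t)\ \ge\ \sup_{x\in\mathsf M,\,A\in\mathcal B(\mathsf M)}\Big|\lambda^{(1)}(t,x)\big(Q^{(1)}(t,x,A)-\delta_x(A)\big)-\lambda^{(2)}(t,x)\big(Q^{(2)}(t,x,A)-\delta_x(A)\big)\Big|.$$ Then for all $t\ge0$ and $x\in\mathsf M$, $$\big\|\delta_xP^{(1)}_{0,t}-\delta_xP^{(2)}_{0,t}\big\|_{\mathrm{TV}}\le 2\Big\{1-\exp\Big(-\int_0^tg(s)\,ds\Big)\Big\}.$$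
   Context: $\mathsf M$ is a smooth closed Riemannian submanifold of $\mathbb R^N$ with Borel $\sigma$-field $\mathcal B(\mathsf M)$; $\infty\notin\mathsf M$ is a cemetery point; $\mathcal P(\mathsf M)$ is the set of probability measures on $\mathsf M$; $\inf\emptyset=+\infty$; $\mathbb N^*=\{1,2,\dots\}$. The total variation norm is normalized as $\|\mu-\nu\|_{\mathrm{TV}}=2\inf_\xi\xi(\{(x,y):x\ne y\})$, the infimum being over all couplings $\xi$ of $\mu$ and $\nu$; equivalently $\|\mu-\nu\|_{\mathrm{TV}}=2\sup_{A}|\mu(A)-\nu(A)|$. A differential flow on $\mathsf M$ is a measurable map $\varphi:(t,h,x)\mapsto\varphi_{t,t+h}(x)$ from $\mathbb R_+\times\mathbb R_+\times\mathsf M$ to $\mathsf M$ with $\varphi_{t,t}=\mathrm{Id}$, $\varphi_{t+h_1,t+h_1+h_2}\circ\varphi_{t,t+h_1}=\varphi_{t,t+h_1+h_2}$, such that $h\mapsto\varphi_{t,t+h}(x)$ is continuously differentiable for all $(t,x)$ and $\varphi_{t,t+h}$ is a $C^1$-diffeomorphism of $\mathsf M$ for all $t,h\ge0$. A jump rate is a measurable $\lambda:\mathbb R_+\times\mathsf M\to\mathbb R_+$ bounded on every compact subset of $\mathbb R_+\times\mathsf M$; an (inhomogeneous) Markov kernel is $Q:\mathbb R_+\times\mathsf M\times\mathcal B(\mathsf M)\to[0,1]$ with $(t,x)\mapsto Q(t,x,A)$ measurable and $Q(t,x,\cdot)\in\mathcal P(\mathsf M)$. Such a triple $(\varphi,\lambda,Q)$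 is called PDMP characteristics. A PDMP with characteristics $(\varphi,\lambda,Q)$ and initial distribution $\mu_0$ is a process with the law, on the Skorokhod space $D(\mathbb R_+,\mathsf M\cup\{\infty\})$, of the following one. Let $G:\mathbb R_+\times\mathsf M\times[0,1]\to\mathsf M$ be measurable with $Q(t,x,A)=\mathbb P(G(t,x,U)\in A)$, $U$ uniform on $[0,1]$; let $W_0\sim\mu_0$ and, independently, $(E_k,U_k)_{k\in\mathbb N^*}$ i.i.d. with $E_k$ exponential with parameter $1$, $U_k$ uniform on $[0,1]$, independent. Set $S_0=0$, $X_0=X_0'=W_0$; given $X'_k\in\mathsf M$, $S_k<\infty$, set $S_{k+1}=\inf\{t\ge S_k:E_{k+1}<\int_{S_k}^t\lambda(s,\varphi_{S_k,s}(X'_k))\,ds\}$. If $S_{k+1}=+\infty$, set $S_m=+\infty$ for $m>k$ and $X_t=\varphi_{S_k,t}(X'_k)$ for $t\ge S_k$. Otherwise $X_t=\varphi_{S_k,t}(X'_k)$ for $t\in(S_k,S_{k+1})$ and $X_{S_{k+1}}=X'_{k+1}=G(S_{k+1},\varphi_{S_k,S_{k+1}}(X'_k),U_{k+1})$. For $t\ge\sup_kS_k$, $X_t=\infty$. The characteristics (and the semigroup) are non-explosive if for every initial distribution $\inf\{t\ge0:X_t=\infty\}=+\infty$ almost surely. The associated semigroup is $P_{s,t}(x,A)=\mathbb P(\bar X^{s,x}_{t-s}\in A)$, where $(\bar X^{s,x}_u)_{u\ge0}$ is a PDMP started at $x$ with the time-shifted characteristics $((\varphi_{s+u,s+v})_{v\ge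 u\ge0},\lambda(s+\cdot,\cdot),Q(s+\cdot,\cdot,\cdot))$; $\delta_xP_{0,t}=P_{0,t}(x,\cdot)$. *)

theory Defs
  imports "HOL-Probability.Probability"
begin

section \<open>Smooth submanifolds of a Euclidean space\<close>

(* Class C^k on an open set U. In finite dimension, continuity of all directional derivatives
   up to order k is continuity of the derivatives up to order k. *)
primrec Ck_on ::
    "nat \<Rightarrow> 'a::euclidean_space set \<Rightarrow> ('a \<Rightarrow> 'b::euclidean_space) \<Rightarrow> bool" where
  "Ck_on 0 U f \<longleftrightarrow> continuous_on U f"
| "Ck_on (Suc k) U f \<longleftrightarrow>
     (\<forall>x\<in>U. f differentiable (at x)) \<and>
     (\<forall>v. Ck_on k U (\<lambda>x. frechet_derivative f (at x) v))"

(* Embedded submanifold without boundary: smooth slice charts of the ambient space onto open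
   pieces of one linear subspace L, whose dimension is the dimension of M. *)
definition smooth_submanifold :: "'a::euclidean_space set \<Rightarrow> bool" where
  "smooth_submanifold M \<longleftrightarrow>
     (\<exists>L :: 'a set. subspace L \<and>
       (\<forall>p\<in>M. \<exists>(U :: 'a set) (V :: 'a set) F F'.
          open U \<and> p \<in> U \<and> open V \<and> homeomorphism U V F F' \<and>
          (\<forall>k. Ck_on k U F) \<and> (\<forall>k. Ck_on k V F') \<and> F ` (M \<inter> U) = L \<inter> V))"

(* C^1 maps from a submanifold to the ambient space: local restrictions of C^1 maps. *)
definition C1_on_submanifold :: "'a::euclidean_space set \<Rightarrow> ('a \<Rightarrow> 'a) \<Rightarrow> bool" where
  "C1_on_submanifold M f \<longleftrightarrow>
     (\<forall>p\<in>M. \<exists>U F. open U \<and> p \<in> U \<and> Ck_on 1 U F \<and> (\<forall>x\<in>M \<inter> U. F x = f x))"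

definition C1_diffeomorphism :: "'a::euclidean_space set \<Rightarrow> ('a \<Rightarrow> 'a) \<Rightarrow> bool" where
  "C1_diffeomorphism M f \<longleftrightarrow>
     bij_betw f M M \<and> C1_on_submanifold M f \<and> C1_on_submanifold M (inv_into M f)"

section \<open>PDMP characteristics\<close>

abbreviation borel_of :: "'a::topological_space set \<Rightarrow> 'a measure" where
  "borel_of M \<equiv> restrict_space borel M"

abbreviation half_line :: "real measure" where
  "half_line \<equiv> restrict_space borel {0..}"

(* phi s t x is the position at time t of the flow line passing through x at time s;
   only 0 <= s <= t and x in M are relevant. *)
definition differential_flow ::
    "'a::euclidean_space set \<Rightarrow> (real \<Rightarrow> real \<Rightarrow> 'a \<Rightarrow> 'a) \<Rightarrow> bool" where
  "differential_flow M \<phi> \<longleftrightarrow>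
     (\<lambda>(t, h, x). \<phi> t (t + h) x)
        \<in> measurable (half_line \<Otimes>\<^sub>M (half_line \<Otimes>\<^sub>M borel_of M)) (borel_of M) \<and>
     (\<forall>t\<ge>0. \<forall>x\<in>M. \<phi> t t x = x) \<and>
     (\<forall>t\<ge>0. \<forall>h1\<ge>0. \<forall>h2\<ge>0. \<forall>x\<in>M.
        \<phi> (t + h1) (t + h1 + h2) (\<phi> t (t + h1) x) = \<phi> t (t + h1 + h2) x) \<and>
     (\<forall>t\<ge>0. \<forall>x\<in>M. \<exists>D. continuous_on {0..} D \<and>
        (\<forall>h\<ge>0. ((\<lambda>h. \<phi> t (t + h) x) has_vector_derivative D h) (at h within {0..}))) \<and>
     (\<forall>t\<ge>0. \<forall>h\<ge>0. C1_diffeomorphism M (\<phi> t (t + h)))"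

definition jump_rate :: "'a::euclidean_space set \<Rightarrow> (real \<Rightarrow> 'a \<Rightarrow> real) \<Rightarrow> bool" where
  "jump_rate M r \<longleftrightarrow>
     (\<lambda>(t, x). r t x) \<in> borel_measurable (half_line \<Otimes>\<^sub>M borel_of M) \<and>
     (\<forall>t\<ge>0. \<forall>x\<in>M. 0 \<le> r t x) \<and>
     (\<forall>K. compact K \<and> K \<subseteq> {0..} \<times> M \<longrightarrow> bounded ((\<lambda>(t, x). r t x) ` K))"

definition markov_kernel ::
    "'a::euclidean_space set \<Rightarrow> (real \<Rightarrow> 'a \<Rightarrow> 'a measure) \<Rightarrow> bool" where
  "markov_kernel M Q \<longleftrightarrow>
     (\<forall>t\<ge>0. \<forall>x\<in>M. Q t x \<in> space (prob_algebra (borel_of M))) \<and>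
     (\<forall>A\<in>sets (borel_of M).
        (\<lambda>(t, x). measure (Q t x) A) \<in> borel_measurable (half_line \<Otimes>\<^sub>M borel_of M))"

definition pdmp_characteristics ::
    "'a::euclidean_space set \<Rightarrow> (real \<Rightarrow> real \<Rightarrow> 'a \<Rightarrow> 'a) \<Rightarrow> (real \<Rightarrow> 'a \<Rightarrow> real) \<Rightarrow>
     (real \<Rightarrow> 'a \<Rightarrow> 'a measure) \<Rightarrow> bool" where
  "pdmp_characteristics M \<phi> r Q \<longleftrightarrow>
     differential_flow M \<phi> \<and> jump_rate M r \<and> markov_kernel M Q"

section \<open>The process\<close>

(* Lebesgue measure on the measurable space [0,1]. It is restricted rather than a measure on the whole line,
   because the maps G below are measurable on [0,1] only. *)
abbreviation uniform01 :: "real measure" where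
  "uniform01 \<equiv> restrict_space lborel {0..1}"

definition represents_kernel ::
    "'a::euclidean_space set \<Rightarrow> (real \<Rightarrow> 'a \<Rightarrow> 'a measure) \<Rightarrow>
     (real \<Rightarrow> 'a \<Rightarrow> real \<Rightarrow> 'a) \<Rightarrow> bool" where
  "represents_kernel M Q G \<longleftrightarrow>
     (\<lambda>(t, x, u). G t x u)
        \<in> measurable (half_line \<Otimes>\<^sub>M (borel_of M \<Otimes>\<^sub>M uniform01)) (borel_of M) \<and>
     (\<forall>t\<ge>0. \<forall>x\<in>M. Q t x = distr uniform01 (borel_of M) (G t x))"

(* Canonical space of (W_0, (E_k, U_k) for k >= 1); the pair (E_(k+1), U_(k+1)) is coordinate k. *)
definition pdmp_space :: "'a measure \<Rightarrow> ('a \<times> (nat \<Rightarrow> real \<times> real)) measure" where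
  "pdmp_space \<mu>0 =
     \<mu>0 \<Otimes>\<^sub>M (\<Pi>\<^sub>M k\<in>(UNIV::nat set).
        density lborel (\<lambda>e. ennreal (exponential_density 1 e)) \<Otimes>\<^sub>M uniform01)"

(* Next jump time after s from position x with threshold e; infinite when the set is empty. *)
definition next_jump ::
    "(real \<Rightarrow> real \<Rightarrow> 'a \<Rightarrow> 'a) \<Rightarrow> (real \<Rightarrow> 'a \<Rightarrow> real) \<Rightarrow> real \<Rightarrow> 'a \<Rightarrow> real \<Rightarrow> ereal" where
  "next_jump \<phi> r s x e =
     Inf {ereal t | t. s \<le> t \<and> e < (LINT v:{s..t}|lborel. r v (\<phi> s v x))}"

(* The pairs (S_k, X'_k). The second component is irrelevant once the first is infinite. *)
primrec pdmp_chain ::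
    "(real \<Rightarrow> real \<Rightarrow> 'a \<Rightarrow> 'a) \<Rightarrow> (real \<Rightarrow> 'a \<Rightarrow> real) \<Rightarrow> (real \<Rightarrow> 'a \<Rightarrow> real \<Rightarrow> 'a) \<Rightarrow>
     'a \<times> (nat \<Rightarrow> real \<times> real) \<Rightarrow> nat \<Rightarrow> ereal \<times> 'a" where
  "pdmp_chain \<phi> r G \<omega> 0 = (0, fst \<omega>)"
| "pdmp_chain \<phi> r G \<omega> (Suc k) =
     (let (S, x) = pdmp_chain \<phi> r G \<omega> k; (e, u) = snd \<omega> k in
      if S = \<infinity> then (\<infinity>, x)
      else let s = real_of_ereal S; T = next_jump \<phi> r s x e in
        if T = \<infinity> then (\<infinity>, x)
        else let t = real_of_ereal T in (T, G t (\<phi> s t x) u))"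

(* None is the cemetery. The value at a jump time S_k is phi S_k S_k X'_k = X'_k. *)
definition pdmp_path ::
    "(real \<Rightarrow> real \<Rightarrow> 'a \<Rightarrow> 'a) \<Rightarrow> (real \<Rightarrow> 'a \<Rightarrow> real) \<Rightarrow> (real \<Rightarrow> 'a \<Rightarrow> real \<Rightarrow> 'a) \<Rightarrow>
     'a \<times> (nat \<Rightarrow> real \<times> real) \<Rightarrow> real \<Rightarrow> 'a option" where
  "pdmp_path \<phi> r G \<omega> t =
     (let S = (\<lambda>k. fst (pdmp_chain \<phi> r G \<omega> k)); X' = (\<lambda>k. snd (pdmp_chain \<phi> r G \<omega> k)) in
      if (SUP k. S k) \<le> ereal t then None
      else let k = (LEAST k. S k \<le> ereal t \<and> ereal t < S (Suc k)) in
        Some (\<phi> (real_of_ereal (S k)) t (X' k)))"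

definition non_explosive ::
    "'a::euclidean_space set \<Rightarrow> (real \<Rightarrow> real \<Rightarrow> 'a \<Rightarrow> 'a) \<Rightarrow> (real \<Rightarrow> 'a \<Rightarrow> real) \<Rightarrow>
     (real \<Rightarrow> 'a \<Rightarrow> 'a measure) \<Rightarrow> bool" where
  "non_explosive M \<phi> r Q \<longleftrightarrow>
     (\<forall>\<mu>0\<in>space (prob_algebra (borel_of M)). \<forall>G. represents_kernel M Q G \<longrightarrow>
        (AE \<omega> in pdmp_space \<mu>0.
           Inf {ereal t | t. 0 \<le> t \<and> pdmp_path \<phi> r G \<omega> t = None} = \<infinity>))"

(* P is determined for 0 <= s <= t and x in M: the law of the process does not depend on the
   map G representing the kernel, so any such G may be used. In general P s t x is only a
   subprobability on M, the missing mass being that of the cemetery. *)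
definition is_pdmp_semigroup ::
    "'a::euclidean_space set \<Rightarrow> (real \<Rightarrow> real \<Rightarrow> 'a \<Rightarrow> 'a) \<Rightarrow> (real \<Rightarrow> 'a \<Rightarrow> real) \<Rightarrow>
     (real \<Rightarrow> 'a \<Rightarrow> 'a measure) \<Rightarrow> (real \<Rightarrow> real \<Rightarrow> 'a \<Rightarrow> 'a measure) \<Rightarrow> bool" where
  "is_pdmp_semigroup M \<phi> r Q P \<longleftrightarrow>
     (\<forall>s\<ge>0. \<forall>t\<ge>s. \<forall>x\<in>M.
        sets (P s t x) = sets (borel_of M) \<and>
        (\<exists>G. represents_kernel M (\<lambda>u. Q (s + u)) G \<and>
          (\<forall>A\<in>sets (borel_of M).
             emeasure (P s t x) A =
             emeasure (pdmp_space (return (borel_of M) x))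
               {\<omega> \<in> space (pdmp_space (return (borel_of M) x)).
                  pdmp_path (\<lambda>u v. \<phi> (s + u) (s + v)) (\<lambda>u. r (s + u)) G \<omega> (t - s)
                    \<in> Some ` A})))"

section \<open>Total variation, and the exponential of an integral\<close>

definition couplings :: "'a measure \<Rightarrow> 'a measure \<Rightarrow> ('a \<times> 'a) measure set" where
  "couplings \<mu> \<nu> =
     {\<xi>. sets \<xi> = sets (\<mu> \<Otimes>\<^sub>M \<nu>) \<and> distr \<xi> \<mu> fst = \<mu> \<and> distr \<xi> \<nu> snd = \<nu>}"

definition tv_norm_diff :: "'a measure \<Rightarrow> 'a measure \<Rightarrow> real" where
  "tv_norm_diff \<mu> \<nu> =
     2 * (INF \<xi>\<in>couplings \<mu> \<nu>. measure \<xi> {z \<in> space \<xi>. fst z \<noteq> snd z})"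

(* exp(-a), with exp(-\<infinity>) = 0: the integral of g may be infinite. *)
definition exp_minus :: "ennreal \<Rightarrow> real" where
  "exp_minus a = (if a = \<infinity> then 0 else exp (- enn2real a))"

end

(*
Let u1(s,x) and u2(s,x) be the probabilities that the first process, started at x at time s, is in
A at time t, and that the second one is outside A. Put G(s) = exp(-int_s^t g). It is enough to
show u1 + u2 >= G for every A, since a maximal coupling then exists with the required mass on the
diagonal. Both hypotheses bound the gap of the two jump generators on indicators, hence on
functions with values in [0,c], by c g. Along a flow line, let D = (G - u1 - u2)^+ and
f = (G - u2)^+. Where D > 0, f lies below u1 + D with equality at the current point, and G - u2
lies below f with equality there, so replacing u1 + D and G - u2 by f in the two generators only
costs g G, which is compensated by G' = g G. Hence D is dominated by its expectation at the first
jump of the first process, and by induction by the probability that this process jumps n times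
before t, which tends to 0 by non-explosion.
*)
theory Submission
  imports Defs
begin

text \<open>Rates, kernels and g are merely measurable, so the functions followed along a flow line
  need not be differentiable. The evolution equations are kept in integrated form, with a product
  rule from Fubini and a chain rule for exponentials obtained by substituting the jump threshold for
  time. A bound on indicators costs only c g on functions with values in [0,c] because the layer
  cake formula integrates it over the levels in [0,c). With c = G this is exactly what G' = g G pays
  for. The generators are compared by a maximum principle: of two functions that agree at x, the
  larger one has the larger jump generator at x. This says something only while the deficit is
  positive, so each flow line is followed to the first time where it vanishes; there is one since
  the deficit is 0 at time t. The law is defined as a series of iterated jump operators, which makes
  the renewal equation a shift of the series. The chain of jump times and positions enters only to
  identify that series with the law of the process.\<close>

section \<open>Indefinite Lebesgue integrals\<close>

text \<open>Absolute continuity with almost everywhere derivative \<open>f\<close>, in integral form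
  because \<open>f\<close> is only measurable. Integrability is a separate conjunct since the
  integral of a non-integrable function is 0 by default.\<close>

definition primitive_on :: "real \<Rightarrow> real \<Rightarrow> (real \<Rightarrow> real) \<Rightarrow> (real \<Rightarrow> real) \<Rightarrow> bool" where
  "primitive_on a b F f \<longleftrightarrow> set_integrable lborel {a..b} f \<and>
     (\<forall>v\<in>{a..b}. F v = F a + (LINT w:{a..v}|lborel. f w))"

lemma primitive_onD:
  assumes "primitive_on a b F f" "a \<le> v" "v \<le> b"
  shows "F v = F a + (LINT w:{a..v}|lborel. f w)"
proof -
  have "v \<in> {a..b}" using assms by simp
  then show ?thesis using assms(1) unfolding primitive_on_def by blast
qed

lemma primitive_onD_integrable:
  assumes "primitive_on a b F f" "a \<le> c" "d \<le> b"
  shows "set_integrable lborel {c..d} f"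
  using assms set_integrable_subset[of lborel "{a..b}" f "{c..d}"]
  by (auto simp: primitive_on_def)

lemma set_lebesgue_integral_Icc_combine:
  fixes f :: "real \<Rightarrow> real"
  assumes f: "set_integrable lborel {a..d} f" and "a \<le> c" "c \<le> d"
  shows "(LINT w:{a..d}|lborel. f w) = (LINT w:{a..c}|lborel. f w) + (LINT w:{c..d}|lborel. f w)"
proof -
  have i: "set_integrable lborel {a..c} f" "set_integrable lborel {c..d} f"
    using set_integrable_subset[OF f] assms by auto
  show ?thesis
    using Henstock_Kurzweil_Integration.integral_combine[OF assms(2,3) set_borel_integral_eq_integral(1)[OF f]]
    by (simp add: set_borel_integral_eq_integral(2)[OF f] set_borel_integral_eq_integral(2)[OF i(1)]
        set_borel_integral_eq_integral(2)[OF i(2)])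
qed

lemma primitive_on_diff:
  assumes p: "primitive_on a b F f" and "a \<le> c" "c \<le> d" "d \<le> b"
  shows "F d - F c = (LINT w:{c..d}|lborel. f w)"
proof -
  have "F d = F a + (LINT w:{a..d}|lborel. f w)" "F c = F a + (LINT w:{a..c}|lborel. f w)"
    using primitive_onD[OF p, of d] primitive_onD[OF p, of c] assms(2-4) by linarith+
  then show ?thesis
    using set_lebesgue_integral_Icc_combine[of a d f c] primitive_onD_integrable[OF p, of a d] assms
    by simp
qed

lemma primitive_on_subinterval:
  assumes p: "primitive_on a b F f" and "a \<le> c" "d \<le> b"
  shows "primitive_on c d F f"
  unfolding primitive_on_def
proof safe
  show "set_integrable lborel {c..d} f" using primitive_onD_integrable[OF assms] .
  fix v assume "v \<in> {c..d}"
  then show "F v = F c + (LINT w:{c..v}|lborel. f w)"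
    using primitive_on_diff[OF p, of c v] assms by simp
qed

lemma primitive_on_cong:
  assumes "primitive_on a b F f" and "\<And>v. v \<in> {a..b} \<Longrightarrow> F v = F' v" "\<And>v. v \<in> {a..b} \<Longrightarrow> f v = f' v"
  shows "primitive_on a b F' f'"
proof -
  have "set_integrable lborel {a..b} f = set_integrable lborel {a..b} f'"
    by (rule set_integrable_cong) (use assms in auto)
  moreover have "(LINT w:{a..v}|lborel. f w) = (LINT w:{a..v}|lborel. f' w)" if "v \<in> {a..b}" for v
    by (rule set_lebesgue_integral_cong) (use assms that in auto)
  moreover have "F a = F' a" if "v \<in> {a..b}" for v using assms(2)[of a] that by auto
  ultimately show ?thesis using assms(1,2) unfolding primitive_on_def by metis
qed

lemma primitive_on_continuous:
  assumes p: "primitive_on a b F f"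
  shows "continuous_on {a..b} F"
proof -
  have "set_integrable lborel {a..b} f" using p by (simp add: primitive_on_def)
  then have "f integrable_on {a..b}" by (rule set_borel_integral_eq_integral)
  then have "continuous_on {a..b} (\<lambda>v. F a + integral {a..v} f)"
    by (intro continuous_intros indefinite_integral_continuous_1)
  moreover have "F v = F a + integral {a..v} f" if "v \<in> {a..b}" for v
    using primitive_onD[OF p, of v] that set_borel_integral_eq_integral(2)[OF primitive_onD_integrable[OF p, of a v]]
    by simp
  ultimately show ?thesis by (metis (no_types, lifting) continuous_on_cong)
qed

lemma primitive_on_add:
  assumes "primitive_on a b F f" "primitive_on a b G g"
  shows "primitive_on a b (\<lambda>v. F v + G v) (\<lambda>v. f v + g v)"
  unfolding primitive_on_def
proof safe
  show "set_integrable lborel {a..b} (\<lambda>v. f v + g v)"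
    using assms by (intro set_integral_add) (auto simp: primitive_on_def)
  fix v assume "v \<in> {a..b}"
  then show "F v + G v = F a + G a + (LINT w:{a..v}|lborel. f w + g w)"
    using assms primitive_onD_integrable[OF assms(1), of a v] primitive_onD_integrable[OF assms(2), of a v]
    primitive_onD[OF assms(1), of v] primitive_onD[OF assms(2), of v]
    by (subst set_integral_add) simp_all
qed

lemma primitive_on_cmult:
  assumes "primitive_on a b F f"
  shows "primitive_on a b (\<lambda>v. c * F v) (\<lambda>v. c * f v)"
  unfolding primitive_on_def
proof safe
  show "set_integrable lborel {a..b} (\<lambda>v. c * f v)"
    using assms by (simp add: primitive_on_def)
  fix v assume "v \<in> {a..b}"
  then show "c * F v = c * F a + (LINT w:{a..v}|lborel. c * f w)"
    using primitive_onD[OF assms, of v] by (simp add: algebra_simps)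
qed

text \<open>Integration by parts without derivatives: by Fubini the product of the integrals is the
  integral of \<open>f v * g w\<close> over the plane, which the diagonal cuts into the two
  summands.\<close>

lemma integral_product_split:
  fixes f g :: "real \<Rightarrow> real"
  assumes f: "integrable lborel f" and g: "integrable lborel g"
  defines "F \<equiv> \<lambda>v. LINT w|lborel. indicator {..v} w * f w"
    and "G \<equiv> \<lambda>v. LINT w|lborel. indicator {..v} w * g w"
  shows "integrable lborel (\<lambda>v. f v * G v)" "integrable lborel (\<lambda>v. F v * g v)"
    "(LINT v|lborel. f v) * (LINT v|lborel. g v) = (LINT v|lborel. f v * G v) + (LINT v|lborel. F v * g v)"
proof -
  have [measurable]: "f \<in> borel_measurable borel" "g \<in> borel_measurable borel"
    using f g by (auto dest: borel_measurable_integrable)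
  have ind: "(\<lambda>p. indicator {..fst p} (snd p) :: real) \<in> borel_measurable (lborel \<Otimes>\<^sub>M (lborel :: real measure))"
    unfolding indicator_def atMost_iff by measurable
  have ind2: "(\<lambda>p. indicator {fst p<..} (snd p) :: real) \<in> borel_measurable (lborel \<Otimes>\<^sub>M (lborel :: real measure))"
    unfolding indicator_def greaterThan_iff by measurable
  have P: "integrable (lborel \<Otimes>\<^sub>M lborel) (\<lambda>(v, w). f v * g w)"
  proof (rule lborel_pair.Fubini_integrable)
    show "(\<lambda>(v, w). f v * g w) \<in> borel_measurable (lborel \<Otimes>\<^sub>M lborel)" by measurable
    have "integrable lborel (\<lambda>x. norm (f x) * (LINT y|lborel. norm (g y)))"
      using f by (intro integrable_mult_left integrable_norm)
    then show "integrable lborel (\<lambda>x. LINT y|lborel. norm (case (x, y) of (v, w) \<Rightarrow> f v * g w))"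
      by (simp add: abs_mult)
    show "AE x in lborel. integrable lborel (\<lambda>y. case (x, y) of (v, w) \<Rightarrow> f v * g w)"
      using g by simp
  qed
  have P1: "integrable (lborel \<Otimes>\<^sub>M lborel) (\<lambda>(v, w). indicator {..v} w * (f v * g w))"
    apply (rule Bochner_Integration.integrable_bound[OF P])
    using ind apply (simp add: split_beta')
    by (auto simp: indicator_def)
  have P2: "integrable (lborel \<Otimes>\<^sub>M lborel) (\<lambda>(v, w). indicator {v<..} w * (f v * g w))"
    apply (rule Bochner_Integration.integrable_bound[OF P])
    using ind2 apply (simp add: split_beta')
    by (auto simp: indicator_def)
  have i1: "(LINT w|lborel. indicator {..v} w * (f v * g w)) = f v * G v" for v
    unfolding G_def by (subst integral_mult_right_zero[symmetric]) (simp add: ac_simps)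
  have i2: "(LINT v|lborel. indicator {v<..} w * (f v * g w)) = F w * g w" for w
  proof -
    \<comment> \<open>The region w > v leaves {..<w} for v, while \<open>F\<close> integrates over
      {..w}; the point v = w is null.\<close>
    have "(LINT v|lborel. indicator {v<..} w * (f v * g w)) = (LINT v|lborel. (indicator {..w} v * f v) * g w)"
      using AE_lborel_singleton[of w]
      by (intro integral_cong_AE) (auto simp: indicator_def)
    then show ?thesis unfolding F_def by simp
  qed
  show A: "integrable lborel (\<lambda>v. f v * G v)"
    using lborel_pair.integrable_fst[OF P1] by (simp add: i1)
  show B: "integrable lborel (\<lambda>v. F v * g v)"
    using lborel_pair.integrable_snd[OF P2] by (simp add: i2)
  have "(LINT v|lborel. f v) * (LINT v|lborel. g v) = (LINT p|(lborel \<Otimes>\<^sub>M lborel). (\<lambda>(v, w). f v * g w) p)"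
    using lborel_pair.integral_fst[OF P] by simp
  also have "\<dots> = (LINT p|(lborel \<Otimes>\<^sub>M lborel). (\<lambda>(v, w). indicator {..v} w * (f v * g w)) p
      + (\<lambda>(v, w). indicator {v<..} w * (f v * g w)) p)"
    by (rule Bochner_Integration.integral_cong) (auto simp: indicator_def)
  also have "\<dots> = (LINT p|(lborel \<Otimes>\<^sub>M lborel). (\<lambda>(v, w). indicator {..v} w * (f v * g w)) p)
      + (LINT p|(lborel \<Otimes>\<^sub>M lborel). (\<lambda>(v, w). indicator {v<..} w * (f v * g w)) p)"
    by (rule Bochner_Integration.integral_add[OF P1 P2])
  also have "\<dots> = (LINT v|lborel. f v * G v) + (LINT v|lborel. F v * g v)"
    using lborel_pair.integral_fst[OF P1] lborel_pair.integral_snd[OF P2] by (simp add: i1 i2)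
  finally show "(LINT v|lborel. f v) * (LINT v|lborel. g v) = (LINT v|lborel. f v * G v) + (LINT v|lborel. F v * g v)" .
qed

text \<open>Product rule, from \<open>integral_product_split\<close> applied to \<open>f\<close> and
  \<open>g\<close> cut off to {a..c}. The partial integrals of the cut-off functions are
  \<open>F v - F a\<close> and \<open>G v - G a\<close>; the constants are added back at the
  end.\<close>

lemma primitive_on_mult:
  assumes F: "primitive_on a b F f" and G: "primitive_on a b G g"
  shows "primitive_on a b (\<lambda>v. F v * G v) (\<lambda>v. f v * G v + F v * g v)"
proof -
  have main: "set_integrable lborel {a..c} (\<lambda>v. f v * G v + F v * g v) \<and>
      F c * G c = F a * G a + (LINT v:{a..c}|lborel. f v * G v + F v * g v)" if c: "c \<le> b" "a \<le> c" for c
  proof -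
    let ?f = "\<lambda>v. indicator {a..c} v * f v" and ?g = "\<lambda>v. indicator {a..c} v * g v"
    have f: "integrable lborel ?f" and g: "integrable lborel ?g"
      using primitive_onD_integrable[OF F order.refl c(1)] primitive_onD_integrable[OF G order.refl c(1)]
      by (auto simp: set_integrable_def)
    note s = integral_product_split[OF f g]
    have pf: "(LINT w|lborel. indicator {..v} w * ?f w) = F v - F a"
      and pg: "(LINT w|lborel. indicator {..v} w * ?g w) = G v - G a" if "v \<in> {a..c}" for v
    proof -
      have "{..v} \<inter> {a..c} = {a..v}" using that by auto
      then show "(LINT w|lborel. indicator {..v} w * ?f w) = F v - F a"
        "(LINT w|lborel. indicator {..v} w * ?g w) = G v - G a"
        using primitive_onD[OF F, of v] primitive_onD[OF G, of v] that c
        by (simp_all add: set_lebesgue_integral_def indicator_inter_arith[symmetric] mult.assoc[symmetric])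
    qed
    \<comment> \<open>Off {a..c} the partial integral need not be \<open>G v - G a\<close>, but
      there the factor \<open>?f v\<close> is 0, so the identity holds for every v.\<close>
    have e: "?f v * (LINT w|lborel. indicator {..v} w * ?g w) = ?f v * G v - G a * ?f v" for v
    proof (cases "v \<in> {a..c}")
      case True then show ?thesis by (simp only: pg) (simp add: algebra_simps)
    qed simp
    have e': "(LINT w|lborel. indicator {..v} w * ?f w) * ?g v = F v * ?g v - F a * ?g v" for v
    proof (cases "v \<in> {a..c}")
      case True then show ?thesis by (simp only: pf) (simp add: algebra_simps)
    qed simp
    note e = e e'
    have fG: "integrable lborel (\<lambda>v. ?f v * G v)"
      using Bochner_Integration.integrable_add[OF s(1) integrable_mult_right[OF f, of "G a"]] unfolding e by simp
    have Fg: "integrable lborel (\<lambda>v. F v * ?g v)"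
      using Bochner_Integration.integrable_add[OF s(2) integrable_mult_right[OF g, of "F a"]] unfolding e by simp
    have r: "indicator {a..c} v *\<^sub>R (f v * G v + F v * g v) = ?f v * G v + F v * ?g v" for v
      by (simp add: algebra_simps)
    have "(LINT v|lborel. ?f v) * (LINT v|lborel. ?g v) =
       (LINT v|lborel. ?f v * G v) - G a * (LINT v|lborel. ?f v)
      + ((LINT v|lborel. F v * ?g v) - F a * (LINT v|lborel. ?g v))"
      unfolding s(3) e using fG Fg f g by simp
    moreover have "(LINT v|lborel. ?f v) = F c - F a" "(LINT v|lborel. ?g v) = G c - G a"
      using primitive_onD[OF F, of c] primitive_onD[OF G, of c] c by (simp_all add: set_lebesgue_integral_def)
    ultimately have "(F c - F a) * (G c - G a) =
       (LINT v|lborel. ?f v * G v) - G a * (F c - F a) + ((LINT v|lborel. F v * ?g v) - F a * (G c - G a))"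
      by (simp only:)
    then have "F c * G c = F a * G a + ((LINT v|lborel. ?f v * G v) + (LINT v|lborel. F v * ?g v))"
      by (simp add: algebra_simps)
    then show ?thesis
      unfolding set_integrable_def set_lebesgue_integral_def r using fG Fg by simp
  qed
  show ?thesis
  proof (cases "a \<le> b")
    case True
    show ?thesis
      unfolding primitive_on_def
    proof safe
      show "set_integrable lborel {a..b} (\<lambda>v. f v * G v + F v * g v)" using main[of b] True by blast
      fix v assume "v \<in> {a..b}"
      then show "F v * G v = F a * G a + (LINT w:{a..v}|lborel. f w * G w + F w * g w)"
        using main[of v] by simp
    qed
  next
    case False then show ?thesis by (auto simp: primitive_on_def set_integrable_def)
  qed
qed

section \<open>Cumulative hazard and first passage\<close>

text \<open>One rate as a function of time alone. Two kinds of instances occur: a jump rate read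
  along one flow line, and the bound g, whose hazard is the exponent in the final estimate.\<close>

locale hazard_rate =
  fixes \<rho> :: "real \<Rightarrow> real" and a :: real
  assumes rate_measurable [measurable]: "\<rho> \<in> borel_measurable borel"
    and rate_nonneg: "0 \<le> \<rho> v"
    and rate_integrable: "set_integrable lborel {a..b} \<rho>"
begin

definition hazard :: "real \<Rightarrow> real" where
  "hazard v = (LINT w:{a..v}|lborel. \<rho> w)"

text \<open>This is \<open>next_jump\<close> with the flow line fixed. The strict inequality makes
  it the right-continuous generalised inverse of \<open>hazard\<close>, which skips flat pieces; a
  threshold that is never exceeded gives infinity.\<close>

definition passage :: "real \<Rightarrow> ereal" where
  "passage e = Inf {ereal v | v. a \<le> v \<and> e < hazard v}"

lemma hazard_increment_nonneg: "0 \<le> (LINT w:{v..u}|lborel. \<rho> w)"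
  using rate_nonneg unfolding set_lebesgue_integral_def
  by (intro Bochner_Integration.integral_nonneg) (auto simp: indicator_def)

lemma hazard_eq_0: "v \<le> a \<Longrightarrow> hazard v = 0"
proof -
  assume "v \<le> a"
  then have "AE w in lborel. indicator {a..v} w *\<^sub>R \<rho> w = 0"
    using AE_lborel_singleton[of a] by (auto simp: indicator_def)
  then show ?thesis
    unfolding hazard_def set_lebesgue_integral_def by (rule integral_eq_zero_AE)
qed

lemma primitive_hazard: "primitive_on a b hazard \<rho>"
  using rate_integrable hazard_eq_0[of a] unfolding primitive_on_def by (simp add: hazard_def)

lemma hazard_mono: "v \<le> w \<Longrightarrow> hazard v \<le> hazard w"
proof (cases "v \<le> a")
  assume "v \<le> a"
  then show "hazard v \<le> hazard w"
    using hazard_increment_nonneg[of a w] by (simp add: hazard_eq_0) (simp add: hazard_def)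
next
  assume "v \<le> w" "\<not> v \<le> a"
  then have "hazard w - hazard v = (LINT u:{v..w}|lborel. \<rho> u)"
    by (intro primitive_on_diff[OF primitive_hazard]) auto
  also have "\<dots> \<ge> 0" by (rule hazard_increment_nonneg)
  finally show ?thesis by simp
qed

lemma hazard_nonneg: "0 \<le> hazard v"
  using hazard_mono[of "min a v" v] hazard_eq_0[of "min a v"] by simp

lemma continuous_hazard: "continuous_on {a..b} hazard"
  by (rule primitive_on_continuous[OF primitive_hazard])

lemma hazard_left:
  assumes "a < c" "e < hazard c" shows "\<exists>v. a \<le> v \<and> v < c \<and> e < hazard v"
proof -
  obtain d where d: "d > 0" "\<And>v. v \<in> {a..c} \<Longrightarrow> dist v c < d \<Longrightarrow> dist (hazard v) (hazard c) < hazard c - e"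
    using continuous_hazard[of c, unfolded continuous_on_iff, rule_format, of c "hazard c - e"] assms by auto
  define v where "v = max a (c - d / 2)"
  have "dist (hazard v) (hazard c) < hazard c - e"
    using d(1) assms by (intro d) (auto simp: v_def dist_real_def)
  then have "e < hazard v" by (simp add: dist_real_def)
  moreover have "a \<le> v" "v < c" using assms d by (auto simp: v_def)
  ultimately show ?thesis by blast
qed

lemma hazard_right:
  assumes "a \<le> c" "hazard c < e" shows "\<exists>v>c. hazard v < e"
proof -
  obtain d where d: "d > 0" "\<And>v. v \<in> {a..c + 1} \<Longrightarrow> dist v c < d \<Longrightarrow> dist (hazard v) (hazard c) < e - hazard c"
    using continuous_hazard[of "c + 1", unfolded continuous_on_iff, rule_format, of c "e - hazard c"] assms by auto
  define v where "v = min (c + 1) (c + d / 2)"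
  have "dist (hazard v) (hazard c) < e - hazard c"
    using d(1) assms by (intro d) (auto simp: v_def dist_real_def)
  then have "hazard v < e" by (simp add: dist_real_def)
  moreover have "v > c" using d by (auto simp: v_def)
  ultimately show ?thesis by blast
qed

text \<open>If \<open>hazard c\<close> exceeds e then, by continuity, so does the hazard slightly
  before c, and the infimum lies strictly below c. Sublevel sets of \<open>passage\<close> thus
  become half-lines in e or empty, from which measurability and the law of the jump time
  follow.\<close>

lemma passage_less_iff: "passage e < ereal c \<longleftrightarrow> a < c \<and> e < hazard c"
proof
  assume "passage e < ereal c"
  then obtain v where "a \<le> v" "e < hazard v" "v < c"
    unfolding passage_def Inf_less_iff by auto
  then show "a < c \<and> e < hazard c" using hazard_mono[of v c] by simp
next
  assume "a < c \<and> e < hazard c"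
  then obtain v where "a \<le> v" "v < c" "e < hazard v" using hazard_left[of c e] by blast
  then show "passage e < ereal c"
    unfolding passage_def Inf_less_iff by force
qed

lemma passage_ge: "ereal a \<le> passage e"
  unfolding passage_def by (rule Inf_greatest) auto

lemma passage_measurable [measurable]: "passage \<in> borel_measurable borel"
proof (rule borel_measurableI_less)
  fix y :: ereal
  consider (r) c where "y = ereal c" | (p) "y = \<infinity>" | (m) "y = -\<infinity>" by (cases y) auto
  then show "{x \<in> space borel. passage x < y} \<in> sets borel"
  proof cases
    case r
    then have "{x \<in> space borel. passage x < y} = (if a < c then {..<hazard c} else {})"
      by (auto simp: passage_less_iff)
    then show ?thesis by simp
  next
    case p
    have "passage x < \<infinity> \<longleftrightarrow> (\<exists>n::nat. passage x < ereal (real n))" for x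
      using less_PInf_Ex_of_nat[of "passage x"] by simp
    then have "{x \<in> space borel. passage x < y} = (\<Union>n::nat. if a < real n then {..<hazard (real n)} else {})"
      using p by (auto simp: passage_less_iff split: if_splits)
    also have "\<dots> \<in> sets borel" by (intro sets.countable_UN) auto
    finally show ?thesis .
  qed simp
qed

text \<open>Continuity again: at the infimum the hazard cannot exceed e, else it would have done so
  earlier, and cannot be below e, else it would stay below for a while.\<close>

lemma hazard_passage:
  assumes "0 \<le> e" "passage e \<noteq> \<infinity>" shows "hazard (real_of_ereal (passage e)) = e"
proof -
  obtain v where v: "passage e = ereal v"
    using assms passage_ge[of e] by (cases "passage e") auto
  have av: "a \<le> v" using passage_ge[of e] v by simp
  have "\<not> passage e < ereal v" using v by simp
  then have 1: "hazard v \<le> e"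
    using assms(1) av hazard_eq_0[of v] unfolding passage_less_iff by force
  have "\<not> hazard v < e"
  proof
    assume "hazard v < e"
    then obtain w where "v < w" "hazard w < e" using hazard_right av by blast
    then show False using passage_less_iff[of e w] v by simp
  qed
  with 1 v show ?thesis by simp
qed

lemma passage_finite: "0 \<le> e \<Longrightarrow> e < hazard b \<Longrightarrow> passage e < ereal b"
  using hazard_eq_0[of b] by (force simp: passage_less_iff)

lemma nn_integral_rate:
  "(\<integral>\<^sup>+ v. ennreal (\<rho> v) * indicator {a..b} v \<partial>lborel) = ennreal (hazard b)"
proof -
  have "(\<integral>\<^sup>+ v. ennreal (\<rho> v) * indicator {a..b} v \<partial>lborel) = (\<integral>\<^sup>+ v. ennreal (indicator {a..b} v *\<^sub>R \<rho> v) \<partial>lborel)"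
    by (intro nn_integral_cong) (auto simp: indicator_def)
  also have "\<dots> = ennreal (hazard b)"
    unfolding hazard_def set_lebesgue_integral_def
    using rate_integrable[of b] rate_nonneg by (intro nn_integral_eq_integral) (auto simp: set_integrable_def)
  finally show ?thesis .
qed

text \<open>Since \<^term>\<open>passage\<close> is a generalised inverse of \<^term>\<open>hazard\<close>, it turns Lebesgue measure
  into the rate; this replaces the chain rule for the merely measurable \<^term>\<open>\<rho>\<close>.\<close>

lemma distr_passage:
  "distr (density lborel (indicator {0..<hazard b})) borel (\<lambda>e. real_of_ereal (passage e))
    = density lborel (\<lambda>v. ennreal (\<rho> v) * indicator {a..b} v)" (is "?D = ?E")
proof (rule measure_eqI_generator_eq)
  let ?G = "range (lessThan :: real \<Rightarrow> _)"
  show "Int_stable ?G"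
    unfolding Int_stable_def
  proof safe
    fix x y :: real
    show "{..<x} \<inter> {..<y} \<in> ?G" by (rule range_eqI[of _ _ "min x y"]) auto
  qed
  show "?G \<subseteq> Pow UNIV" by auto
  show "sets ?D = sigma_sets UNIV ?G" "sets ?E = sigma_sets UNIV ?G"
    by (simp_all add: borel_Iio)
  show "range (\<lambda>n. {..<real n}) \<subseteq> ?G" by auto
  show "(\<Union>n. {..<real n}) = UNIV" using reals_Archimedean2 by auto
  have eq: "emeasure ?D {..<c} = emeasure ?E {..<c} \<and> emeasure ?E {..<c} \<noteq> \<infinity>" for c
  proof -
    \<comment> \<open>For thresholds in [0, hazard b), passing before c means passing before
      \<open>min b c\<close>. If this minimum is at most a, both sides are false, since its hazard
      is then 0.\<close>
    have fin: "passage e < ereal b \<and> real_of_ereal (passage e) < c \<longleftrightarrow> e < hazard (min b c)" if "0 \<le> e" "e < hazard b" for e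
    proof -
      have "passage e < ereal b" using passage_finite[OF that] .
      then obtain v where v: "passage e = ereal v" "v < b"
        using passage_ge[of e] by (cases "passage e") auto
      have "real_of_ereal (passage e) < c \<longleftrightarrow> passage e < ereal (min b c)" using v by simp
      also have "\<dots> \<longleftrightarrow> e < hazard (min b c)"
        unfolding passage_less_iff using that hazard_eq_0[of "min b c"] by force
      finally show ?thesis using v by simp
    qed
    have [measurable]: "(\<lambda>e. real_of_ereal (passage e)) -` {..<c} \<in> sets borel"
      using measurable_sets[of "\<lambda>e. real_of_ereal (passage e)" borel borel "{..<c}"] by simp
    have "emeasure ?D {..<c} = (\<integral>\<^sup>+ e. indicator {0..<hazard b} e * indicator ((\<lambda>e. real_of_ereal (passage e)) -` {..<c}) e \<partial>lborel)"
      by (subst emeasure_distr) (simp_all add: emeasure_density)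
    also have "\<dots> = (\<integral>\<^sup>+ e. indicator {0..<hazard (min b c)} e \<partial>lborel)"
      using fin passage_finite hazard_mono[of "min b c" b]
      by (intro nn_integral_cong) (auto simp: indicator_def)
    also have "\<dots> = ennreal (hazard (min b c))" using hazard_nonneg by simp
    finally have D: "emeasure ?D {..<c} = ennreal (hazard (min b c))" .
    have "ennreal (hazard (min b c)) = (\<integral>\<^sup>+ v. ennreal (\<rho> v) * indicator {a..min b c} v \<partial>lborel)"
      by (rule nn_integral_rate[symmetric])
    also have "\<dots> = (\<integral>\<^sup>+ v. ennreal (\<rho> v) * indicator {a..b} v * indicator {..<c} v \<partial>lborel)"
      using AE_lborel_singleton[of c] by (intro nn_integral_cong_AE) (auto simp: indicator_def)
    also have "\<dots> = emeasure ?E {..<c}" by (simp add: emeasure_density)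
    finally show ?thesis unfolding D by (metis ennreal_neq_top infinity_ennreal_def)
  qed
  then show "X \<in> ?G \<Longrightarrow> emeasure ?D X = emeasure ?E X" for X by blast
  show "emeasure ?D {..<real n} \<noteq> \<infinity>" for n using eq by simp
qed

text \<open>The substitution e = \<open>hazard v\<close>, with Jacobian
  \<open>\<rho>\<close>.\<close>

lemma nn_integral_passage:
  assumes [measurable]: "h \<in> borel_measurable borel"
  shows "(\<integral>\<^sup>+ e. h (real_of_ereal (passage e)) * indicator {0..<hazard b} e \<partial>lborel)
    = (\<integral>\<^sup>+ v. ennreal (\<rho> v) * h v * indicator {a..b} v \<partial>lborel)"
proof -
  let ?D = "density lborel (indicator {0..<hazard b})"
  have "(\<integral>\<^sup>+ e. h (real_of_ereal (passage e)) * indicator {0..<hazard b} e \<partial>lborel)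
    = (\<integral>\<^sup>+ e. h (real_of_ereal (passage e)) \<partial>?D)"
    by (subst nn_integral_density) (auto simp: mult.commute)
  also have "\<dots> = (\<integral>\<^sup>+ v. h v \<partial>distr ?D borel (\<lambda>e. real_of_ereal (passage e)))"
    by (subst nn_integral_distr) auto
  also have "\<dots> = (\<integral>\<^sup>+ v. h v \<partial>density lborel (\<lambda>v. ennreal (\<rho> v) * indicator {a..b} v))"
    by (simp only: distr_passage)
  also have "\<dots> = (\<integral>\<^sup>+ v. ennreal (\<rho> v) * indicator {a..b} v * h v \<partial>lborel)"
    by (subst nn_integral_density) auto
  also have "\<dots> = (\<integral>\<^sup>+ v. ennreal (\<rho> v) * h v * indicator {a..b} v \<partial>lborel)"
    by (intro nn_integral_cong) (auto split: split_indicator)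
  finally show ?thesis .
qed

lemma hazard_measurable [measurable]: "hazard \<in> borel_measurable borel"
  by (rule borel_measurable_mono) (auto simp: mono_def hazard_mono)

lemma hazard_a [simp]: "hazard a = 0"
  by (rule hazard_eq_0) simp

text \<open>The substitution e = \<open>hazard v\<close> turns the integral of the claimed
  derivative, divided by c, into that of exp (c * e) over an interval starting at 0, where the
  classical fundamental theorem applies. With c = 1 and c = -1 it supplies integrating
  factors.\<close>

lemma primitive_exp_hazard:
  assumes "c \<noteq> 0"
  shows "primitive_on a b (\<lambda>v. exp (c * hazard v)) (\<lambda>v. c * (\<rho> v * exp (c * hazard v)))"
proof -
  have main: "has_bochner_integral lborel (\<lambda>v. indicator {a..v'} v *\<^sub>R (\<rho> v * exp (c * hazard v)))
      ((exp (c * hazard v') - 1) / c)" for v'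
  proof (rule has_bochner_integral_nn_integral)
    have "(\<integral>\<^sup>+ v. ennreal (indicator {a..v'} v *\<^sub>R (\<rho> v * exp (c * hazard v))) \<partial>lborel)
      = (\<integral>\<^sup>+ v. ennreal (\<rho> v) * ennreal (exp (c * hazard v)) * indicator {a..v'} v \<partial>lborel)"
      using rate_nonneg by (intro nn_integral_cong) (auto simp: indicator_def ennreal_mult)
    also have "\<dots> = (\<integral>\<^sup>+ e. ennreal (exp (c * hazard (real_of_ereal (passage e)))) * indicator {0..<hazard v'} e \<partial>lborel)"
      by (subst nn_integral_passage) simp_all
    also have "\<dots> = (\<integral>\<^sup>+ e. ennreal (exp (c * e)) * indicator {0..hazard v'} e \<partial>lborel)"
    \<comment> \<open>Below the endpoint the passage time is finite and
      \<open>hazard_passage\<close> applies; at the endpoint itself the two indicators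
      differ.\<close>
    proof (rule nn_integral_cong_AE, use AE_lborel_singleton[of "hazard v'"] in eventually_elim)
      fix e assume "e \<noteq> hazard v'"
      have "passage e \<noteq> \<infinity>" if "0 \<le> e" "e < hazard v'"
        using passage_finite[OF that] by auto
      then show "ennreal (exp (c * hazard (real_of_ereal (passage e)))) * indicator {0..<hazard v'} e
        = ennreal (exp (c * e)) * indicator {0..hazard v'} e"
        using hazard_passage[of e] \<open>e \<noteq> hazard v'\<close>
        by (cases "0 \<le> e \<and> e < hazard v'") (auto simp: indicator_def)
    qed
    also have "\<dots> = exp (c * hazard v') / c - exp (c * 0) / c"
      using hazard_nonneg \<open>c \<noteq> 0\<close>
      by (intro nn_integral_FTC_Icc) (auto intro!: derivative_eq_intros)
    finally show "(\<integral>\<^sup>+ v. ennreal (indicator {a..v'} v *\<^sub>R (\<rho> v * exp (c * hazard v))) \<partial>lborel)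
       = ennreal ((exp (c * hazard v') - 1) / c)" by (simp add: diff_divide_distrib)
    show "0 \<le> (exp (c * hazard v') - 1) / c"
      using hazard_nonneg[of v'] \<open>c \<noteq> 0\<close>
      by (cases "c > 0") (auto simp: divide_nonneg_nonneg mult_nonpos_nonneg intro!: divide_nonpos_nonpos)
  qed (use rate_nonneg in auto)
  show ?thesis
    unfolding primitive_on_def
  proof safe
    have "set_integrable lborel {a..b} (\<lambda>v. \<rho> v * exp (c * hazard v))"
      unfolding set_integrable_def using main[of b] by (rule integrable.intros)
    then show "set_integrable lborel {a..b} (\<lambda>v. c * (\<rho> v * exp (c * hazard v)))" by simp
    fix v
    show "exp (c * hazard v) = exp (c * hazard a) + (LINT w:{a..v}|lborel. c * (\<rho> w * exp (c * hazard w)))"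
      using has_bochner_integral_integral_eq[OF main[of v]] \<open>c \<noteq> 0\<close> by (simp add: set_lebesgue_integral_def)
  qed
qed

text \<open>The integrand is minus the derivative of the survival function exp (- hazard).\<close>

lemma nn_integral_hazard_density:
  assumes "a \<le> b"
  shows "(\<integral>\<^sup>+ v. ennreal (\<rho> v * exp (- hazard v)) * indicator {a..b} v \<partial>lborel) = ennreal (1 - exp (- hazard b))"
proof -
  have p: "primitive_on a b (\<lambda>v. exp (- hazard v)) (\<lambda>v. - (\<rho> v * exp (- hazard v)))"
    using primitive_exp_hazard[of "-1" b] by simp
  have "set_integrable lborel {a..b} (\<lambda>v. - 1 * - (\<rho> v * exp (- hazard v)))"
    using primitive_onD_integrable[OF p] by (intro set_integrable_mult_right) auto
  then have i: "set_integrable lborel {a..b} (\<lambda>v. \<rho> v * exp (- hazard v))" by simp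
  have "(LINT v:{a..b}|lborel. - (\<rho> v * exp (- hazard v))) = exp (- hazard b) - 1"
    using primitive_onD[OF p, of b] assms by simp
  then have "(LINT v:{a..b}|lborel. \<rho> v * exp (- hazard v)) = 1 - exp (- hazard b)"
    using i by (simp add: set_integral_uminus)
  moreover have "(\<integral>\<^sup>+ v. ennreal (\<rho> v * exp (- hazard v)) * indicator {a..b} v \<partial>lborel)
     = (\<integral>\<^sup>+ v. ennreal (indicator {a..b} v *\<^sub>R (\<rho> v * exp (- hazard v))) \<partial>lborel)"
    by (intro nn_integral_cong) (auto simp: indicator_def)
  ultimately show ?thesis
    using i rate_nonneg unfolding set_integrable_def set_lebesgue_integral_def
    by (simp add: nn_integral_eq_integral)
qed

text \<open>Substituting e = \<open>hazard v\<close> turns the weight exp (- e) into exp (- hazard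
  v) and supplies the factor \<open>\<rho>\<close>: this is the law of the jump time. Since h
  vanishes beyond b, only thresholds below \<open>hazard b\<close> count, up to a null set, and for
  them the jump time is finite.\<close>

lemma nn_integral_exponential_passage:
  assumes [measurable]: "h \<in> borel_measurable borel" and h: "\<And>y. ereal b < y \<Longrightarrow> h y = 0"
  shows "(\<integral>\<^sup>+ e. h (passage e) \<partial>density lborel (\<lambda>e. ennreal (exponential_density 1 e)))
    = (\<integral>\<^sup>+ v. ennreal (\<rho> v * exp (- hazard v)) * h (ereal v) * indicator {a..b} v \<partial>lborel)"
proof -
  have "(\<integral>\<^sup>+ e. h (passage e) \<partial>density lborel (\<lambda>e. ennreal (exponential_density 1 e)))
    = (\<integral>\<^sup>+ e. ennreal (exponential_density 1 e) * h (passage e) \<partial>lborel)"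
    by (subst nn_integral_density) auto
  also have "\<dots> = (\<integral>\<^sup>+ e. (\<lambda>v. ennreal (exp (- hazard v)) * h (ereal v)) (real_of_ereal (passage e)) * indicator {0..<hazard b} e \<partial>lborel)"
  proof (rule nn_integral_cong_AE, use AE_lborel_singleton[of "hazard b"] in eventually_elim)
    \<comment> \<open>At e = \<open>hazard b\<close> the passage time may be b or, if the hazard is
      flat after b, later; this one threshold is left out.\<close>
    fix e assume e: "e \<noteq> hazard b"
    consider "e < 0" | "0 \<le> e" "e < hazard b" | "0 \<le> e" "hazard b < e" using e by force
    then show "ennreal (exponential_density 1 e) * h (passage e) =
       (\<lambda>v. ennreal (exp (- hazard v)) * h (ereal v)) (real_of_ereal (passage e)) * indicator {0..<hazard b} e"
    proof cases
      case 1 then show ?thesis by (simp add: exponential_density_def)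
    next
      case 2
      then obtain v where v: "passage e = ereal v"
        using passage_finite[of e b] passage_ge[of e] by (cases "passage e") auto
      with 2 hazard_passage[of e] show ?thesis by (simp add: exponential_density_def)
    next
      \<comment> \<open>By continuity the hazard is still below the threshold slightly after b, so
        the passage time lies strictly beyond b, where h vanishes.\<close>
      case 3
      have "ereal b < passage e"
      proof (cases "a \<le> b")
        case True
        then obtain v where "v > b" "hazard v < e" using hazard_right 3 by blast
        then have "\<not> passage e < ereal v" by (simp add: passage_less_iff)
        then show ?thesis using \<open>v > b\<close> less_le_trans[of "ereal b" "ereal v" "passage e"] by simp
      next
        case False
        then show ?thesis using passage_ge[of e] less_le_trans[of "ereal b" "ereal a" "passage e"] by simp
      qed
      with 3 h show ?thesis by simp
    qed
  qed
  also have "\<dots> = (\<integral>\<^sup>+ v. ennreal (\<rho> v) * (ennreal (exp (- hazard v)) * h (ereal v)) * indicator {a..b} v \<partial>lborel)"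
    by (rule nn_integral_passage) measurable
  also have "\<dots> = (\<integral>\<^sup>+ v. ennreal (\<rho> v * exp (- hazard v)) * h (ereal v) * indicator {a..b} v \<partial>lborel)"
    using rate_nonneg by (intro nn_integral_cong) (simp add: ennreal_mult ac_simps)
  finally show ?thesis .
qed

text \<open>Computed from the complement, because beyond b the passage time may be infinite with
  positive probability.\<close>

lemma nn_integral_exponential_survival:
  assumes "a \<le> b"
  shows "(\<integral>\<^sup>+ e. indicator {ereal b<..} (passage e) \<partial>density lborel (\<lambda>e. ennreal (exponential_density 1 e)))
    = ennreal (exp (- hazard b))"
proof -
  let ?E = "density lborel (\<lambda>e. ennreal (exponential_density 1 e))"
  interpret E: prob_space ?E by (rule prob_space_exponential_density) simp
  have b: "(\<integral>\<^sup>+ e. indicator {..ereal b} (passage e) \<partial>?E) = ennreal (1 - exp (- hazard b))"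
    by (subst nn_integral_exponential_passage[where b=b])
      (auto simp: nn_integral_hazard_density[OF assms, symmetric] intro!: nn_integral_cong split: split_indicator)
  have "(\<integral>\<^sup>+ e. indicator {ereal b<..} (passage e) \<partial>?E) + (\<integral>\<^sup>+ e. indicator {..ereal b} (passage e) \<partial>?E)
     = (\<integral>\<^sup>+ e. indicator {ereal b<..} (passage e) + indicator {..ereal b} (passage e) \<partial>?E)"
    by (rule nn_integral_add[symmetric]) auto
  also have "\<dots> = (\<integral>\<^sup>+ e. 1 \<partial>?E)"
    by (intro nn_integral_cong) (auto split: split_indicator)
  also have "\<dots> = ennreal (exp (- hazard b)) + ennreal (1 - exp (- hazard b))"
    using hazard_nonneg by (subst ennreal_plus[symmetric]) (simp_all add: E.emeasure_space_1[simplified])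
  finally show ?thesis unfolding b by (simp add: ennreal_add_left_cancel add.commute)
qed

end

section \<open>Maximal couplings and the layer cake formula\<close>

text \<open>Provides the additions of measures out of which the coupling in
  \<open>tv_norm_diff_le\<close> is assembled.\<close>

lemma sum_measure_exists:
  assumes "sets N = sets M"
  shows "\<exists>K. sets K = sets M \<and> (\<forall>A\<in>sets M. emeasure K A = emeasure M A + emeasure N A)"
proof (intro exI conjI ballI)
  let ?K = "measure_of (space M) (sets M) (\<lambda>A. emeasure M A + emeasure N A)"
  show "sets ?K = sets M" by simp
  fix A assume "A \<in> sets M"
  show "emeasure ?K A = emeasure M A + emeasure N A"
  proof (rule emeasure_measure_of_sigma)
    show "sigma_algebra (space M) (sets M)" ..
    show "positive (sets M) (\<lambda>A. emeasure M A + emeasure N A)" by (simp add: positive_def)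
    show "countably_additive (sets M) (\<lambda>A. emeasure M A + emeasure N A)"
    proof (rule countably_additiveI)
      fix A :: "nat \<Rightarrow> _" assume "range A \<subseteq> sets M" "disjoint_family A"
      then show "(\<Sum>i. emeasure M (A i) + emeasure N (A i)) = emeasure M (\<Union>i. A i) + emeasure N (\<Union>i. A i)"
        using assms by (simp add: suminf_add[symmetric] suminf_emeasure)
    qed
  qed fact
qed

text \<open>With Y the Hahn set on which \<nu> lies below \<mu>, the mass common to both measures is
  that of \<mu> off Y plus that of \<nu> on Y, and a coupling can keep this mass on the diagonal.
  The hypothesis is applied to the single set A = complement of Y, where it bounds the remaining
  mass p by 1 - c.\<close>

lemma tv_norm_diff_le:
  assumes "prob_space \<mu>" "prob_space \<nu>" and sets: "sets \<nu> = sets \<mu>"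
    and c: "\<And>A. A \<in> sets \<mu> \<Longrightarrow> c \<le> measure \<mu> A + measure \<nu> (space \<mu> - A)"
  shows "tv_norm_diff \<mu> \<nu> \<le> 2 * (1 - c)"
proof -
  interpret \<mu>: prob_space \<mu> by fact
  interpret \<nu>: prob_space \<nu> by fact
  note [measurable_cong] = sets
  have sp: "space \<nu> = space \<mu>" by (rule sets_eq_imp_space_eq[OF sets])
  obtain Y where Y [measurable]: "Y \<in> sets \<mu>"
    and Y12: "\<forall>X\<in>sets \<mu>. X \<subseteq> Y \<longrightarrow> emeasure \<nu> X \<le> emeasure \<mu> X"
      "\<forall>X\<in>sets \<mu>. X \<inter> Y = {} \<longrightarrow> emeasure \<mu> X \<le> emeasure \<nu> X"
    using finite_unsigned_Hahn_decomposition[OF \<mu>.finite_measure_axioms \<nu>.finite_measure_axioms sets]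
    by (elim bexE conjE)
  note Y1 = Y12(1)[rule_format] and Y2 = Y12(2)[rule_format]
  \<comment> \<open>The coupling keeps the common part \<open>\<nu>\<close> on \<open>Y\<close> and \<open>\<mu>\<close> off \<open>Y\<close> on the diagonal and takes the
    normalised product of the two excess measures elsewhere; for \<open>p = 0\<close> the excess measures
    vanish, so the infinite factor \<open>1 / p\<close> is harmless.\<close>
  let ?Z = "space \<mu> - Y"
  define \<mu>Y \<mu>Z \<nu>Y \<nu>Z where "\<mu>Y = density \<mu> (indicator Y)" and "\<mu>Z = density \<mu> (indicator ?Z)"
    and "\<nu>Y = density \<nu> (indicator Y)" and "\<nu>Z = density \<nu> (indicator ?Z)"
  note defs = \<mu>Y_def \<mu>Z_def \<nu>Y_def \<nu>Z_def
  have s [simp, measurable_cong]: "sets \<mu>Y = sets \<mu>" "sets \<mu>Z = sets \<mu>" "sets \<nu>Y = sets \<mu>" "sets \<nu>Z = sets \<mu>"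
    using sets by (auto simp: defs)
  have s' [simp]: "space \<mu>Y = space \<mu>" "space \<mu>Z = space \<mu>" "space \<nu>Y = space \<mu>" "space \<nu>Z = space \<mu>"
    using sp by (auto simp: defs)
  have e: "emeasure \<mu>Y B = emeasure \<mu> (B \<inter> Y)" "emeasure \<mu>Z B = emeasure \<mu> (B \<inter> ?Z)"
    "emeasure \<nu>Y B = emeasure \<nu> (B \<inter> Y)" "emeasure \<nu>Z B = emeasure \<nu> (B \<inter> ?Z)" if B [measurable]: "B \<in> sets \<mu>" for B
  proof -
    have [measurable]: "B \<in> sets \<nu>" "Y \<in> sets \<nu>" "?Z \<in> sets \<nu>" using sets by auto
    show "emeasure \<mu>Y B = emeasure \<mu> (B \<inter> Y)" "emeasure \<mu>Z B = emeasure \<mu> (B \<inter> ?Z)"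
      "emeasure \<nu>Y B = emeasure \<nu> (B \<inter> Y)" "emeasure \<nu>Z B = emeasure \<nu> (B \<inter> ?Z)"
      unfolding defs by (simp_all add: emeasure_density indicator_inter_arith[symmetric] Int_commute)
  qed
  have fin: "finite_measure \<mu>Y" "finite_measure \<mu>Z" "finite_measure \<nu>Y" "finite_measure \<nu>Z"
    using sets.top[of \<mu>] by (auto intro!: finite_measureI simp: e sp[symmetric] simp del: sets.top)
  define \<alpha> \<beta> where "\<alpha> = diff_measure \<mu>Y \<nu>Y" and "\<beta> = diff_measure \<nu>Z \<mu>Z"
  have sab [simp, measurable_cong]: "sets \<alpha> = sets \<mu>" "sets \<beta> = sets \<mu>" by (auto simp: \<alpha>_def \<beta>_def)
  have sab' [simp]: "space \<alpha> = space \<mu>" "space \<beta> = space \<mu>" by (auto simp: \<alpha>_def \<beta>_def)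
  have ea: "emeasure \<alpha> B = emeasure \<mu> (B \<inter> Y) - emeasure \<nu> (B \<inter> Y)" if "B \<in> sets \<mu>" for B
    unfolding \<alpha>_def using that by (subst emeasure_diff_measure) (auto simp: fin e intro!: Y1)
  have eb: "emeasure \<beta> B = emeasure \<nu> (B \<inter> ?Z) - emeasure \<mu> (B \<inter> ?Z)" if "B \<in> sets \<mu>" for B
    unfolding \<beta>_def using that by (subst emeasure_diff_measure) (auto simp: fin e intro!: Y2)
  have addY: "emeasure \<nu> (B \<inter> Y) + emeasure \<alpha> B = emeasure \<mu> (B \<inter> Y)" if "B \<in> sets \<mu>" for B
    unfolding ea[OF that] using that Y1[of "B \<inter> Y"] by (simp add: ennreal_add_diff_cancel_right add_diff_inverse_ennreal)
  have addZ: "emeasure \<mu> (B \<inter> ?Z) + emeasure \<beta> B = emeasure \<nu> (B \<inter> ?Z)" if "B \<in> sets \<mu>" for B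
    unfolding eb[OF that] using that Y2[of "B \<inter> ?Z"] by (subst add_diff_inverse_ennreal) auto
  define p where "p = measure \<mu> Y - measure \<nu> Y"
  have pos: "0 \<le> p"
    using Y1[of Y] Y sets by (simp add: p_def \<mu>.emeasure_eq_measure \<nu>.emeasure_eq_measure)
  have Yn: "Y \<in> sets \<nu>" using Y sets by simp
  have pa: "emeasure \<alpha> (space \<mu>) = ennreal p"
    using Y sets.sets_into_space[OF Y]
    by (simp add: ea p_def \<mu>.emeasure_eq_measure \<nu>.emeasure_eq_measure ennreal_minus Int_absorb1)
  have pb: "emeasure \<beta> (space \<mu>) = ennreal p"
    using Y \<mu>.prob_compl[OF Y] \<nu>.prob_compl[OF Yn]
    by (simp add: eb p_def \<mu>.emeasure_eq_measure \<nu>.emeasure_eq_measure ennreal_minus Int_absorb1 sp)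
  have cp: "p \<le> 1 - c"
    using c[of ?Z] \<mu>.prob_compl[OF Y] sets.sets_into_space[OF Y] by (simp add: p_def double_diff)
  have finab: "finite_measure \<alpha>" "finite_measure \<beta>"
    by (auto intro!: finite_measureI simp: pa pb)
  interpret \<alpha>: finite_measure \<alpha> by (rule finab)
  interpret \<beta>: finite_measure \<beta> by (rule finab)
  let ?d = "\<lambda>x. (x, x)"
  have d [measurable]: "?d \<in> \<mu>Z \<rightarrow>\<^sub>M \<mu> \<Otimes>\<^sub>M \<nu>" "?d \<in> \<nu>Y \<rightarrow>\<^sub>M \<mu> \<Otimes>\<^sub>M \<nu>" by measurable
  obtain D where D: "sets D = sets (\<mu> \<Otimes>\<^sub>M \<nu>)"
    "\<And>B. B \<in> sets (\<mu> \<Otimes>\<^sub>M \<nu>) \<Longrightarrow> emeasure D B = emeasure (distr \<mu>Z (\<mu> \<Otimes>\<^sub>M \<nu>) ?d) B + emeasure (distr \<nu>Y (\<mu> \<Otimes>\<^sub>M \<nu>) ?d) B"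
    using sum_measure_exists[of "distr \<nu>Y (\<mu> \<Otimes>\<^sub>M \<nu>) ?d" "distr \<mu>Z (\<mu> \<Otimes>\<^sub>M \<nu>) ?d"] by auto
  have sP: "sets (\<alpha> \<Otimes>\<^sub>M \<beta>) = sets (\<mu> \<Otimes>\<^sub>M \<nu>)" using sets by (intro sets_pair_measure_cong) auto
  obtain \<xi> where \<xi>: "sets \<xi> = sets (\<mu> \<Otimes>\<^sub>M \<nu>)"
    "\<And>B. B \<in> sets (\<mu> \<Otimes>\<^sub>M \<nu>) \<Longrightarrow> emeasure \<xi> B = emeasure D B + emeasure (scale_measure (1 / ennreal p) (\<alpha> \<Otimes>\<^sub>M \<beta>)) B"
    using sum_measure_exists[of "scale_measure (1 / ennreal p) (\<alpha> \<Otimes>\<^sub>M \<beta>)" D] D(1) sP by auto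
  have \<xi>: "sets \<xi> = sets (\<mu> \<Otimes>\<^sub>M \<nu>)"
    "\<And>B. B \<in> sets (\<mu> \<Otimes>\<^sub>M \<nu>) \<Longrightarrow> emeasure \<xi> B =
      emeasure \<mu>Z (?d -` B \<inter> space \<mu>) + emeasure \<nu>Y (?d -` B \<inter> space \<mu>) + 1 / ennreal p * emeasure (\<alpha> \<Otimes>\<^sub>M \<beta>) B"
    using \<xi> D by (auto simp: emeasure_distr)
  have cancel: "1 / ennreal p * (x * ennreal p) = x" if "x \<le> ennreal p" for x
  proof (cases "p = 0")
    case True then show ?thesis using that by simp
  next
    case False
    then have "1 / ennreal p * (x * ennreal p) = x * (ennreal p / ennreal p)"
      by (simp add: ennreal_times_divide mult.commute ennreal_divide_times)
    then show ?thesis using False pos by simp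
  qed
  have "\<xi> \<in> couplings \<mu> \<nu>"
    unfolding couplings_def
  proof (safe intro!: \<xi>(1) measure_eqI)
    note [measurable_cong] = \<xi>(1)
    have spx: "space \<xi> = space \<mu> \<times> space \<mu>"
      using sets_eq_imp_space_eq[OF \<xi>(1)] by (simp add: space_pair_measure sp)
    fix B
    {
      assume "B \<in> sets (distr \<xi> \<mu> fst)"
      then have B [measurable]: "B \<in> sets \<mu>" by simp
      have "fst -` B \<inter> space \<xi> = B \<times> space \<mu>"
        using sets.sets_into_space[OF B] spx by auto
      then have "emeasure (distr \<xi> \<mu> fst) B = emeasure \<xi> (B \<times> space \<mu>)"
        by (subst emeasure_distr) auto
      also have "\<dots> = emeasure \<mu>Z B + emeasure \<nu>Y B + 1 / ennreal p * (emeasure \<alpha> B * ennreal p)"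
        using sets.sets_into_space[OF B] B sets.top[of \<nu>]
        by (subst \<xi>(2)) (auto simp: \<beta>.emeasure_pair_measure_Times pb sp Int_absorb2 vimage_def Int_def
          intro!: arg_cong2[where f="(+)"] arg_cong[where f="emeasure _"] simp del: sets.top)
      also have "\<dots> = emeasure \<mu>Z B + (emeasure \<nu>Y B + emeasure \<alpha> B)"
        using emeasure_mono[OF sets.sets_into_space[OF B], of \<alpha>] pa by (subst cancel) (auto simp: add.assoc)
      also have "\<dots> = emeasure \<mu> (B \<inter> ?Z) + emeasure \<mu> (B \<inter> Y)" by (simp add: e addY)
      also have "\<dots> = emeasure \<mu> B"
        using sets.sets_into_space[OF B] by (subst plus_emeasure) (auto intro!: arg_cong[where f="emeasure _"])
      finally show "emeasure (distr \<xi> \<mu> fst) B = emeasure \<mu> B" .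
    next
      assume "B \<in> sets (distr \<xi> \<nu> snd)"
      then have B [measurable]: "B \<in> sets \<mu>" using sets by simp
      have "snd -` B \<inter> space \<xi> = space \<mu> \<times> B"
        using sets.sets_into_space[OF B] spx by auto
      then have "emeasure (distr \<xi> \<nu> snd) B = emeasure \<xi> (space \<mu> \<times> B)"
        using sets by (subst emeasure_distr) auto
      also have "\<dots> = emeasure \<mu>Z B + emeasure \<nu>Y B + 1 / ennreal p * (emeasure \<beta> B * ennreal p)"
        using sets.sets_into_space[OF B] B sets.top[of \<mu>] sets
        by (subst \<xi>(2)) (auto simp: \<beta>.emeasure_pair_measure_Times pa sp Int_absorb2 vimage_def Int_def mult.commute
          intro!: arg_cong2[where f="(+)"] arg_cong[where f="emeasure _"] simp del: sets.top)
      also have "\<dots> = (emeasure \<mu>Z B + emeasure \<beta> B) + emeasure \<nu>Y B"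
        using emeasure_mono[OF sets.sets_into_space[OF B], of \<beta>] pb by (subst cancel) (auto simp: ac_simps)
      also have "\<dots> = emeasure \<nu> (B \<inter> ?Z) + emeasure \<nu> (B \<inter> Y)" by (simp add: e addZ)
      also have "\<dots> = emeasure \<nu> B"
        using sets.sets_into_space[OF B] sets by (subst plus_emeasure) (auto intro!: arg_cong[where f="emeasure _"])
      finally show "emeasure (distr \<xi> \<nu> snd) B = emeasure \<nu> B" .
    }
  qed (auto simp: sets)
  moreover have "measure \<xi> {z \<in> space \<xi>. fst z \<noteq> snd z} \<le> p"
  \<comment> \<open>In an abstract space the diagonal may fail to be measurable for the product;
    \<open>measure\<close> is then 0 by convention.\<close>
  proof (cases "{z \<in> space \<xi>. fst z \<noteq> snd z} \<in> sets \<xi>")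
    case True
    then have *: "{z \<in> space \<xi>. fst z \<noteq> snd z} \<in> sets (\<mu> \<Otimes>\<^sub>M \<nu>)" using \<xi>(1) by simp
    have "emeasure \<xi> {z \<in> space \<xi>. fst z \<noteq> snd z} = 1 / ennreal p * emeasure (\<alpha> \<Otimes>\<^sub>M \<beta>) {z \<in> space \<xi>. fst z \<noteq> snd z}"
      by (subst \<xi>(2)[OF *]) (auto simp: vimage_def)
    also have "\<dots> \<le> 1 / ennreal p * emeasure (\<alpha> \<Otimes>\<^sub>M \<beta>) (space \<mu> \<times> space \<mu>)"
      using sets_eq_imp_space_eq[OF \<xi>(1)] sP sets.top[of "\<mu> \<Otimes>\<^sub>M \<nu>"]
      by (intro mult_left_mono emeasure_mono) (auto simp: space_pair_measure sp)
    also have "\<dots> = ennreal p"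
      using sets.top[of \<mu>] by (subst \<beta>.emeasure_pair_measure_Times) (auto simp: pa pb cancel simp del: sets.top)
    finally show ?thesis unfolding measure_def by (metis enn2real_ennreal enn2real_mono ennreal_less_top pos)
  qed (use pos in \<open>simp add: measure_notin_sets\<close>)
  ultimately have "(INF \<xi>\<in>couplings \<mu> \<nu>. measure \<xi> {z \<in> space \<xi>. fst z \<noteq> snd z}) \<le> p"
    by (intro cINF_lower2) (auto intro!: bdd_belowI[where m=0])
  then have "(INF \<xi>\<in>couplings \<mu> \<nu>. measure \<xi> {z \<in> space \<xi>. fst z \<noteq> snd z}) \<le> 1 - c"
    using cp by (rule order_trans)
  then show ?thesis unfolding tv_norm_diff_def by (rule mult_left_mono) simp
qed

text \<open>A value f x is the length of [0, f x), with negative values counted as 0 on both sides,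
  and Fubini does the rest. Levels stop at c, so a bound valid at every level is later multiplied by
  c only.\<close>

lemma nn_integral_layer_cake:
  fixes f :: "'a \<Rightarrow> real"
  assumes "sigma_finite_measure M" and [measurable]: "f \<in> borel_measurable M"
    and f: "\<And>x. x \<in> space M \<Longrightarrow> f x \<le> c"
  shows "(\<integral>\<^sup>+ x. ennreal (f x) \<partial>M)
    = (\<integral>\<^sup>+ y. emeasure M {x \<in> space M. y < f x} * indicator {0..<c} y \<partial>lborel)"
proof -
  interpret sigma_finite_measure M by fact
  interpret pair_sigma_finite M lborel ..
  have "(\<integral>\<^sup>+ x. ennreal (f x) \<partial>M)
    = (\<integral>\<^sup>+ x. \<integral>\<^sup>+ y. (if y < f x then 1 else 0) * indicator {0..<c} y \<partial>lborel \<partial>M)"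
  proof (rule nn_integral_cong)
    fix x assume "x \<in> space M"
    have "ennreal (f x) = (\<integral>\<^sup>+ y. indicator {0..<f x} y \<partial>lborel)" by (cases "0 \<le> f x") (simp_all add: ennreal_neg)
    also have "\<dots> = (\<integral>\<^sup>+ y. (if y < f x then 1 else 0) * indicator {0..<c} y \<partial>lborel)"
      using f[OF \<open>x \<in> space M\<close>] by (intro nn_integral_cong) (auto split: split_indicator)
    finally show "ennreal (f x) = \<dots>" .
  qed
  also have "\<dots> = (\<integral>\<^sup>+ y. \<integral>\<^sup>+ x. (if y < f x then 1 else 0) * indicator {0..<c} y \<partial>M \<partial>lborel)"
    by (rule Fubini'[symmetric]) measurable
  also have "\<dots> = (\<integral>\<^sup>+ y. emeasure M {x \<in> space M. y < f x} * indicator {0..<c} y \<partial>lborel)"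
  proof (rule nn_integral_cong)
    fix y
    have "(\<integral>\<^sup>+ x. (if y < f x then 1 else 0) * indicator {0..<c} y \<partial>M)
      = (\<integral>\<^sup>+ x. indicator {x \<in> space M. y < f x} x * indicator {0..<c} y \<partial>M)"
      by (rule nn_integral_cong) (simp split: split_indicator)
    also have "\<dots> = emeasure M {x \<in> space M. y < f x} * indicator {0..<c} y"
      by (subst nn_integral_multc) auto
    finally show "(\<integral>\<^sup>+ x. (if y < f x then 1 else 0) * indicator {0..<c} y \<partial>M)
      = emeasure M {x \<in> space M. y < f x} * indicator {0..<c} y" .
  qed
  finally show ?thesis .
qed

text \<open>The layer cake formula for \<open>Q1\<close>, \<open>Q2\<close> and the Dirac mass at x
  writes both generators as integrals over superlevel sets of f. The gap on sets is applied at each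
  level and integrated over [0,c).\<close>

lemma generator_diff_le:
  fixes f :: "'a \<Rightarrow> real"
  assumes Q1: "Q1 \<in> space (prob_algebra N)" and Q2: "Q2 \<in> space (prob_algebra N)" and x: "x \<in> space N"
    and r: "0 \<le> r1" "0 \<le> r2" "0 \<le> \<gamma>"
    and gap: "\<And>A. A \<in> sets N \<Longrightarrow>
      r2 * (measure Q2 A - indicator A x) - r1 * (measure Q1 A - indicator A x) \<le> \<gamma>"
    and f [measurable]: "f \<in> borel_measurable N"
    and c: "\<And>y. y \<in> space N \<Longrightarrow> 0 \<le> f y" "\<And>y. y \<in> space N \<Longrightarrow> f y \<le> c"
  shows "r2 * ((\<integral>y. f y \<partial>Q2) - f x) - r1 * ((\<integral>y. f y \<partial>Q1) - f x) \<le> \<gamma> * c"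
proof -
  have Qs [measurable_cong, simp]: "sets Q1 = sets N" "sets Q2 = sets N" and Qp: "prob_space Q1" "prob_space Q2"
    using Q1 Q2 by (auto simp: space_prob_algebra)
  interpret Q1: prob_space Q1 by (rule Qp)
  interpret Q2: prob_space Q2 by (rule Qp)
  interpret X: prob_space "return N x" using x by (rule prob_space_return)
  have sp: "space Q1 = space N" "space Q2 = space N" using Qs[THEN sets_eq_imp_space_eq] by auto
  let ?A = "\<lambda>y. {x \<in> space N. y < f x}"
  have c0: "0 \<le> c" using c x by fastforce
  have lc: "(\<integral>\<^sup>+ x. ennreal (f x) \<partial>M) = (\<integral>\<^sup>+ y. emeasure M (?A y) * indicator {0..<c} y \<partial>lborel)"
    and me: "(\<lambda>y. emeasure M (?A y)) \<in> borel_measurable lborel"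
    if "prob_space M" "sets M = sets N" for M
  proof -
    interpret prob_space M by fact
    note [measurable_cong] = that(2)
    have sM: "space M = space N" using that(2) by (rule sets_eq_imp_space_eq)
    show "(\<integral>\<^sup>+ x. ennreal (f x) \<partial>M) = (\<integral>\<^sup>+ y. emeasure M (?A y) * indicator {0..<c} y \<partial>lborel)"
      using nn_integral_layer_cake[of M f c] c sM sigma_finite_measure_axioms by auto
    have "(\<lambda>y. emeasure M {x \<in> space M. y < f x}) \<in> borel_measurable lborel" by measurable
    then show "(\<lambda>y. emeasure M (?A y)) \<in> borel_measurable lborel" by (simp add: sM)
  qed
  note [measurable] = me[OF Qp(1)] me[OF Qp(2)] me[OF X.prob_space_axioms]
  have int: "(\<integral>\<^sup>+ x. ennreal (f x) \<partial>M) = ennreal (\<integral>x. f x \<partial>M)" if "prob_space M" "sets M = sets N" for M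
  proof -
    interpret prob_space M by fact
    note [measurable_cong] = that(2)
    have sM: "space M = space N" using that(2) by (rule sets_eq_imp_space_eq)
    have "integrable M f" using c by (intro integrable_const_bound[where B=c] AE_I2) (auto simp: sM)
    then show ?thesis using c by (intro nn_integral_eq_integral AE_I2) (auto simp: sM)
  qed
  have nn: "0 \<le> (\<integral>y. f y \<partial>Q1)" "0 \<le> (\<integral>y. f y \<partial>Q2)" "0 \<le> f x"
    using c x by (auto intro!: Bochner_Integration.integral_nonneg simp: sp)
  have rx: "(\<integral>y. f y \<partial>return N x) = f x" using x by (simp add: integral_return)
  \<comment> \<open>Negative terms have been moved to the other side, so that the whole comparison
    takes place among nonnegative quantities in \<open>ennreal\<close>.\<close>
  have "ennreal (r2 * (\<integral>y. f y \<partial>Q2) + r1 * f x)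
     = ennreal r2 * (\<integral>\<^sup>+y. ennreal (f y) \<partial>Q2) + ennreal r1 * (\<integral>\<^sup>+y. ennreal (f y) \<partial>return N x)"
    using r nn by (simp add: int Qp(2) X.prob_space_axioms rx ennreal_mult)
  also have "\<dots> = (\<integral>\<^sup>+ y. (ennreal r2 * emeasure Q2 (?A y) + ennreal r1 * emeasure (return N x) (?A y)) * indicator {0..<c} y \<partial>lborel)"
    by (simp add: lc Qp(2) X.prob_space_axioms nn_integral_add distrib_right mult.assoc nn_integral_cmult)
  also have "\<dots> \<le> (\<integral>\<^sup>+ y. (ennreal r1 * emeasure Q1 (?A y) + ennreal r2 * emeasure (return N x) (?A y) + ennreal \<gamma>) * indicator {0..<c} y \<partial>lborel)"
  proof (intro nn_integral_mono mult_right_mono)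
    fix y :: real
    have "?A y \<in> sets N" by measurable
    then show "ennreal r2 * emeasure Q2 (?A y) + ennreal r1 * emeasure (return N x) (?A y)
      \<le> ennreal r1 * emeasure Q1 (?A y) + ennreal r2 * emeasure (return N x) (?A y) + ennreal \<gamma>"
      using gap[of "?A y"] r
      by (simp add: Q1.emeasure_eq_measure Q2.emeasure_eq_measure X.emeasure_eq_measure measure_return
        ennreal_mult[symmetric] ennreal_plus[symmetric] algebra_simps del: ennreal_plus)
  qed simp
  also have "\<dots> = ennreal r1 * (\<integral>\<^sup>+y. ennreal (f y) \<partial>Q1) + ennreal r2 * (\<integral>\<^sup>+y. ennreal (f y) \<partial>return N x) + ennreal \<gamma> * ennreal c"
    using c0 by (simp add: lc Qp(1) X.prob_space_axioms nn_integral_add distrib_right mult.assoc nn_integral_cmult)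
  also have "\<dots> = ennreal (r1 * (\<integral>y. f y \<partial>Q1) + r2 * f x + \<gamma> * c)"
    using r nn c0 by (simp add: int Qp(1) X.prob_space_axioms rx ennreal_mult)
  finally have "r2 * (\<integral>y. f y \<partial>Q2) + r1 * f x \<le> r1 * (\<integral>y. f y \<partial>Q1) + r2 * f x + \<gamma> * c"
    using r nn c0 by (subst (asm) ennreal_le_iff) auto
  then show ?thesis by (simp add: algebra_simps)
qed

section \<open>Linear integral equations and inequalities driven by a hazard\<close>

context hazard_rate begin

lemma set_integrable_rate_bounded:
  assumes [measurable]: "q \<in> borel_measurable borel" and q: "\<And>v. v \<in> {a..b} \<Longrightarrow> \<bar>q v\<bar> \<le> C"
  shows "set_integrable lborel {a..b} (\<lambda>v. \<rho> v * q v)"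
  unfolding set_integrable_def
proof (rule Bochner_Integration.integrable_bound)
  show "integrable lborel (\<lambda>v. C * (indicator {a..b} v *\<^sub>R \<rho> v))"
    using rate_integrable[of b] unfolding set_integrable_def by (rule integrable_mult_right)
  have "\<bar>\<rho> v * q v\<bar> \<le> \<bar>C * \<rho> v\<bar>" if "v \<in> {a..b}" for v
    using q[OF that] rate_nonneg[of v] mult_left_mono[of "\<bar>q v\<bar>" C "\<rho> v"]
    by (simp add: abs_mult mult.commute)
  then show "AE v in lborel. norm (indicator {a..b} v *\<^sub>R (\<rho> v * q v)) \<le> norm (C * (indicator {a..b} v *\<^sub>R \<rho> v))"
    by (auto split: split_indicator)
qed measurable

lemma exp_hazard_le_1: "exp (- hazard v) \<le> 1"
  using hazard_nonneg[of v] by simp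

text \<open>The right-hand side of the equation has derivative - \<rho> exp (- hazard) q in v, and
  the integrating factor exp (hazard) recovers h. In classical terms, h' = \<rho> (h - q).\<close>

lemma primitive_renewal:
  assumes [measurable]: "q \<in> borel_measurable borel" and q: "\<And>v. v \<in> {a..b} \<Longrightarrow> 0 \<le> q v \<and> q v \<le> 1"
    and h: "\<And>v. v \<in> {a..b} \<Longrightarrow> exp (- hazard v) * h v = C + (LINT w:{v..b}|lborel. \<rho> w * exp (- hazard w) * q w)"
  shows "primitive_on a b h (\<lambda>v. \<rho> v * (h v - q v))"
proof (cases "a \<le> b")
  case True
  let ?p = "\<lambda>w. \<rho> w * exp (- hazard w) * q w"
  have "set_integrable lborel {a..b} (\<lambda>w. \<rho> w * (exp (- hazard w) * q w))"
    using q exp_hazard_le_1 by (intro set_integrable_rate_bounded[where C=1]) (auto simp: abs_mult intro!: mult_le_one)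
  then have int: "set_integrable lborel {a..b} ?p" by (simp add: mult.assoc)
  have p1: "primitive_on a b (\<lambda>v. exp (- hazard v) * h v) (\<lambda>v. - 1 * ?p v)"
    unfolding primitive_on_def
  proof safe
    show "set_integrable lborel {a..b} (\<lambda>v. - 1 * ?p v)" using int by (intro set_integrable_mult_right) simp
    fix v assume v: "v \<in> {a..b}"
    have "exp (- hazard a) * h a = C + (LINT w:{a..b}|lborel. ?p w)"
      using True by (intro h) simp
    moreover have "(LINT w:{a..b}|lborel. ?p w) = (LINT w:{a..v}|lborel. ?p w) + (LINT w:{v..b}|lborel. ?p w)"
      using v by (intro set_lebesgue_integral_Icc_combine[OF int]) auto
    ultimately show "exp (- hazard v) * h v = exp (- hazard a) * h a + (LINT w:{a..v}|lborel. - 1 * ?p w)"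
      using h[OF v] unfolding set_integral_mult_right by linarith
  qed
  have p2: "primitive_on a b (\<lambda>v. exp (hazard v)) (\<lambda>v. \<rho> v * exp (hazard v))"
    using primitive_exp_hazard[of 1 b] by simp
  show ?thesis
    by (rule primitive_on_cong[OF primitive_on_mult[OF p1 p2]])
      (simp_all add: exp_minus field_simps)
qed (simp add: primitive_on_def set_integrable_def)

text \<open>A Gronwall estimate run backwards from b: exp (- hazard) y has derivative at least -
  \<rho> exp (- hazard) q, and its boundary value at b is dropped, being at most 0. The inequality
  is asked strictly before b because it will be known only up to a stopping time.\<close>

lemma hazard_comparison:
  assumes y: "primitive_on a b y y'" and "a \<le> b" and "y b \<le> 0"
    and le: "\<And>v. a \<le> v \<Longrightarrow> v < b \<Longrightarrow> \<rho> v * (y v - q v) \<le> y' v"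
    and [measurable]: "q \<in> borel_measurable borel" and q: "\<And>v. v \<in> {a..b} \<Longrightarrow> 0 \<le> q v \<and> q v \<le> 1"
  shows "y a \<le> (LINT v:{a..b}|lborel. \<rho> v * exp (- hazard v) * q v)"
proof -
  have p: "primitive_on a b (\<lambda>v. exp (- hazard v)) (\<lambda>v. - 1 * (\<rho> v * exp (- hazard v)))"
    using primitive_exp_hazard[of "-1" b] by simp
  let ?z = "\<lambda>v. - 1 * (\<rho> v * exp (- hazard v)) * y v + exp (- hazard v) * y' v"
  note py = primitive_on_mult[OF p y]
  have "set_integrable lborel {a..b} (\<lambda>w. \<rho> w * (exp (- hazard w) * q w))"
    using q exp_hazard_le_1 by (intro set_integrable_rate_bounded[where C=1]) (auto simp: abs_mult intro!: mult_le_one)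
  then have int: "set_integrable lborel {a..b} (\<lambda>w. \<rho> w * exp (- hazard w) * q w)" by (simp add: mult.assoc)
  have "y a = exp (- hazard b) * y b - (LINT v:{a..b}|lborel. ?z v)"
    using primitive_onD[OF py, of b] \<open>a \<le> b\<close> by simp
  also have "\<dots> \<le> - (LINT v:{a..b}|lborel. ?z v)"
    using \<open>y b \<le> 0\<close> by (simp add: mult_nonneg_nonpos)
  also have "\<dots> = (LINT v:{a..b}|lborel. - 1 * ?z v)"
    by (simp only: set_integral_mult_right)
  also have "\<dots> \<le> (LINT v:{a..b}|lborel. \<rho> v * exp (- hazard v) * q v)"
    unfolding set_lebesgue_integral_def
  proof (rule integral_mono_AE)
    show "integrable lborel (\<lambda>v. indicator {a..b} v *\<^sub>R (- 1 * ?z v))"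
      using set_integrable_mult_right[of "-1" lborel "{a..b}" ?z] py
      unfolding primitive_on_def set_integrable_def by blast
    show "integrable lborel (\<lambda>v. indicator {a..b} v *\<^sub>R (\<rho> v * exp (- hazard v) * q v))"
      using int unfolding set_integrable_def .
    \<comment> \<open>The drift inequality says nothing at v = b, a null set.\<close>
    have "- 1 * ?z v \<le> \<rho> v * exp (- hazard v) * q v" if "v \<in> {a..b}" "v \<noteq> b" for v
      using mult_left_mono[OF le[of v], of "exp (- hazard v)"] that by (simp add: algebra_simps)
    then have ae: "indicator {a..b} v *\<^sub>R (- 1 * ?z v) \<le> indicator {a..b} v *\<^sub>R (\<rho> v * exp (- hazard v) * q v)"
      if "v \<noteq> b" for v
      using that by (cases "v \<in> {a..b}") (simp_all only: indicator_simps(1) indicator_simps(2)[of v] scaleR_one scaleR_zero_left order.refl simp_thms)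
    show "AE v in lborel. indicator {a..b} v *\<^sub>R (- 1 * ?z v) \<le> indicator {a..b} v *\<^sub>R (\<rho> v * exp (- hazard v) * q v)"
    proof (rule AE_mp[OF AE_lborel_singleton[of b]], rule AE_I2, rule impI)
      fix v assume "v \<noteq> b"
      then show "indicator {a..b} v *\<^sub>R (- 1 * ?z v) \<le> indicator {a..b} v *\<^sub>R (\<rho> v * exp (- hazard v) * q v)"
        by (rule ae)
    qed
  qed
  finally show ?thesis .
qed

end

section \<open>Renewal equations along a flow\<close>

locale measurable_flow =
  fixes N :: "'a measure" and \<psi> :: "real \<Rightarrow> real \<Rightarrow> 'a \<Rightarrow> 'a"
  assumes flow_measurable: "(\<lambda>(s, v, x). \<psi> s v x) \<in> borel \<Otimes>\<^sub>M (borel \<Otimes>\<^sub>M N) \<rightarrow>\<^sub>M N"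
    and flow_id: "x \<in> space N \<Longrightarrow> \<psi> s s x = x"
    and flow_flow: "x \<in> space N \<Longrightarrow> a \<le> b \<Longrightarrow> b \<le> c \<Longrightarrow> \<psi> b c (\<psi> a b x) = \<psi> a c x"
begin

lemma flow_measurable' [measurable (raw)]:
  assumes "f \<in> K \<rightarrow>\<^sub>M borel" "g \<in> K \<rightarrow>\<^sub>M borel" "h \<in> K \<rightarrow>\<^sub>M N"
  shows "(\<lambda>w. \<psi> (f w) (g w) (h w)) \<in> K \<rightarrow>\<^sub>M N"
proof -
  have "(\<lambda>w. (f w, g w, h w)) \<in> K \<rightarrow>\<^sub>M borel \<Otimes>\<^sub>M (borel \<Otimes>\<^sub>M N)" using assms by measurable
  from measurable_compose[OF this flow_measurable] show ?thesis by simp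
qed

lemma flow_in_space [simp]: "x \<in> space N \<Longrightarrow> \<psi> s v x \<in> space N"
  using measurable_space[OF flow_measurable, of "(s, v, x)"] by (simp add: space_pair_measure)

end

text \<open>A jump rate is bounded on compact sets but possibly not globally, so boundedness is
  asked along finite stretches of flow lines; this makes every flow line an instance of
  \<open>hazard_rate\<close>. A kernel measurable into \<open>prob_algebra N\<close> has integrals
  that are measurable in their parameters.\<close>

locale jump_flow = measurable_flow N \<psi> for N :: "'a measure" and \<psi> +
  fixes \<rho> :: "real \<Rightarrow> 'a \<Rightarrow> real" and Q :: "real \<Rightarrow> 'a \<Rightarrow> 'a measure"
  assumes rate_measurable: "(\<lambda>(v, x). \<rho> v x) \<in> borel_measurable (borel \<Otimes>\<^sub>M N)"
    and rate_nonneg: "0 \<le> \<rho> v x"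
    and rate_bounded: "x \<in> space N \<Longrightarrow> \<exists>B. \<forall>v\<in>{a..b}. \<rho> v (\<psi> a v x) \<le> B"
    and kernel_measurable: "(\<lambda>(v, x). Q v x) \<in> borel \<Otimes>\<^sub>M N \<rightarrow>\<^sub>M prob_algebra N"
begin

lemma rate_measurable' [measurable (raw)]:
  assumes "f \<in> K \<rightarrow>\<^sub>M borel" "h \<in> K \<rightarrow>\<^sub>M N"
  shows "(\<lambda>w. \<rho> (f w) (h w)) \<in> borel_measurable K"
proof -
  have "(\<lambda>w. (f w, h w)) \<in> K \<rightarrow>\<^sub>M borel \<Otimes>\<^sub>M N" using assms by measurable
  from measurable_compose[OF this rate_measurable] show ?thesis by simp
qed

lemma kernel_measurable' [measurable (raw)]:
  assumes "f \<in> K \<rightarrow>\<^sub>M borel" "h \<in> K \<rightarrow>\<^sub>M N"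
  shows "(\<lambda>w. Q (f w) (h w)) \<in> K \<rightarrow>\<^sub>M prob_algebra N"
proof -
  have "(\<lambda>w. (f w, h w)) \<in> K \<rightarrow>\<^sub>M borel \<Otimes>\<^sub>M N" using assms by measurable
  from measurable_compose[OF this kernel_measurable] show ?thesis by simp
qed

lemma kernel_in_prob_algebra: "x \<in> space N \<Longrightarrow> Q v x \<in> space (prob_algebra N)"
  using measurable_space[OF kernel_measurable, of "(v, x)"] by (simp add: space_pair_measure)

lemma prob_space_kernel: "x \<in> space N \<Longrightarrow> prob_space (Q v x)"
  and sets_kernel [simp, measurable_cong]: "x \<in> space N \<Longrightarrow> sets (Q v x) = sets N"
  and space_kernel [simp]: "x \<in> space N \<Longrightarrow> space (Q v x) = space N"
  using kernel_in_prob_algebra[of x v] by (auto simp: space_prob_algebra dest: sets_eq_imp_space_eq)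

lemma nn_integral_kernel_measurable [measurable (raw)]:
  assumes "case_prod f \<in> borel_measurable (borel \<Otimes>\<^sub>M N)" "b \<in> K \<rightarrow>\<^sub>M borel" "h \<in> K \<rightarrow>\<^sub>M N"
  shows "(\<lambda>w. \<integral>\<^sup>+ y. f (b w) y \<partial>Q (b w) (h w)) \<in> borel_measurable K"
proof (rule nn_integral_measurable_subprob_algebra2)
  have "(\<lambda>p. (b (fst p), snd p)) \<in> K \<Otimes>\<^sub>M N \<rightarrow>\<^sub>M borel \<Otimes>\<^sub>M N" using assms by measurable
  from measurable_compose[OF this assms(1)]
  show "(\<lambda>(x, y). f (b x) y) \<in> borel_measurable (K \<Otimes>\<^sub>M N)" by (simp add: split_beta')
  show "(\<lambda>w. Q (b w) (h w)) \<in> K \<rightarrow>\<^sub>M subprob_algebra N"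
    using assms by (intro measurable_prob_algebraD) measurable
qed

lemma hazard_rate_flow:
  assumes x: "x \<in> space N"
  shows "hazard_rate (\<lambda>w. \<rho> w (\<psi> s w x)) s"
proof
  show m [measurable]: "(\<lambda>w. \<rho> w (\<psi> s w x)) \<in> borel_measurable borel" using x by measurable
  show "0 \<le> \<rho> v (\<psi> s v x)" for v by (rule rate_nonneg)
  fix b
  obtain B where B: "\<And>v. v \<in> {s..b} \<Longrightarrow> \<rho> v (\<psi> s v x) \<le> B" using rate_bounded[OF x, of s b] by blast
  show "set_integrable lborel {s..b} (\<lambda>w. \<rho> w (\<psi> s w x))"
    unfolding set_integrable_def
  proof (rule Bochner_Integration.integrable_bound)
    show "integrable lborel (\<lambda>w. indicator {s..b} w *\<^sub>R B)" by (auto simp: integrable_indicator_iff emeasure_lborel_Icc_eq)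
    have "norm (\<rho> v (\<psi> s v x)) \<le> norm B" if "v \<in> {s..b}" for v
      using B[OF that] rate_nonneg[of v "\<psi> s v x"] by simp
    then show "AE w in lborel. norm (indicator {s..b} w *\<^sub>R \<rho> w (\<psi> s w x)) \<le> norm (indicator {s..b} w *\<^sub>R B)"
      by (auto split: split_indicator)
  qed measurable
qed

definition flow_hazard :: "real \<Rightarrow> real \<Rightarrow> 'a \<Rightarrow> real" where
  "flow_hazard s v x = hazard_rate.hazard (\<lambda>w. \<rho> w (\<psi> s w x)) s v"

lemma flow_hazard_eq: "x \<in> space N \<Longrightarrow> flow_hazard s v x = (LINT w:{s..v}|lborel. \<rho> w (\<psi> s w x))"
  unfolding flow_hazard_def by (rule hazard_rate.hazard_def[OF hazard_rate_flow])

lemma flow_hazard_measurable' [measurable (raw)]: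
  assumes [measurable]: "f \<in> K \<rightarrow>\<^sub>M borel" "g \<in> K \<rightarrow>\<^sub>M borel" "h \<in> K \<rightarrow>\<^sub>M N"
  shows "(\<lambda>w. flow_hazard (f w) (g w) (h w)) \<in> borel_measurable K"
proof -
  have "(\<lambda>p. indicator {f (fst p)..g (fst p)} (snd p) *\<^sub>R \<rho> (snd p) (\<psi> (f (fst p)) (snd p) (h (fst p))))
      \<in> borel_measurable (K \<Otimes>\<^sub>M lborel)"
    unfolding indicator_def atLeastAtMost_iff by measurable
  then have "(\<lambda>z. LINT w|lborel. indicator {f z..g z} w *\<^sub>R \<rho> w (\<psi> (f z) w (h z))) \<in> borel_measurable K"
    by (intro lborel.borel_measurable_lebesgue_integral) (simp add: split_beta')
  then show ?thesis
    using measurable_space[OF assms(3)]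
    by (subst measurable_cong[OF flow_hazard_eq]) (auto simp: set_lebesgue_integral_def)
qed

text \<open>By the flow property the restarted flow line is the old one, so only the hazard
  accumulated before a is lost.\<close>

lemma flow_hazard_split:
  assumes x: "x \<in> space N" and "s \<le> a" "a \<le> v"
  shows "flow_hazard a v (\<psi> s a x) = flow_hazard s v x - flow_hazard s a x"
proof -
  interpret hazard_rate "\<lambda>w. \<rho> w (\<psi> s w x)" s by (rule hazard_rate_flow[OF x])
  have "flow_hazard a v (\<psi> s a x) = (LINT w:{a..v}|lborel. \<rho> w (\<psi> a w (\<psi> s a x)))"
    using x by (simp add: flow_hazard_eq)
  also have "\<dots> = (LINT w:{a..v}|lborel. \<rho> w (\<psi> s w x))"
    using assms by (intro set_lebesgue_integral_cong) (auto simp: flow_flow)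
  finally show ?thesis
    using primitive_on_diff[OF primitive_hazard, of a v v] assms by (simp add: flow_hazard_def)
qed

text \<open>\<open>jump_op t f s x\<close> is the expectation of \<open>f\<close> at the first jump after time \<open>s\<close>, from position
  \<open>x\<close>, on the event that it occurs before \<open>t\<close>; \<open>stay t A\<close> is the probability of having no such jump
  and being in \<open>A\<close> at time \<open>t\<close>. The sum \<open>law t A\<close> is over the number of jumps before \<open>t\<close>.\<close>

definition jump_op :: "real \<Rightarrow> (real \<Rightarrow> 'a \<Rightarrow> ennreal) \<Rightarrow> real \<Rightarrow> 'a \<Rightarrow> ennreal" where
  "jump_op t f s x = (\<integral>\<^sup>+ v. ennreal (\<rho> v (\<psi> s v x) * exp (- flow_hazard s v x)) * (\<integral>\<^sup>+ y. f v y \<partial>Q v (\<psi> s v x))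
     * indicator {s..t} v \<partial>lborel)"

definition stay :: "real \<Rightarrow> 'a set \<Rightarrow> real \<Rightarrow> 'a \<Rightarrow> ennreal" where
  "stay t A s x = ennreal (exp (- flow_hazard s t x)) * indicator A (\<psi> s t x) * indicator {..t} s"

definition law :: "real \<Rightarrow> 'a set \<Rightarrow> real \<Rightarrow> 'a \<Rightarrow> ennreal" where
  "law t A s x = (\<Sum>k. (jump_op t ^^ k) (stay t A) s x)"

lemma jump_op_measurable [measurable]:
  assumes [measurable]: "case_prod f \<in> borel_measurable (borel \<Otimes>\<^sub>M N)"
  shows "case_prod (jump_op t f) \<in> borel_measurable (borel \<Otimes>\<^sub>M N)"
proof -
  let ?K = "(borel \<Otimes>\<^sub>M N) \<Otimes>\<^sub>M (lborel :: real measure)"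
  have X: "(\<lambda>p. \<psi> (fst (fst p)) (snd p) (snd (fst p))) \<in> ?K \<rightarrow>\<^sub>M N" by measurable
  have "(\<lambda>p. \<rho> (snd p) (\<psi> (fst (fst p)) (snd p) (snd (fst p))) * exp (- flow_hazard (fst (fst p)) (snd p) (snd (fst p))))
     \<in> borel_measurable ?K" by measurable
  moreover have "(\<lambda>p. \<integral>\<^sup>+ y. f (snd p) y \<partial>Q (snd p) (\<psi> (fst (fst p)) (snd p) (snd (fst p)))) \<in> borel_measurable ?K"
    by (rule nn_integral_kernel_measurable[OF assms _ X]) measurable
  moreover have "(\<lambda>p. indicator {fst (fst p)..t} (snd p) :: ennreal) \<in> borel_measurable ?K"
    unfolding indicator_def atLeastAtMost_iff by measurable
  ultimately have "(\<lambda>p. ennreal (\<rho> (snd p) (\<psi> (fst (fst p)) (snd p) (snd (fst p))) * exp (- flow_hazard (fst (fst p)) (snd p) (snd (fst p))))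
     * (\<integral>\<^sup>+ y. f (snd p) y \<partial>Q (snd p) (\<psi> (fst (fst p)) (snd p) (snd (fst p))))
     * indicator {fst (fst p)..t} (snd p)) \<in> borel_measurable ?K"
    by (intro borel_measurable_times_ennreal measurable_compose[OF _ measurable_ennreal])
  from lborel.borel_measurable_nn_integral_fst[OF this]
  show ?thesis by (simp add: jump_op_def[abs_def] split_beta')
qed

lemma jump_op_power_measurable [measurable]:
  "case_prod f \<in> borel_measurable (borel \<Otimes>\<^sub>M N) \<Longrightarrow> case_prod ((jump_op t ^^ k) f) \<in> borel_measurable (borel \<Otimes>\<^sub>M N)"
  by (induction k) (auto intro: jump_op_measurable)

lemma stay_measurable [measurable]:
  assumes [measurable]: "A \<in> sets N"
  shows "case_prod (stay t A) \<in> borel_measurable (borel \<Otimes>\<^sub>M N)"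
proof -
  have "(\<lambda>p. indicator {..t} (fst p) :: ennreal) \<in> borel_measurable (borel \<Otimes>\<^sub>M N)"
    unfolding indicator_def atMost_iff by measurable
  then show ?thesis unfolding stay_def[abs_def] split_beta' by measurable
qed

lemma case_prod_apply_measurable:
  "case_prod f \<in> borel_measurable (borel \<Otimes>\<^sub>M N) \<Longrightarrow> b \<in> K \<rightarrow>\<^sub>M borel \<Longrightarrow> h \<in> K \<rightarrow>\<^sub>M N \<Longrightarrow>
    (\<lambda>w. f (b w) (h w)) \<in> borel_measurable K"
  using measurable_compose[of "\<lambda>w. (b w, h w)" K "borel \<Otimes>\<^sub>M N" "case_prod f" borel] by simp

lemma law_measurable [measurable]:
  assumes [measurable]: "A \<in> sets N"
  shows "case_prod (law t A) \<in> borel_measurable (borel \<Otimes>\<^sub>M N)"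
proof -
  have "(\<lambda>p. \<Sum>k. case_prod ((jump_op t ^^ k) (stay t A)) p) \<in> borel_measurable (borel \<Otimes>\<^sub>M N)"
    by measurable
  then show ?thesis by (simp add: law_def[abs_def] split_beta')
qed

lemma jump_op_mono:
  assumes "x \<in> space N" "\<And>v y. s \<le> v \<Longrightarrow> v \<le> t \<Longrightarrow> y \<in> space N \<Longrightarrow> f v y \<le> g v y"
  shows "jump_op t f s x \<le> jump_op t g s x"
  unfolding jump_op_def using assms
  by (intro nn_integral_mono) (auto split: split_indicator intro!: mult_left_mono nn_integral_mono)

lemma kernel_section_measurable [measurable (raw)]:
  assumes "case_prod f \<in> borel_measurable (borel \<Otimes>\<^sub>M N)" "x \<in> space N"
  shows "f v \<in> borel_measurable (Q v' x)"
proof -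
  have "(\<lambda>y. f v y) \<in> borel_measurable N"
    by (rule case_prod_apply_measurable[OF assms(1)]) auto
  then show ?thesis using assms(2) by (simp cong: measurable_cong_sets)
qed

lemma jump_op_suminf:
  assumes f: "\<And>k. case_prod (f k) \<in> borel_measurable (borel \<Otimes>\<^sub>M N)" and x: "x \<in> space N"
  shows "jump_op t (\<lambda>v y. \<Sum>k. f k v y) s x = (\<Sum>k. jump_op t (f k) s x)"
proof -
  have [measurable]: "\<And>k. case_prod (f k) \<in> borel_measurable (borel \<Otimes>\<^sub>M N)" by fact
  have "jump_op t (\<lambda>v y. \<Sum>k. f k v y) s x = (\<integral>\<^sup>+ v. (\<Sum>k. ennreal (\<rho> v (\<psi> s v x) * exp (- flow_hazard s v x))
      * (\<integral>\<^sup>+ y. f k v y \<partial>Q v (\<psi> s v x)) * indicator {s..t} v) \<partial>lborel)"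
    unfolding jump_op_def using kernel_section_measurable[OF f] x
    by (subst nn_integral_suminf) (auto simp: ennreal_suminf_cmult ennreal_suminf_multc)
  also have "\<dots> = (\<Sum>k. jump_op t (f k) s x)"
    unfolding jump_op_def using x by (intro nn_integral_suminf) measurable
  finally show ?thesis .
qed

lemma jump_op_add:
  assumes f: "case_prod f \<in> borel_measurable (borel \<Otimes>\<^sub>M N)" "case_prod g \<in> borel_measurable (borel \<Otimes>\<^sub>M N)"
    and x: "x \<in> space N"
  shows "jump_op t (\<lambda>v y. f v y + g v y) s x = jump_op t f s x + jump_op t g s x"
proof -
  note [measurable] = f
  have "jump_op t (\<lambda>v y. f v y + g v y) s x =
     (\<integral>\<^sup>+ v. ennreal (\<rho> v (\<psi> s v x) * exp (- flow_hazard s v x)) * (\<integral>\<^sup>+ y. f v y \<partial>Q v (\<psi> s v x)) * indicator {s..t} v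
       + ennreal (\<rho> v (\<psi> s v x) * exp (- flow_hazard s v x)) * (\<integral>\<^sup>+ y. g v y \<partial>Q v (\<psi> s v x)) * indicator {s..t} v \<partial>lborel)"
    unfolding jump_op_def using kernel_section_measurable[OF f(1)] kernel_section_measurable[OF f(2)] x
    by (subst nn_integral_add) (auto simp: distrib_left distrib_right)
  also have "\<dots> = jump_op t f s x + jump_op t g s x"
    unfolding jump_op_def using x by (intro nn_integral_add) measurable
  finally show ?thesis .
qed

lemma jump_op_one:
  assumes x: "x \<in> space N" and "s \<le> t"
  shows "jump_op t (\<lambda>_ _. 1) s x = ennreal (1 - exp (- flow_hazard s t x))"
proof -
  interpret hazard_rate "\<lambda>w. \<rho> w (\<psi> s w x)" s by (rule hazard_rate_flow[OF x])
  have "(\<integral>\<^sup>+ y. 1 \<partial>Q v (\<psi> s v x)) = 1" for v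
    using prob_space.emeasure_space_1[OF prob_space_kernel[of "\<psi> s v x" v]] x by simp
  then show ?thesis
    using nn_integral_hazard_density[OF \<open>s \<le> t\<close>] by (simp add: jump_op_def flow_hazard_def)
qed

lemma stay_plus_jump_op_one_le:
  assumes x: "x \<in> space N"
  shows "stay t A s x + jump_op t (\<lambda>_ _. 1) s x \<le> 1"
proof (cases "s \<le> t")
  case True
  interpret hazard_rate "\<lambda>w. \<rho> w (\<psi> s w x)" s by (rule hazard_rate_flow[OF x])
  have "stay t A s x + jump_op t (\<lambda>_ _. 1) s x \<le> ennreal (exp (- flow_hazard s t x)) + ennreal (1 - exp (- flow_hazard s t x))"
    unfolding jump_op_one[OF x True] by (intro add_right_mono) (auto simp: stay_def split: split_indicator)
  also have "\<dots> = 1" using hazard_nonneg by (subst ennreal_plus[symmetric]) (auto simp: flow_hazard_def)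
  finally show ?thesis .
next
  case False
  then show ?thesis by (simp add: stay_def jump_op_def)
qed

text \<open>Peeling off the first jump, each partial sum is \<open>stay\<close> plus
  \<open>jump_op\<close> of the preceding one, so the bound 1 propagates through
  \<open>stay_plus_jump_op_one_le\<close>.\<close>

lemma sum_jump_op_power_le:
  assumes [measurable]: "A \<in> sets N" and x: "x \<in> space N"
  shows "(\<Sum>k<n. (jump_op t ^^ k) (stay t A) s x) \<le> 1"
  using x
proof (induction n arbitrary: s x)
  case (Suc n)
  have sum: "jump_op t (\<lambda>v y. \<Sum>k<m. (jump_op t ^^ k) (stay t A) v y) s x = (\<Sum>k<m. jump_op t ((jump_op t ^^ k) (stay t A)) s x)" for m
  proof (induction m)
    case 0
    then show ?case by (simp add: jump_op_def)
  next
    case (Suc m)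
    have [measurable]: "case_prod ((jump_op t ^^ k) (stay t A)) \<in> borel_measurable (borel \<Otimes>\<^sub>M N)" for k by measurable
    have "(\<lambda>p. \<Sum>k<m. case_prod ((jump_op t ^^ k) (stay t A)) p) \<in> borel_measurable (borel \<Otimes>\<^sub>M N)"
      by measurable
    then have "case_prod (\<lambda>v y. \<Sum>k<m. (jump_op t ^^ k) (stay t A) v y) \<in> borel_measurable (borel \<Otimes>\<^sub>M N)"
      by (simp add: split_beta')
    then show ?case using Suc jump_op_add[of "\<lambda>v y. \<Sum>k<m. (jump_op t ^^ k) (stay t A) v y" "(jump_op t ^^ m) (stay t A)" x t s] \<open>x \<in> space N\<close>
      by simp
  qed
  have "(\<Sum>k<Suc n. (jump_op t ^^ k) (stay t A) s x) = stay t A s x + jump_op t (\<lambda>v y. \<Sum>k<n. (jump_op t ^^ k) (stay t A) v y) s x"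
    unfolding sum sum.lessThan_Suc_shift by simp
  also have "\<dots> \<le> stay t A s x + jump_op t (\<lambda>_ _. 1) s x"
    using Suc by (intro add_left_mono jump_op_mono) auto
  also have "\<dots> \<le> 1" by (rule stay_plus_jump_op_one_le) fact
  finally show ?case .
qed simp

lemma law_le_1: "A \<in> sets N \<Longrightarrow> x \<in> space N \<Longrightarrow> law t A s x \<le> 1"
  unfolding law_def by (intro suminf_le_const summableI sum_jump_op_power_le)

text \<open>Conditioning on the first jump. With the law defined as a series this is a shift of the
  index, since \<open>jump_op\<close> commutes with countable sums.\<close>

lemma law_renewal:
  assumes [measurable]: "A \<in> sets N" and x: "x \<in> space N"
  shows "law t A s x = stay t A s x + jump_op t (law t A) s x"
proof -
  have "jump_op t (law t A) s x = (\<Sum>k. jump_op t ((jump_op t ^^ k) (stay t A)) s x)"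
    unfolding law_def[abs_def] using x by (intro jump_op_suminf) measurable
  moreover have "law t A s x = (\<Sum>k. (jump_op t ^^ Suc k) (stay t A) s x) + stay t A s x"
    using sums_unique[OF sums_Suc[OF summable_sums[OF summableI]], of "\<lambda>k. (jump_op t ^^ k) (stay t A) s x"]
    by (simp add: law_def)
  ultimately show ?thesis by (simp add: add.commute)
qed

end

section \<open>Backward equation for the law along a flow line\<close>

context jump_flow begin

text \<open>From a later point of the flow line, and weighted by the probability of no jump up to
  there, the jump operator is the tail of one fixed integral. The starting time enters through the
  domain of integration alone, as \<open>primitive_renewal\<close> asks.\<close>

lemma jump_op_flow_line:
  assumes f: "case_prod f \<in> borel_measurable (borel \<Otimes>\<^sub>M N)" and x: "x \<in> space N" and "s \<le> a"
  shows "ennreal (exp (- flow_hazard s a x)) * jump_op t f a (\<psi> s a x) =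
    (\<integral>\<^sup>+ v. ennreal (\<rho> v (\<psi> s v x) * exp (- flow_hazard s v x)) * (\<integral>\<^sup>+ y. f v y \<partial>Q v (\<psi> s v x)) * indicator {a..t} v \<partial>lborel)"
proof -
  note [measurable] = f x
  let ?y = "\<psi> s a x"
  have y [measurable]: "?y \<in> space N" using x by simp
  have "ennreal (exp (- flow_hazard s a x)) * jump_op t f a ?y
    = (\<integral>\<^sup>+ v. ennreal (exp (- flow_hazard s a x)) * (ennreal (\<rho> v (\<psi> a v ?y) * exp (- flow_hazard a v ?y)) * (\<integral>\<^sup>+ y. f v y \<partial>Q v (\<psi> a v ?y)) * indicator {a..t} v) \<partial>lborel)"
    unfolding jump_op_def by (rule nn_integral_cmult[symmetric]) measurable
  also have "\<dots> = (\<integral>\<^sup>+ v. ennreal (\<rho> v (\<psi> s v x) * exp (- flow_hazard s v x)) * (\<integral>\<^sup>+ y. f v y \<partial>Q v (\<psi> s v x)) * indicator {a..t} v \<partial>lborel)"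
  proof (rule nn_integral_cong)
    fix v
    show "ennreal (exp (- flow_hazard s a x)) * (ennreal (\<rho> v (\<psi> a v ?y) * exp (- flow_hazard a v ?y)) * (\<integral>\<^sup>+ y. f v y \<partial>Q v (\<psi> a v ?y)) * indicator {a..t} v)
      = ennreal (\<rho> v (\<psi> s v x) * exp (- flow_hazard s v x)) * (\<integral>\<^sup>+ y. f v y \<partial>Q v (\<psi> s v x)) * indicator {a..t} v"
    proof (cases "v \<in> {a..t}")
      case True
      then have "\<psi> a v ?y = \<psi> s v x" "flow_hazard a v ?y = flow_hazard s v x - flow_hazard s a x"
        using assms by (auto simp: flow_flow flow_hazard_split)
      moreover have "ennreal (exp (- flow_hazard s a x)) * ennreal (\<rho> v (\<psi> s v x) * exp (- (flow_hazard s v x - flow_hazard s a x)))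
        = ennreal (\<rho> v (\<psi> s v x) * exp (- flow_hazard s v x))"
        using rate_nonneg by (subst ennreal_mult[symmetric]) (auto simp: exp_diff exp_minus field_simps)
      ultimately show ?thesis by (simp add: mult.assoc[symmetric])
    qed simp
  qed
  finally show ?thesis .
qed

lemma integral_kernel_enn2real:
  assumes f: "case_prod f \<in> borel_measurable (borel \<Otimes>\<^sub>M N)" and x: "x \<in> space N"
    and le: "\<And>y. y \<in> space N \<Longrightarrow> f v y \<le> 1"
  shows "(\<integral>y. enn2real (f v y) \<partial>Q v x) = enn2real (\<integral>\<^sup>+ y. f v y \<partial>Q v x)"
    "(\<integral>\<^sup>+ y. f v y \<partial>Q v x) \<le> 1" "integrable (Q v x) (\<lambda>y. enn2real (f v y))"
proof -
  interpret Qv: prob_space "Q v x" using x by (rule prob_space_kernel)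
  have [measurable]: "f v \<in> borel_measurable (Q v x)" by (rule kernel_section_measurable[OF f x])
  have le': "enn2real (f v y) \<le> 1" if "y \<in> space N" for y
    using le[OF that] enn2real_mono[of "f v y" 1] by simp
  have eq: "ennreal (enn2real (f v y)) = f v y" if "y \<in> space N" for y
    using le[OF that] by (intro ennreal_enn2real) (auto simp: less_top[symmetric] top_unique)
  show "(\<integral>y. enn2real (f v y) \<partial>Q v x) = enn2real (\<integral>\<^sup>+ y. f v y \<partial>Q v x)"
    using eq x by (subst integral_eq_nn_integral) (auto intro!: arg_cong[where f=enn2real] nn_integral_cong)
  have "(\<integral>\<^sup>+ y. f v y \<partial>Q v x) \<le> (\<integral>\<^sup>+ y. 1 \<partial>Q v x)"
    using le x by (intro nn_integral_mono) auto
  then show "(\<integral>\<^sup>+ y. f v y \<partial>Q v x) \<le> 1" by (simp add: Qv.emeasure_space_1)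
  show "integrable (Q v x) (\<lambda>y. enn2real (f v y))"
    using le' x by (intro Qv.integrable_const_bound[where B=1] AE_I2) auto
qed

text \<open>The backward Kolmogorov equation in integrated form. The renewal equation, multiplied by
  the probability of no jump between s and v, meets the hypothesis of
  \<open>primitive_renewal\<close>, with q v the expected value of \<open>law\<close> just after a
  jump at time v.\<close>

lemma law_primitive:
  assumes A: "A \<in> sets N" and x: "x \<in> space N"
  shows "primitive_on s t (\<lambda>v. enn2real (law t A v (\<psi> s v x)))
    (\<lambda>v. \<rho> v (\<psi> s v x) * (enn2real (law t A v (\<psi> s v x)) - (\<integral>y. enn2real (law t A v y) \<partial>Q v (\<psi> s v x))))"
proof -
  interpret R: hazard_rate "\<lambda>w. \<rho> w (\<psi> s w x)" s by (rule hazard_rate_flow[OF x])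
  note [measurable] = A x
  have Hh: "R.hazard v = flow_hazard s v x" for v by (simp add: flow_hazard_def)
  define q where "q v = enn2real (\<integral>\<^sup>+ y. law t A v y \<partial>Q v (\<psi> s v x))" for v
  have qU: "(\<integral>\<^sup>+ y. law t A v y \<partial>Q v (\<psi> s v x)) = ennreal (q v)" and q01: "0 \<le> q v \<and> q v \<le> 1"
    and qI: "q v = (\<integral>y. enn2real (law t A v y) \<partial>Q v (\<psi> s v x))" for v
  proof -
    have le: "(\<integral>\<^sup>+ y. law t A v y \<partial>Q v (\<psi> s v x)) \<le> 1"
      using x by (intro integral_kernel_enn2real(2) law_measurable A law_le_1) auto
    then show "(\<integral>\<^sup>+ y. law t A v y \<partial>Q v (\<psi> s v x)) = ennreal (q v)"
      unfolding q_def by (intro ennreal_enn2real[symmetric]) (auto simp: less_top[symmetric] top_unique)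
    show "0 \<le> q v \<and> q v \<le> 1"
      unfolding q_def using enn2real_mono[OF le] by simp
    show "q v = (\<integral>y. enn2real (law t A v y) \<partial>Q v (\<psi> s v x))"
      unfolding q_def using x by (intro integral_kernel_enn2real(1)[symmetric] law_measurable A law_le_1) auto
  qed
  have qm [measurable]: "q \<in> borel_measurable borel"
    unfolding q_def[abs_def] by measurable
  have "primitive_on s t (\<lambda>v. enn2real (law t A v (\<psi> s v x))) (\<lambda>v. \<rho> v (\<psi> s v x) * (enn2real (law t A v (\<psi> s v x)) - q v))"
  proof (rule R.primitive_renewal[OF qm q01])
    fix v assume v: "v \<in> {s..t}"
    let ?p = "\<lambda>w. \<rho> w (\<psi> s w x) * exp (- R.hazard w) * q w"
    let ?h = "enn2real (law t A v (\<psi> s v x))"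
    have hU: "ennreal ?h = law t A v (\<psi> s v x)"
      using law_le_1[OF A flow_in_space[OF x], of t v s v] by (intro ennreal_enn2real) (auto simp: less_top[symmetric] top_unique)
    have "set_integrable lborel {s..t} (\<lambda>w. \<rho> w (\<psi> s w x) * (exp (- R.hazard w) * q w))"
      using q01 R.exp_hazard_le_1 by (intro R.set_integrable_rate_bounded[where C=1]) (auto simp: abs_mult intro!: mult_le_one)
    then have int: "set_integrable lborel {v..t} ?p"
      using v set_integrable_subset[of lborel "{s..t}" _ "{v..t}"] by (auto simp: mult.assoc)
    have pn: "0 \<le> ?p w" for w using q01 rate_nonneg by (intro mult_nonneg_nonneg) auto
    have "ennreal (exp (- R.hazard v) * ?h) = ennreal (exp (- flow_hazard s v x)) * law t A v (\<psi> s v x)"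
      by (simp add: ennreal_mult hU Hh)
    also have "\<dots> = ennreal (exp (- flow_hazard s v x)) * stay t A v (\<psi> s v x) + ennreal (exp (- flow_hazard s v x)) * jump_op t (law t A) v (\<psi> s v x)"
      using x by (subst law_renewal[OF A]) (auto simp: distrib_left)
    \<comment> \<open>Surviving from s to v and then from v to t is surviving from s to t, so this
      term is the constant C, independent of v.\<close>
    also have "ennreal (exp (- flow_hazard s v x)) * stay t A v (\<psi> s v x) = ennreal (exp (- flow_hazard s t x) * indicator A (\<psi> s t x))"
    proof -
      have "flow_hazard s t x = flow_hazard s v x + flow_hazard v t (\<psi> s v x)" "\<psi> v t (\<psi> s v x) = \<psi> s t x"
        using v x by (auto simp: flow_hazard_split flow_flow)
      then show ?thesis
        using v by (auto simp: stay_def exp_add exp_diff exp_minus ennreal_mult[symmetric] field_simps split: split_indicator)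
    qed
    also have "ennreal (exp (- flow_hazard s v x)) * jump_op t (law t A) v (\<psi> s v x) = (\<integral>\<^sup>+ w. ennreal (indicator {v..t} w *\<^sub>R ?p w) \<partial>lborel)"
      using v x q01 rate_nonneg
      by (subst jump_op_flow_line) (auto intro!: nn_integral_cong law_measurable A simp: qU Hh ennreal_mult split: split_indicator)
    also have "\<dots> = ennreal (LINT w:{v..t}|lborel. ?p w)"
      using int pn unfolding set_integrable_def set_lebesgue_integral_def by (intro nn_integral_eq_integral) auto
    also have "ennreal (exp (- flow_hazard s t x) * indicator A (\<psi> s t x)) + ennreal (LINT w:{v..t}|lborel. ?p w)
      = ennreal (exp (- flow_hazard s t x) * indicator A (\<psi> s t x) + (LINT w:{v..t}|lborel. ?p w))"
      using pn unfolding set_lebesgue_integral_def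
      by (intro ennreal_plus[symmetric] Bochner_Integration.integral_nonneg) (auto split: split_indicator)
    finally show "exp (- R.hazard v) * ?h = exp (- flow_hazard s t x) * indicator A (\<psi> s t x) + (LINT w:{v..t}|lborel. ?p w)"
      using pn unfolding set_lebesgue_integral_def
      by (subst (asm) ennreal_inj) (auto intro!: add_nonneg_nonneg Bochner_Integration.integral_nonneg split: split_indicator)
  qed
  then show ?thesis unfolding qI .
qed

text \<open>Only the term without jumps remains: the jump probability over {t..t} is 1 - exp 0 =
  0.\<close>

lemma law_final:
  assumes A: "A \<in> sets N" and x: "x \<in> space N"
  shows "enn2real (law t A t x) = indicator A x"
proof -
  interpret R: hazard_rate "\<lambda>w. \<rho> w (\<psi> t w x)" t by (rule hazard_rate_flow[OF x])
  have H0: "flow_hazard t t x = 0" by (simp add: flow_hazard_def)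
  have "jump_op t (law t A) t x \<le> jump_op t (\<lambda>_ _. 1) t x" by (intro jump_op_mono x law_le_1 A)
  also have "\<dots> = 0" using jump_op_one[OF x order.refl[of t]] H0 by simp
  finally have "law t A t x = indicator A x"
    using x by (subst law_renewal[OF A x]) (simp add: stay_def H0 flow_id)
  then show ?thesis by (simp split: split_indicator)
qed

end

section \<open>Comparison of two jump mechanisms\<close>

text \<open>Both forms of the hypothesis on g lead to the one-sided assumption \<open>gap\<close>.
  It contains the two-sided bound, since passing from A to its complement changes the sign of each
  generator term.\<close>

locale jump_flow_pair =
  J1: jump_flow N \<psi> \<rho>1 Q1 + J2: jump_flow N \<psi> \<rho>2 Q2 + G: hazard_rate g t0
  for N :: "'a measure" and \<psi> \<rho>1 Q1 \<rho>2 Q2 g t0 +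
  fixes t :: real
  assumes t0_le: "t0 \<le> t"
    and gap: "t0 \<le> v \<Longrightarrow> v \<le> t \<Longrightarrow> x \<in> space N \<Longrightarrow> A \<in> sets N \<Longrightarrow>
      \<rho>2 v x * (measure (Q2 v x) A - indicator A x) - \<rho>1 v x * (measure (Q1 v x) A - indicator A x) \<le> g v"
begin

text \<open>For v between t0 and t this is exp of minus the integral of g over {v..t}, the function
  G of the proof.\<close>

definition survival :: "real \<Rightarrow> real" where "survival v = exp (G.hazard v - G.hazard t)"

definition deficit :: "'a set \<Rightarrow> real \<Rightarrow> 'a \<Rightarrow> real" where
  "deficit A v x = max 0 (survival v - enn2real (J1.law t A v x) - enn2real (J2.law t (space N - A) v x))"

lemma survival_bounds: "0 \<le> survival v" "v \<le> t \<Longrightarrow> survival v \<le> 1"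
  using G.hazard_mono[of v t] by (auto simp: survival_def)

lemma survival_primitive: "primitive_on s t survival (\<lambda>v. g v * survival v)" if "t0 \<le> s"
proof -
  have "primitive_on s t (\<lambda>v. exp (- G.hazard t) * exp (1 * G.hazard v)) (\<lambda>v. exp (- G.hazard t) * (1 * (g v * exp (1 * G.hazard v))))"
    using that by (intro primitive_on_cmult primitive_on_subinterval[OF G.primitive_exp_hazard]) auto
  then show ?thesis by (rule primitive_on_cong) (auto simp: survival_def exp_diff exp_minus field_simps)
qed

lemma law_range:
  assumes "A \<in> sets N" "x \<in> space N"
  shows "0 \<le> enn2real (J1.law t A v x)" "enn2real (J1.law t A v x) \<le> 1"
    "0 \<le> enn2real (J2.law t A v x)" "enn2real (J2.law t A v x) \<le> 1"
  using enn2real_mono[OF J1.law_le_1[OF assms, of t v]] enn2real_mono[OF J2.law_le_1[OF assms, of t v]] by auto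

lemma deficit_bounds:
  assumes A: "A \<in> sets N" and x: "x \<in> space N"
  shows "0 \<le> deficit A v x" "v \<le> t \<Longrightarrow> deficit A v x \<le> 1"
proof -
  show "0 \<le> deficit A v x" by (simp add: deficit_def)
  show "deficit A v x \<le> 1" if "v \<le> t"
    using law_range(1)[OF A x, of v] law_range(3)[OF sets.compl_sets[OF A] x, of v] survival_bounds(2)[OF that]
    unfolding deficit_def max_def by (auto simp del: enn2real_nonneg)
qed

lemma deficit_measurable [measurable]:
  assumes A [measurable]: "A \<in> sets N"
  shows "(\<lambda>(v, x). ennreal (deficit A v x)) \<in> borel_measurable (borel \<Otimes>\<^sub>M N)"
proof -
  have [measurable]: "survival \<in> borel_measurable borel" unfolding survival_def[abs_def] by measurable
  have "(\<lambda>p. ennreal (max 0 (survival (fst p) - enn2real (case_prod (J1.law t A) p) - enn2real (case_prod (J2.law t (space N - A)) p))))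
      \<in> borel_measurable (borel \<Otimes>\<^sub>M N)" by measurable
  then show ?thesis by (simp add: deficit_def split_beta')
qed

text \<open>With the value h x held fixed, the rate times (integral of h - h x) grows with h. So the
  first generator of f is at most that of u1 + deficit, and the second one of f is at least that of
  survival - u2; constants are annihilated. As f takes values in [0, survival v], exchanging one
  generator for the other costs at most \<open>g v * survival v\<close>.\<close>

lemma drift_bound:
  assumes A [measurable]: "A \<in> sets N" and x: "x \<in> space N" and v: "t0 \<le> v" "v \<le> t"
    and pos: "0 < survival v - enn2real (J1.law t A v x) - enn2real (J2.law t (space N - A) v x)" (is "0 < ?y")
  shows "\<rho>1 v x * (?y - (\<integral>z. deficit A v z \<partial>Q1 v x)) \<le> g v * survival v
     + \<rho>1 v x * ((\<integral>z. enn2real (J1.law t A v z) \<partial>Q1 v x) - enn2real (J1.law t A v x))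
     + \<rho>2 v x * ((\<integral>z. enn2real (J2.law t (space N - A) v z) \<partial>Q2 v x) - enn2real (J2.law t (space N - A) v x))"
proof -
  interpret K1: prob_space "Q1 v x" using x by (rule J1.prob_space_kernel)
  interpret K2: prob_space "Q2 v x" using x by (rule J2.prob_space_kernel)
  have Ac [measurable]: "space N - A \<in> sets N" by simp
  let ?u1 = "\<lambda>z. enn2real (J1.law t A v z)" and ?u2 = "\<lambda>z. enn2real (J2.law t (space N - A) v z)"
  \<comment> \<open>\<open>f\<close> lies below \<open>u1 + deficit\<close> and above \<open>survival - u2\<close>, with equality in both at \<open>x\<close>.\<close>
  define f where "f z = max 0 (survival v - ?u2 z)" for z
  have um: "?u1 \<in> borel_measurable N" "?u2 \<in> borel_measurable N"
    using J1.case_prod_apply_measurable[OF J1.law_measurable[OF A], of "\<lambda>_. v" N "\<lambda>z. z" t]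
      J2.case_prod_apply_measurable[OF J2.law_measurable[OF Ac], of "\<lambda>_. v" N "\<lambda>z. z" t] by auto
  note [measurable] = um
  have fm [measurable]: "f \<in> borel_measurable N" unfolding f_def[abs_def] by measurable
  have Dm [measurable]: "deficit A v \<in> borel_measurable N" unfolding deficit_def[abs_def] by measurable
  have f01: "0 \<le> f z" "f z \<le> survival v" if "z \<in> space N" for z
    using law_range[OF Ac that, of v] survival_bounds[of v] by (auto simp: f_def)
  have int: "integrable (Q1 v x) h" "integrable (Q2 v x) h"
    if "h \<in> borel_measurable N" "\<And>z. z \<in> space N \<Longrightarrow> 0 \<le> h z \<and> h z \<le> 1" for h :: "'a \<Rightarrow> real"
    using that x by (auto intro!: K1.integrable_const_bound[where B=1] K2.integrable_const_bound[where B=1] AE_I2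
        cong: measurable_cong_sets)
  have G1: "survival v \<le> 1" using survival_bounds v by auto
  have f1: "0 \<le> f z \<and> f z \<le> 1" if "z \<in> space N" for z using f01[OF that] G1 by auto
  have gen: "\<rho>2 v x * ((\<integral>z. f z \<partial>Q2 v x) - f x) - \<rho>1 v x * ((\<integral>z. f z \<partial>Q1 v x) - f x) \<le> g v * survival v"
    using x v f01 by (intro generator_diff_le[where N=N] J1.kernel_in_prob_algebra J2.kernel_in_prob_algebra
      J1.rate_nonneg J2.rate_nonneg G.rate_nonneg gap fm)
  \<comment> \<open>Positivity of \<open>?y\<close> and nonnegativity of \<open>?u1 x\<close> remove
    the maximum in \<open>f x\<close>; this is where both comparisons touch.\<close>
  have fx: "f x = ?u1 x + ?y" "?u2 x = survival v - f x"
    using pos law_range(1)[OF A x, of v] unfolding f_def max_def by (auto simp del: enn2real_nonneg)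
  have "(\<integral>z. f z \<partial>Q1 v x) \<le> (\<integral>z. ?u1 z + deficit A v z \<partial>Q1 v x)"
  proof (rule integral_mono)
    show "integrable (Q1 v x) f" by (rule int[OF fm f1])
    show "integrable (Q1 v x) (\<lambda>z. ?u1 z + deficit A v z)"
      using law_range[OF A] deficit_bounds[OF A] v by (intro Bochner_Integration.integrable_add int) auto
    fix z assume "z \<in> space (Q1 v x)"
    then have "z \<in> space N" using x by simp
    then show "f z \<le> ?u1 z + deficit A v z" using law_range[OF A, of z v] by (auto simp: f_def deficit_def)
  qed
  also have "\<dots> = (\<integral>z. ?u1 z \<partial>Q1 v x) + (\<integral>z. deficit A v z \<partial>Q1 v x)"
    using law_range[OF A] deficit_bounds[OF A] v by (intro Bochner_Integration.integral_add int) auto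
  finally have i1: "(\<integral>z. f z \<partial>Q1 v x) \<le> (\<integral>z. ?u1 z \<partial>Q1 v x) + (\<integral>z. deficit A v z \<partial>Q1 v x)" .
  have "(\<integral>z. survival v - ?u2 z \<partial>Q2 v x) \<le> (\<integral>z. f z \<partial>Q2 v x)"
  proof (rule integral_mono)
    show "integrable (Q2 v x) f" by (rule int[OF fm f1])
    show "integrable (Q2 v x) (\<lambda>z. survival v - ?u2 z)"
      using law_range[OF Ac] survival_bounds(1)[of v] G1 by (intro Bochner_Integration.integrable_diff int) auto
  qed (auto simp: f_def)
  also have "(\<integral>z. survival v - ?u2 z \<partial>Q2 v x) = survival v - (\<integral>z. ?u2 z \<partial>Q2 v x)"
    using law_range[OF Ac] survival_bounds(1)[of v] G1 by (subst Bochner_Integration.integral_diff) (auto intro!: int simp: K2.prob_space)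
  finally have i2: "survival v - (\<integral>z. f z \<partial>Q2 v x) \<le> (\<integral>z. ?u2 z \<partial>Q2 v x)" by simp
  have "\<rho>1 v x * ((\<integral>z. f z \<partial>Q1 v x) - f x) \<le> \<rho>1 v x * ((\<integral>z. ?u1 z \<partial>Q1 v x) + (\<integral>z. deficit A v z \<partial>Q1 v x) - f x)"
    using i1 by (intro mult_left_mono J1.rate_nonneg) simp
  moreover have "\<rho>2 v x * (f x - (\<integral>z. f z \<partial>Q2 v x)) \<le> \<rho>2 v x * ((\<integral>z. ?u2 z \<partial>Q2 v x) - ?u2 x)"
    using i2 fx(2) by (intro mult_left_mono J2.rate_nonneg) simp
  ultimately show ?thesis using gen unfolding fx(1) by (simp add: algebra_simps)
qed

text \<open>Along the flow line the signed deficit y is absolutely continuous, but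
  \<open>drift_bound\<close> controls it only where it is positive. \<open>hazard_comparison\<close>
  is therefore run from s to the first time \<tau> with y \<le> 0, and the estimate is then extended
  to t.\<close>

lemma deficit_le_jump_op:
  assumes A [measurable]: "A \<in> sets N" and x [measurable]: "x \<in> space N" and s: "t0 \<le> s" "s \<le> t"
  shows "ennreal (deficit A s x) \<le> J1.jump_op t (\<lambda>v z. ennreal (deficit A v z)) s x"
proof (cases "deficit A s x \<le> 0")
  case False
  have Ac [measurable]: "space N - A \<in> sets N" by simp
  interpret R: hazard_rate "\<lambda>w. \<rho>1 w (\<psi> s w x)" s by (rule J1.hazard_rate_flow[OF x])
  let ?X = "\<lambda>v. \<psi> s v x"
  define h1 h2 where "h1 v = enn2real (J1.law t A v (?X v))" and "h2 v = enn2real (J2.law t (space N - A) v (?X v))" for v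
  define y where "y v = survival v - h1 v - h2 v" for v
  define q1 q2 where "q1 v = (\<integral>z. enn2real (J1.law t A v z) \<partial>Q1 v (?X v))"
    and "q2 v = (\<integral>z. enn2real (J2.law t (space N - A) v z) \<partial>Q2 v (?X v))" for v
  \<comment> \<open>The derivative of y: the first term comes from \<open>survival\<close>, the
    other two from \<open>law_primitive\<close>.\<close>
  define y' where "y' v = g v * survival v + (- 1 * (\<rho>1 v (?X v) * (h1 v - q1 v)) + - 1 * (\<rho>2 v (?X v) * (h2 v - q2 v)))" for v
  have "primitive_on s t (\<lambda>v. survival v + (- 1 * h1 v + - 1 * h2 v)) y'"
    unfolding y'_def[abs_def] h1_def h2_def q1_def q2_def
    by (intro primitive_on_add primitive_on_cmult survival_primitive s J1.law_primitive J2.law_primitive A Ac x)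
  then have yp: "primitive_on s t y y'"
    by (rule primitive_on_cong) (simp_all add: y_def)
  have Xs: "?X s = x" using x by (rule J1.flow_id)
  have ys: "y s = deficit A s x" using False by (simp add: deficit_def y_def h1_def h2_def Xs)
  \<comment> \<open>At time t the two laws are the indicators of A and of its complement, which add
    up to 1 = \<open>survival t\<close>.\<close>
  have "y t = 0"
    using x J1.flow_in_space[OF x, of s t] by (simp add: y_def h1_def h2_def J1.law_final J2.law_final survival_def split: split_indicator)
  \<comment> \<open>The times at which positivity is lost. The set is closed because y is
    continuous, so it contains its infimum.\<close>
  define S where "S = {s..t} \<inter> y -` {..0}"
  have "closed S"
    unfolding S_def by (rule continuous_closed_preimage[OF primitive_on_continuous[OF yp]]) auto
  have "t \<in> S" using s \<open>y t = 0\<close> by (simp add: S_def)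
  define \<tau> where "\<tau> = Inf S"
  have bdd: "bdd_below S" by (auto simp: S_def intro: bdd_belowI)
  have "\<tau> \<in> S" unfolding \<tau>_def using \<open>t \<in> S\<close> bdd \<open>closed S\<close> by (intro closed_contains_Inf) auto
  then have \<tau>: "s \<le> \<tau>" "\<tau> \<le> t" "y \<tau> \<le> 0" by (auto simp: S_def)
  have ypos: "0 < y v" if "s \<le> v" "v < \<tau>" for v
  proof (rule ccontr)
    assume "\<not> 0 < y v"
    then have "v \<in> S" using that \<tau> by (auto simp: S_def)
    then have "\<tau> \<le> v" unfolding \<tau>_def using bdd by (rule cInf_lower)
    then show False using that by simp
  qed
  have Dm: "case_prod (\<lambda>v z. ennreal (deficit A v z)) \<in> borel_measurable (borel \<Otimes>\<^sub>M N)"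
    using deficit_measurable[OF A] by simp
  \<comment> \<open>Taken from the nonnegative integral, whose measurability in v is immediate; for
    v \<le> t, where the deficit is at most 1, it is the ordinary mean.\<close>
  define q where "q v = enn2real (\<integral>\<^sup>+ z. ennreal (deficit A v z) \<partial>Q1 v (?X v))" for v
  have qm [measurable]: "q \<in> borel_measurable borel"
    unfolding q_def[abs_def] using J1.nn_integral_kernel_measurable[OF Dm, of "\<lambda>v. v" borel ?X] by measurable
  have q: "ennreal (q v) = (\<integral>\<^sup>+ z. ennreal (deficit A v z) \<partial>Q1 v (?X v))" "0 \<le> q v \<and> q v \<le> 1"
    "q v = (\<integral>z. deficit A v z \<partial>Q1 v (?X v))" if "v \<le> t" for v
  proof -
    have Xv: "?X v \<in> space N" using x by simp
    have D1: "ennreal (deficit A v z) \<le> 1" if "z \<in> space N" for z using deficit_bounds[OF A that] \<open>v \<le> t\<close> by simp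
    note I = J1.integral_kernel_enn2real[where f="\<lambda>v z. ennreal (deficit A v z)" and v=v, OF Dm Xv D1]
    show "ennreal (q v) = (\<integral>\<^sup>+ z. ennreal (deficit A v z) \<partial>Q1 v (?X v))"
      unfolding q_def using I(2) by (intro ennreal_enn2real) (auto simp: less_top[symmetric] top_unique)
    show "0 \<le> q v \<and> q v \<le> 1" unfolding q_def using enn2real_mono[OF I(2)] by simp
    have "(\<integral>z. enn2real (ennreal (deficit A v z)) \<partial>Q1 v (?X v)) = (\<integral>z. deficit A v z \<partial>Q1 v (?X v))"
      using Xv deficit_bounds(1)[OF A] by (intro Bochner_Integration.integral_cong) auto
    then show "q v = (\<integral>z. deficit A v z \<partial>Q1 v (?X v))" unfolding q_def using I(1) by simp
  qed
  have "y s \<le> (LINT v:{s..\<tau>}|lborel. \<rho>1 v (?X v) * exp (- R.hazard v) * q v)"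
  proof (rule R.hazard_comparison[OF primitive_on_subinterval[OF yp order.refl \<tau>(2)] \<tau>(1) \<tau>(3) _ qm])
    fix v assume v: "s \<le> v" "v < \<tau>"
    have Xv: "?X v \<in> space N" using x by simp
    have "\<rho>1 v (?X v) * (y v - (\<integral>z. deficit A v z \<partial>Q1 v (?X v))) \<le> g v * survival v
       + \<rho>1 v (?X v) * (q1 v - h1 v) + \<rho>2 v (?X v) * (q2 v - h2 v)"
      unfolding y_def h1_def h2_def q1_def q2_def
      using v s \<tau> ypos[OF v, unfolded y_def h1_def h2_def] by (intro drift_bound[OF A Xv]) auto
    then show "\<rho>1 v (?X v) * (y v - q v) \<le> y' v"
      using v \<tau> q(3)[of v] unfolding y'_def by (simp add: algebra_simps)
  qed (use q(2) \<tau> in auto)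
  moreover have "set_integrable lborel {s..\<tau>} (\<lambda>w. \<rho>1 w (?X w) * (exp (- R.hazard w) * q w))"
    using q(2) \<tau> R.exp_hazard_le_1 by (intro R.set_integrable_rate_bounded[where C=1]) (auto simp: abs_mult intro!: mult_le_one)
  ultimately have "ennreal (deficit A s x) \<le> (\<integral>\<^sup>+ v. ennreal (indicator {s..\<tau>} v *\<^sub>R (\<rho>1 v (?X v) * exp (- R.hazard v) * q v)) \<partial>lborel)"
    unfolding ys[symmetric] set_lebesgue_integral_def set_integrable_def using q(2) \<tau> J1.rate_nonneg
    by (subst nn_integral_eq_integral) (auto simp: mult.assoc intro!: ennreal_leI split: split_indicator)
  \<comment> \<open>The integrand of \<open>jump_op\<close> is nonnegative, so enlarging {s..\<tau>}
    to {s..t} only increases the integral.\<close>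
  also have "\<dots> \<le> J1.jump_op t (\<lambda>v z. ennreal (deficit A v z)) s x"
    unfolding J1.jump_op_def
  proof (rule nn_integral_mono)
    fix v
    show "ennreal (indicator {s..\<tau>} v *\<^sub>R (\<rho>1 v (?X v) * exp (- R.hazard v) * q v))
      \<le> ennreal (\<rho>1 v (?X v) * exp (- J1.flow_hazard s v x)) * (\<integral>\<^sup>+ z. ennreal (deficit A v z) \<partial>Q1 v (?X v)) * indicator {s..t} v"
      using q(2)[of v] q(1)[of v, symmetric] \<tau> J1.rate_nonneg
      by (cases "v \<in> {s..\<tau>}") (auto simp: J1.flow_hazard_def ennreal_mult)
  qed
  finally show ?thesis .
qed (simp add: ennreal_neg)

lemma deficit_le_jump_op_power:
  assumes A: "A \<in> sets N" and x: "x \<in> space N" and s: "t0 \<le> s" "s \<le> t"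
  shows "ennreal (deficit A s x) \<le> (J1.jump_op t ^^ n) (\<lambda>_ _. 1) s x"
  using x s
proof (induction n arbitrary: s x)
  case 0
  then show ?case using deficit_bounds[OF A] by simp
next
  case (Suc n)
  have "ennreal (deficit A s x) \<le> J1.jump_op t (\<lambda>v z. ennreal (deficit A v z)) s x" by (intro deficit_le_jump_op A Suc.prems)
  also have "\<dots> \<le> J1.jump_op t ((J1.jump_op t ^^ n) (\<lambda>_ _. 1)) s x"
    using Suc by (intro J1.jump_op_mono) auto
  finally show ?case by simp
qed

text \<open>The powers of \<open>jump_op\<close> at the constant 1 are the probabilities of at least
  n jumps up to t; that they tend to 0 is the form in which non-explosion of the first process
  enters.\<close>

theorem law_sum_ge:
  assumes A: "A \<in> sets N" and x: "x \<in> space N"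
    and lim: "(\<lambda>n. (J1.jump_op t ^^ n) (\<lambda>_ _. 1) t0 x) \<longlonglongrightarrow> 0"
  shows "exp (- G.hazard t) \<le> enn2real (J1.law t A t0 x) + enn2real (J2.law t (space N - A) t0 x)"
proof -
  have "ennreal (deficit A t0 x) \<le> 0"
    using deficit_le_jump_op_power[OF A x order.refl t0_le] by (intro LIMSEQ_le_const[OF lim]) auto
  then have "deficit A t0 x \<le> 0" by (simp add: ennreal_eq_0_iff)
  then show ?thesis by (simp add: deficit_def survival_def)
qed

end

section \<open>The embedded Markov chain\<close>

abbreviation jump_noise :: "(real \<times> real) measure" where
  "jump_noise \<equiv> density lborel (\<lambda>e. ennreal (exponential_density 1 e)) \<Otimes>\<^sub>M uniform01"

lemma prob_space_uniform01: "prob_space uniform01"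
  by (rule prob_spaceI) (simp add: emeasure_restrict_space space_restrict_space)

lemma prob_space_jump_noise: "prob_space jump_noise"
proof -
  interpret E: prob_space "density lborel (\<lambda>e. ennreal (exponential_density 1 e))"
    by (rule prob_space_exponential_density) simp
  interpret Uni: prob_space uniform01 by (rule prob_space_uniform01)
  interpret P: pair_prob_space "density lborel (\<lambda>e. ennreal (exponential_density 1 e))" uniform01 ..
  show ?thesis by (rule P.prob_space_axioms)
qed

interpretation noise: sequence_space jump_noise
  by (intro sequence_space.intro product_prob_space.intro product_sigma_finite.intro product_prob_space_axioms.intro
      prob_space_imp_sigma_finite prob_space_jump_noise)

text \<open>The recursion of \<open>pdmp_chain\<close> as a map of the current state and one noise
  coordinate. With it the chain can be started at an arbitrary time and position, as conditioning on
  the first jump requires.\<close>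

definition chain_step :: "(real \<Rightarrow> real \<Rightarrow> 'a \<Rightarrow> 'a) \<Rightarrow> (real \<Rightarrow> 'a \<Rightarrow> real) \<Rightarrow> (real \<Rightarrow> 'a \<Rightarrow> real \<Rightarrow> 'a) \<Rightarrow>
    ereal \<times> 'a \<Rightarrow> real \<times> real \<Rightarrow> ereal \<times> 'a" where
  "chain_step \<phi> r G z a =
    (if fst z = \<infinity> then (\<infinity>, snd z)
     else if next_jump \<phi> r (real_of_ereal (fst z)) (snd z) (fst a) = \<infinity> then (\<infinity>, snd z)
     else (next_jump \<phi> r (real_of_ereal (fst z)) (snd z) (fst a),
       G (real_of_ereal (next_jump \<phi> r (real_of_ereal (fst z)) (snd z) (fst a)))
         (\<phi> (real_of_ereal (fst z)) (real_of_ereal (next_jump \<phi> r (real_of_ereal (fst z)) (snd z) (fst a))) (snd z))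
         (snd a)))"

lemma pdmp_chain_Suc:
  "pdmp_chain \<phi> r G \<omega> (Suc k) = chain_step \<phi> r G (pdmp_chain \<phi> r G \<omega> k) (snd \<omega> k)"
  by (simp add: chain_step_def Let_def split_beta')

primrec chain_from :: "(real \<Rightarrow> real \<Rightarrow> 'a \<Rightarrow> 'a) \<Rightarrow> (real \<Rightarrow> 'a \<Rightarrow> real) \<Rightarrow> (real \<Rightarrow> 'a \<Rightarrow> real \<Rightarrow> 'a) \<Rightarrow>
    ereal \<times> 'a \<Rightarrow> (nat \<Rightarrow> real \<times> real) \<Rightarrow> nat \<Rightarrow> ereal \<times> 'a" where
  "chain_from \<phi> r G z \<omega> 0 = z"
| "chain_from \<phi> r G z \<omega> (Suc k) = chain_step \<phi> r G (chain_from \<phi> r G z \<omega> k) (\<omega> k)"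

lemma pdmp_chain_eq_chain_from: "pdmp_chain \<phi> r G \<omega> k = chain_from \<phi> r G (0, fst \<omega>) (snd \<omega>) k"
  by (induction k) (simp_all add: pdmp_chain_Suc del: pdmp_chain.simps(2))

text \<open>The recursion appends a last step; here the first noise coordinate is peeled off
  instead, which matches the order in which the transition operators act.\<close>

lemma chain_from_Suc_shift:
  "chain_from \<phi> r G z (case_nat a \<omega>) (Suc k) = chain_from \<phi> r G (chain_step \<phi> r G z a) \<omega> k"
  by (induction k) simp_all

lemma fst_chain_step_ge: "fst z \<noteq> -\<infinity> \<Longrightarrow> fst z \<le> fst (chain_step \<phi> r G z a)"
proof (cases "fst z")
  case (real s)
  have "ereal s \<le> next_jump \<phi> r s (snd z) (fst a)"
    unfolding next_jump_def by (rule Inf_greatest) auto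
  then show ?thesis using real by (auto simp: chain_step_def)
qed (auto simp: chain_step_def)

locale pdmp = jump_flow N \<psi> \<rho> Q for N :: "'a measure" and \<psi> \<rho> Q +
  fixes G :: "real \<Rightarrow> 'a \<Rightarrow> real \<Rightarrow> 'a"
  assumes jump_measurable: "(\<lambda>(v, x, u). G v x u) \<in> borel \<Otimes>\<^sub>M (N \<Otimes>\<^sub>M uniform01) \<rightarrow>\<^sub>M N"
    and jump_distr: "x \<in> space N \<Longrightarrow> Q v x = distr uniform01 N (G v x)"
begin

abbreviation "step \<equiv> chain_step \<psi> \<rho> G"
abbreviation "chain \<equiv> chain_from \<psi> \<rho> G"
abbreviation "Z \<equiv> (borel :: ereal measure) \<Otimes>\<^sub>M N"

lemma jump_measurable' [measurable (raw)]:
  assumes "f \<in> K \<rightarrow>\<^sub>M borel" "g \<in> K \<rightarrow>\<^sub>M N" "h \<in> K \<rightarrow>\<^sub>M uniform01"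
  shows "(\<lambda>w. G (f w) (g w) (h w)) \<in> K \<rightarrow>\<^sub>M N"
proof -
  have "(\<lambda>w. (f w, g w, h w)) \<in> K \<rightarrow>\<^sub>M borel \<Otimes>\<^sub>M (N \<Otimes>\<^sub>M uniform01)" using assms by measurable
  from measurable_compose[OF this jump_measurable] show ?thesis by simp
qed

lemma next_jump_eq_passage:
  assumes x: "x \<in> space N"
  shows "next_jump \<psi> \<rho> s x e = hazard_rate.passage (\<lambda>w. \<rho> w (\<psi> s w x)) s e"
proof -
  interpret R: hazard_rate "\<lambda>w. \<rho> w (\<psi> s w x)" s by (rule hazard_rate_flow[OF x])
  show ?thesis by (simp add: next_jump_def R.passage_def R.hazard_def)
qed

lemma next_jump_less_iff:
  assumes x: "x \<in> space N"
  shows "next_jump \<psi> \<rho> s x e < ereal c \<longleftrightarrow> s < c \<and> e < flow_hazard s c x"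
  unfolding next_jump_eq_passage[OF x] flow_hazard_def
  by (rule hazard_rate.passage_less_iff[OF hazard_rate_flow[OF x]])

text \<open>The infimum runs over uncountably many times, but \<open>next_jump_less_iff\<close>
  turns each finite sublevel set into a comparison of the threshold with the jointly measurable
  \<open>flow_hazard\<close>. The level infinity is a countable union of these.\<close>

lemma next_jump_measurable [measurable (raw)]:
  assumes f [measurable]: "f \<in> K \<rightarrow>\<^sub>M borel" and g [measurable]: "g \<in> K \<rightarrow>\<^sub>M N" and h [measurable]: "h \<in> K \<rightarrow>\<^sub>M borel"
  shows "(\<lambda>w. next_jump \<psi> \<rho> (f w) (g w) (h w)) \<in> K \<rightarrow>\<^sub>M borel"
proof (rule borel_measurableI_less)
  fix y :: ereal
  have real: "{w \<in> space K. next_jump \<psi> \<rho> (f w) (g w) (h w) < ereal c} \<in> sets K" for c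
  proof -
    have "{w \<in> space K. next_jump \<psi> \<rho> (f w) (g w) (h w) < ereal c} = {w \<in> space K. f w < c \<and> h w < flow_hazard (f w) c (g w)}"
      using measurable_space[OF g] by (auto simp: next_jump_less_iff)
    also have "\<dots> \<in> sets K" by measurable
    finally show ?thesis .
  qed
  consider (r) c where "y = ereal c" | (p) "y = \<infinity>" | (m) "y = -\<infinity>" by (cases y) auto
  then show "{w \<in> space K. next_jump \<psi> \<rho> (f w) (g w) (h w) < y} \<in> sets K"
  proof cases
    case p
    have "{w \<in> space K. next_jump \<psi> \<rho> (f w) (g w) (h w) < y}
      = (\<Union>n::nat. {w \<in> space K. next_jump \<psi> \<rho> (f w) (g w) (h w) < ereal (real n)})"
      using p less_PInf_Ex_of_nat by auto
    also have "\<dots> \<in> sets K" using real by (intro sets.countable_UN) auto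
    finally show ?thesis .
  qed (simp_all add: real)
qed

lemma step_measurable [measurable (raw)]:
  assumes [measurable]: "f \<in> K \<rightarrow>\<^sub>M Z" "g \<in> K \<rightarrow>\<^sub>M jump_noise"
  shows "(\<lambda>w. step (f w) (g w)) \<in> K \<rightarrow>\<^sub>M Z"
proof -
  have [measurable]: "(\<lambda>w. fst (g w)) \<in> K \<rightarrow>\<^sub>M borel" "(\<lambda>w. snd (g w)) \<in> K \<rightarrow>\<^sub>M uniform01"
    using measurable_compose[OF assms(2) measurable_fst] measurable_compose[OF assms(2) measurable_snd] by simp_all
  show ?thesis unfolding chain_step_def by measurable
qed

lemma step_in_space:
  assumes "z \<in> space Z" "a \<in> space jump_noise" shows "step z a \<in> space Z"
proof -
  have "(\<lambda>w. step (fst w) (snd w)) \<in> Z \<Otimes>\<^sub>M jump_noise \<rightarrow>\<^sub>M Z"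
    by (rule step_measurable[OF measurable_fst measurable_snd])
  from measurable_space[OF this, of "(z, a)"] show ?thesis
    using assms by (simp add: space_pair_measure)
qed

lemma chain_measurable [measurable (raw)]:
  assumes [measurable]: "f \<in> K \<rightarrow>\<^sub>M Z" "g \<in> K \<rightarrow>\<^sub>M noise.S"
  shows "(\<lambda>w. chain (f w) (g w) k) \<in> K \<rightarrow>\<^sub>M Z"
proof (induction k)
  case (Suc k)
  have "(\<lambda>w. g w k) \<in> K \<rightarrow>\<^sub>M jump_noise" by measurable
  with Suc show ?case by simp
qed simp

definition transition :: "(ereal \<times> 'a \<Rightarrow> ennreal) \<Rightarrow> ereal \<times> 'a \<Rightarrow> ennreal" where
  "transition f z = (\<integral>\<^sup>+ a. f (step z a) \<partial>jump_noise)"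

text \<open>Two consecutive states appear because lying between jumps k and k + 1 at time t involves
  both jump times. The induction removes the first noise coordinate; the last step is integrated in
  the base case.\<close>

lemma nn_integral_chain:
  assumes w: "case_prod w \<in> borel_measurable (Z \<Otimes>\<^sub>M Z)" and z: "z \<in> space Z"
  shows "(\<integral>\<^sup>+ \<omega>. w (chain z \<omega> k) (chain z \<omega> (Suc k)) \<partial>noise.S)
    = (transition ^^ k) (\<lambda>z. \<integral>\<^sup>+ a. w z (step z a) \<partial>jump_noise) z"
  using z
proof (induction k arbitrary: z)
  have *: "(\<integral>\<^sup>+ \<omega>. w (chain z \<omega> k) (chain z \<omega> (Suc k)) \<partial>noise.S)
    = (\<integral>\<^sup>+ a. \<integral>\<^sup>+ \<omega>. w (chain z (case_nat a \<omega>) k) (chain z (case_nat a \<omega>) (Suc k)) \<partial>noise.S \<partial>jump_noise)"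
    if z: "z \<in> space Z" for k z
  proof -
    let ?f = "\<lambda>\<omega>. w (chain z \<omega> k) (chain z \<omega> (Suc k))"
    have c: "(\<lambda>\<omega>. chain z \<omega> k) \<in> noise.S \<rightarrow>\<^sub>M Z" for k using z by measurable
    have f: "?f \<in> borel_measurable noise.S"
      using measurable_compose[OF measurable_Pair[OF c[of k] c[of "Suc k"]] w] by simp
    have m: "(\<lambda>(s, \<omega>). case_nat s \<omega>) \<in> jump_noise \<Otimes>\<^sub>M noise.S \<rightarrow>\<^sub>M noise.S" by measurable
    \<comment> \<open>A noise sequence has the law of an independent first coordinate put in front
      of another noise sequence.\<close>
    have "(\<integral>\<^sup>+ \<omega>. ?f \<omega> \<partial>noise.S) = (\<integral>\<^sup>+ \<omega>. ?f \<omega> \<partial>distr (jump_noise \<Otimes>\<^sub>M noise.S) noise.S (\<lambda>(s, \<omega>). case_nat s \<omega>))"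
      by (simp only: noise.PiM_iter)
    also have "\<dots> = (\<integral>\<^sup>+ p. ?f (case_nat (fst p) (snd p)) \<partial>(jump_noise \<Otimes>\<^sub>M noise.S))"
      using f m by (subst nn_integral_distr) (auto simp: split_beta')
    also have "\<dots> = (\<integral>\<^sup>+ a. \<integral>\<^sup>+ \<omega>. ?f (case_nat a \<omega>) \<partial>noise.S \<partial>jump_noise)"
      using measurable_compose[OF m f]
      by (subst noise.P.nn_integral_fst[symmetric]) (auto simp: split_beta')
    finally show ?thesis .
  qed
  {
    case 0
    then show ?case
      unfolding *[OF 0] by (simp add: noise.P.emeasure_space_1)
  next
    case (Suc k)
    show ?case
      unfolding *[OF Suc.prems] chain_from_Suc_shift funpow.simps o_apply
      by (subst transition_def) (intro nn_integral_cong Suc.IH step_in_space Suc.prems)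
  }
qed

end

section \<open>The transition operator in terms of the jump operator\<close>

context pdmp begin

text \<open>Functions of time and position, read on the states of the chain that are reached before
  \<open>t\<close>. States with first component \<open>-\<infinity>\<close> are junk and never reached.\<close>

definition on_chain :: "real \<Rightarrow> (real \<Rightarrow> 'a \<Rightarrow> ennreal) \<Rightarrow> ereal \<times> 'a \<Rightarrow> ennreal" where
  "on_chain t f z = f (real_of_ereal (fst z)) (snd z) * indicator {..ereal t} (fst z)"

lemma nn_integral_jump:
  assumes f: "f \<in> borel_measurable N" and x: "x \<in> space N"
  shows "(\<integral>\<^sup>+ u. f (G v x u) \<partial>uniform01) = (\<integral>\<^sup>+ y. f y \<partial>Q v x)"
proof -
  have "G v x \<in> uniform01 \<rightarrow>\<^sub>M N" using jump_measurable'[of "\<lambda>_. v" uniform01 "\<lambda>_. x" "\<lambda>u. u"] x by simp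
  then show ?thesis unfolding jump_distr[OF x] using f by (subst nn_integral_distr) auto
qed

text \<open>Integrating over U turns \<open>G\<close> into the kernel, and integrating over E turns
  the threshold into the jump time density, which leaves \<open>jump_op\<close>. From a state later
  than t both sides vanish, since jump times never decrease.\<close>

lemma transition_on_chain:
  assumes f: "case_prod f \<in> borel_measurable (borel \<Otimes>\<^sub>M N)" and z: "z \<in> space Z" "fst z \<noteq> -\<infinity>"
  shows "transition (on_chain t f) z = on_chain t (jump_op t f) z"
proof (cases "fst z")
  case (real s)
  define x where "x = snd z"
  have x [measurable]: "x \<in> space N" and zz: "z = (ereal s, x)"
    using z real by (auto simp: x_def space_pair_measure prod_eq_iff)
  note [measurable] = f
  interpret R: hazard_rate "\<lambda>w. \<rho> w (\<psi> s w x)" s by (rule hazard_rate_flow[OF x])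
  interpret Uni: prob_space uniform01 by (rule prob_space_uniform01)
  let ?E = "density lborel (\<lambda>e. ennreal (exponential_density 1 e))"
  \<comment> \<open>The mean of f after a jump at time \<tau>, cut off at t; the indicator removes
    an infinite \<tau>, whose real value is a mere default.\<close>
  define h where "h \<tau> = (\<integral>\<^sup>+ y. f (real_of_ereal \<tau>) y \<partial>Q (real_of_ereal \<tau>) (\<psi> s (real_of_ereal \<tau>) x)) * indicator {..ereal t} \<tau>" for \<tau> :: ereal
  have hm: "h \<in> borel_measurable borel"
    unfolding h_def[abs_def] by measurable
  have lm: "on_chain t f \<in> borel_measurable Z"
    unfolding on_chain_def[abs_def]
    by (intro borel_measurable_times_ennreal case_prod_apply_measurable[OF f]) measurable
  have sm: "(\<lambda>a. step z a) \<in> jump_noise \<rightarrow>\<^sub>M Z" using z(1) by measurable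
  have "transition (on_chain t f) z = (\<integral>\<^sup>+ e. \<integral>\<^sup>+ u. on_chain t f (step z (e, u)) \<partial>uniform01 \<partial>?E)"
    unfolding transition_def using measurable_compose[OF sm lm] by (subst Uni.nn_integral_fst[symmetric]) auto
  also have "\<dots> = (\<integral>\<^sup>+ e. h (R.passage e) \<partial>?E)"
  proof (rule nn_integral_cong)
    fix e
    have nj: "next_jump \<psi> \<rho> s x e = R.passage e" by (rule next_jump_eq_passage[OF x])
    show "(\<integral>\<^sup>+ u. on_chain t f (step z (e, u)) \<partial>uniform01) = h (R.passage e)"
    proof (cases "R.passage e")
      case (real \<tau>)
      have "(\<integral>\<^sup>+ u. on_chain t f (step z (e, u)) \<partial>uniform01)
        = (\<integral>\<^sup>+ u. f \<tau> (G \<tau> (\<psi> s \<tau> x) u) * indicator {..ereal t} (ereal \<tau>) \<partial>uniform01)"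
        by (rule nn_integral_cong) (simp add: chain_step_def zz nj real on_chain_def)
      also have "\<dots> = (\<integral>\<^sup>+ y. f \<tau> y * indicator {..ereal t} (ereal \<tau>) \<partial>Q \<tau> (\<psi> s \<tau> x))"
        using case_prod_apply_measurable[OF f, of "\<lambda>_. \<tau>" N "\<lambda>y. y"] x
        by (intro nn_integral_jump[where f="\<lambda>y. f \<tau> y * indicator {..ereal t} (ereal \<tau>)"]) auto
      also have "\<dots> = h (R.passage e)"
        unfolding h_def real using kernel_section_measurable[OF f flow_in_space[OF x]]
        by (subst nn_integral_multc) auto
      finally show ?thesis .
    next
      case PInf
      then show ?thesis by (simp add: chain_step_def zz nj on_chain_def h_def)
    next
      case MInf
      then show ?thesis using R.passage_ge[of e] by simp
    qed
  qed
  also have "\<dots> = (\<integral>\<^sup>+ v. ennreal (\<rho> v (\<psi> s v x) * exp (- R.hazard v)) * h (ereal v) * indicator {s..t} v \<partial>lborel)"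
    using hm by (rule R.nn_integral_exponential_passage) (auto simp: h_def)
  also have "\<dots> = jump_op t f s x"
    unfolding jump_op_def flow_hazard_def by (intro nn_integral_cong) (auto simp: h_def split: split_indicator)
  also have "\<dots> = on_chain t (jump_op t f) z"
    by (cases "s \<le> t") (auto simp: zz on_chain_def jump_op_def)
  finally show ?thesis .
next
  case PInf
  then show ?thesis by (simp add: on_chain_def transition_def chain_step_def)
next
  case MInf
  then show ?thesis using z by simp
qed

lemma fst_step_not_MInf: "fst z \<noteq> -\<infinity> \<Longrightarrow> fst (step z a) \<noteq> -\<infinity>"
  using fst_chain_step_ge[of z \<psi> \<rho> G a] by auto

text \<open>\<open>real_of_ereal\<close> would read minus infinity as time 0, so agreement of
  \<open>W\<close> with \<open>on_chain\<close> is asked only away from such states; the steps never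
  lead there.\<close>

lemma transition_power_on_chain:
  assumes f: "case_prod f \<in> borel_measurable (borel \<Otimes>\<^sub>M N)"
    and W: "\<And>z. z \<in> space Z \<Longrightarrow> fst z \<noteq> -\<infinity> \<Longrightarrow> W z = on_chain t f z"
    and z: "z \<in> space Z" "fst z \<noteq> -\<infinity>"
  shows "(transition ^^ k) W z = on_chain t ((jump_op t ^^ k) f) z"
  using z
proof (induction k arbitrary: z)
  case (Suc k)
  have "(transition ^^ Suc k) W z = transition (on_chain t ((jump_op t ^^ k) f)) z"
    unfolding funpow.simps o_apply
    apply (subst (1 2) transition_def)
    using Suc.prems by (intro nn_integral_cong Suc.IH step_in_space fst_step_not_MInf)
  also have "\<dots> = on_chain t ((jump_op t ^^ Suc k) f) z"
    using Suc.prems by (subst transition_on_chain) (auto intro: jump_op_power_measurable[OF f])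
  finally show ?case .
qed (simp add: W)

lemma emeasure_chain_alive:
  assumes x: "x \<in> space N" and t: "0 \<le> t"
  shows "emeasure noise.S {\<omega> \<in> space noise.S. fst (chain (0, x) \<omega> k) \<le> ereal t} = (jump_op t ^^ k) (\<lambda>_ _. 1) 0 x"
proof -
  let ?w = "\<lambda>z z' :: ereal \<times> 'a. indicator {..ereal t} (fst z) :: ennreal"
  have z: "(0, x) \<in> space Z" using x by (simp add: space_pair_measure)
  have c [measurable]: "(\<lambda>\<omega>. chain (0, x) \<omega> k) \<in> noise.S \<rightarrow>\<^sub>M Z" using z by measurable
  have "emeasure noise.S {\<omega> \<in> space noise.S. fst (chain (0, x) \<omega> k) \<le> ereal t}
     = (\<integral>\<^sup>+ \<omega>. indicator {\<omega> \<in> space noise.S. fst (chain (0, x) \<omega> k) \<le> ereal t} \<omega> \<partial>noise.S)"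
    by (rule nn_integral_indicator[symmetric]) measurable
  also have "\<dots> = (\<integral>\<^sup>+ \<omega>. ?w (chain (0, x) \<omega> k) (chain (0, x) \<omega> (Suc k)) \<partial>noise.S)"
    by (intro nn_integral_cong) (auto split: split_indicator)
  also have "\<dots> = (transition ^^ k) (\<lambda>z. \<integral>\<^sup>+ a. ?w z (step z a) \<partial>jump_noise) (0, x)"
    by (rule nn_integral_chain[OF _ z]) measurable
  also have "\<dots> = on_chain t ((jump_op t ^^ k) (\<lambda>_ _. 1)) (0, x)"
    using z prob_space.emeasure_space_1[OF prob_space_jump_noise]
    by (intro transition_power_on_chain) (auto simp: on_chain_def split: split_indicator)
  finally show ?thesis using t by (simp add: on_chain_def)
qed

text \<open>Given a k-th state (s, y) with s \<le> t, the event says that the next passage time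
  exceeds t and that the flow line is in A at time t; its conditional probability is
  \<open>stay t A s y\<close>.\<close>

lemma emeasure_chain_at:
  assumes A [measurable]: "A \<in> sets N" and x: "x \<in> space N" and t: "0 \<le> t"
  defines "E \<equiv> \<lambda>k. {\<omega> \<in> space noise.S. fst (chain (0, x) \<omega> k) \<le> ereal t \<and> ereal t < fst (chain (0, x) \<omega> (Suc k))
     \<and> \<psi> (real_of_ereal (fst (chain (0, x) \<omega> k))) t (snd (chain (0, x) \<omega> k)) \<in> A}"
  shows "E k \<in> sets noise.S" "emeasure noise.S (E k) = (jump_op t ^^ k) (stay t A) 0 x"
proof -
  let ?w = "\<lambda>z z' :: ereal \<times> 'a. indicator {..ereal t} (fst z) * indicator {ereal t<..} (fst z')
     * indicator A (\<psi> (real_of_ereal (fst z)) t (snd z)) :: ennreal"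
  have z: "(0, x) \<in> space Z" using x by (simp add: space_pair_measure)
  have c [measurable]: "(\<lambda>\<omega>. chain (0, x) \<omega> k) \<in> noise.S \<rightarrow>\<^sub>M Z" for k using z by measurable
  show E [measurable]: "E k \<in> sets noise.S" unfolding E_def by measurable
  have "emeasure noise.S (E k) = (\<integral>\<^sup>+ \<omega>. indicator (E k) \<omega> \<partial>noise.S)"
    by (rule nn_integral_indicator[symmetric]) measurable
  also have "\<dots> = (\<integral>\<^sup>+ \<omega>. ?w (chain (0, x) \<omega> k) (chain (0, x) \<omega> (Suc k)) \<partial>noise.S)"
    by (intro nn_integral_cong) (auto simp: E_def split: split_indicator)
  also have "\<dots> = (transition ^^ k) (\<lambda>z. \<integral>\<^sup>+ a. ?w z (step z a) \<partial>jump_noise) (0, x)"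
    by (rule nn_integral_chain[OF _ z]) measurable
  also have "\<dots> = on_chain t ((jump_op t ^^ k) (stay t A)) (0, x)"
  proof (rule transition_power_on_chain[OF stay_measurable[OF A]])
    fix z :: "ereal \<times> 'a" assume z: "z \<in> space Z" "fst z \<noteq> -\<infinity>"
    show "(\<integral>\<^sup>+ a. ?w z (step z a) \<partial>jump_noise) = on_chain t (stay t A) z"
    proof (cases "fst z \<le> ereal t")
      case True
      define y where "y = snd z"
      obtain s where zz: "z = (ereal s, y)" and s: "s \<le> t"
        using z(2) True by (cases z, cases "fst z") (auto simp: y_def)
      have y [measurable]: "y \<in> space N" using z zz by (auto simp: space_pair_measure)
      interpret R: hazard_rate "\<lambda>w. \<rho> w (\<psi> s w y)" s by (rule hazard_rate_flow[OF y])
      interpret Uni: prob_space uniform01 by (rule prob_space_uniform01)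
      let ?E = "density lborel (\<lambda>e. ennreal (exponential_density 1 e))"
      \<comment> \<open>The time component after a step is the passage time in the finite and the
        infinite case alike, so the second noise coordinate integrates to 1.\<close>
      have "(\<integral>\<^sup>+ a. ?w z (step z a) \<partial>jump_noise)
        = (\<integral>\<^sup>+ a. indicator A (\<psi> s t y) * indicator {ereal t<..} (R.passage (fst a)) \<partial>jump_noise)"
        using s by (intro nn_integral_cong) (auto simp: zz chain_step_def next_jump_eq_passage[OF y] split: split_indicator)
      also have "\<dots> = (\<integral>\<^sup>+ e. \<integral>\<^sup>+ u. indicator A (\<psi> s t y) * indicator {ereal t<..} (R.passage e) \<partial>uniform01 \<partial>?E)"
        by (subst Uni.nn_integral_fst[symmetric]) auto
      also have "\<dots> = (\<integral>\<^sup>+ e. indicator A (\<psi> s t y) * indicator {ereal t<..} (R.passage e) \<partial>?E)"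
        using Uni.emeasure_space_1 by (simp add: space_restrict_space)
      also have "\<dots> = indicator A (\<psi> s t y) * (\<integral>\<^sup>+ e. indicator {ereal t<..} (R.passage e) \<partial>?E)"
        by (rule nn_integral_cmult) measurable
      also have "\<dots> = on_chain t (stay t A) z"
        using s by (subst R.nn_integral_exponential_survival[OF s]) (simp add: on_chain_def stay_def zz flow_hazard_def mult.commute)
      finally show ?thesis .
    qed (simp add: on_chain_def)
  qed (use z in auto)
  finally show "emeasure noise.S (E k) = (jump_op t ^^ k) (stay t A) 0 x" using t by (simp add: on_chain_def)
qed

end

section \<open>Jump times and paths for a fixed noise sequence\<close>

lemma
  shows fst_pdmp_chain_nonneg: "0 \<le> fst (pdmp_chain \<phi> r G \<omega> k)"
    and fst_pdmp_chain_mono: "j \<le> k \<Longrightarrow> fst (pdmp_chain \<phi> r G \<omega> j) \<le> fst (pdmp_chain \<phi> r G \<omega> k)"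
proof -
  have step: "0 \<le> fst (pdmp_chain \<phi> r G \<omega> k) \<Longrightarrow> fst (pdmp_chain \<phi> r G \<omega> k) \<le> fst (pdmp_chain \<phi> r G \<omega> (Suc k))" for k
    unfolding pdmp_chain_Suc by (rule fst_chain_step_ge) auto
  show nn: "0 \<le> fst (pdmp_chain \<phi> r G \<omega> k)" for k
  proof (induction k)
    case (Suc k)
    then show ?case using step[of k] order_trans by blast
  qed simp
  show "j \<le> k \<Longrightarrow> fst (pdmp_chain \<phi> r G \<omega> j) \<le> fst (pdmp_chain \<phi> r G \<omega> k)"
    by (rule lift_Suc_mono_le[of "\<lambda>k. fst (pdmp_chain \<phi> r G \<omega> k)"]) (rule step[OF nn])
qed

lemma pdmp_path_None_iff:
  "pdmp_path \<phi> r G \<omega> t = None \<longleftrightarrow> (\<forall>k. fst (pdmp_chain \<phi> r G \<omega> k) \<le> ereal t)"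
  by (auto simp: pdmp_path_def Let_def SUP_le_iff)

text \<open>Jump times are nondecreasing, so the least k in \<open>pdmp_path\<close> is the only
  admissible one. The existential form is a countable union of events of the chain.\<close>

lemma pdmp_path_mem_iff:
  fixes \<phi> r G \<omega>
  defines "S \<equiv> \<lambda>k. fst (pdmp_chain \<phi> r G \<omega> k)" and "X \<equiv> \<lambda>k. snd (pdmp_chain \<phi> r G \<omega> k)"
  assumes t: "0 \<le> t"
  shows "pdmp_path \<phi> r G \<omega> t \<in> Some ` A \<longleftrightarrow>
    (\<exists>k. S k \<le> ereal t \<and> ereal t < S (Suc k) \<and> \<phi> (real_of_ereal (S k)) t (X k) \<in> A)"
proof -
  have mono: "j \<le> k \<Longrightarrow> S j \<le> S k" for j k unfolding S_def by (rule fst_pdmp_chain_mono)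
  have uniq: "j = k" if "S j \<le> ereal t" "ereal t < S (Suc j)" "S k \<le> ereal t" "ereal t < S (Suc k)" for j k
  proof (rule ccontr)
    assume "j \<noteq> k"
    then consider "Suc j \<le> k" | "Suc k \<le> j" by linarith
    then show False using mono[of "Suc j" k] mono[of "Suc k" j] that by cases auto
  qed
  have path: "pdmp_path \<phi> r G \<omega> t = Some (\<phi> (real_of_ereal (S k)) t (X k))"
    if k: "S k \<le> ereal t" "ereal t < S (Suc k)" for k
  proof -
    have "(LEAST k. S k \<le> ereal t \<and> ereal t < S (Suc k)) = k"
      using k uniq by (intro Least_equality) auto
    moreover have "\<not> (SUP k. S k) \<le> ereal t" using k(2) by (auto simp: SUP_le_iff not_le)
    ultimately show ?thesis unfolding pdmp_path_def Let_def S_def X_def by simp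
  qed
  have ex: "\<exists>k. S k \<le> ereal t \<and> ereal t < S (Suc k)" if "pdmp_path \<phi> r G \<omega> t \<noteq> None"
  proof -
    \<comment> \<open>The first jump time beyond t has positive index because S 0 = 0 \<le> t; its
      predecessor is the required k.\<close>
    define n where "n = (LEAST n. ereal t < S n)"
    have n: "ereal t < S n"
      using that unfolding pdmp_path_None_iff n_def S_def by (auto simp: not_le intro: LeastI)
    have "S 0 \<le> ereal t" using t by (simp add: S_def)
    with n obtain k where k: "n = Suc k" by (cases n) auto
    then have "\<not> ereal t < S k" unfolding n_def by (metis lessI not_less_Least)
    with n k show ?thesis by (auto simp: not_less)
  qed
  show ?thesis
  proof
    assume *: "pdmp_path \<phi> r G \<omega> t \<in> Some ` A"
    then obtain k where k: "S k \<le> ereal t" "ereal t < S (Suc k)" using ex by auto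
    then show "\<exists>k. S k \<le> ereal t \<and> ereal t < S (Suc k) \<and> \<phi> (real_of_ereal (S k)) t (X k) \<in> A"
      using * path[OF k] by auto
  next
    assume "\<exists>k. S k \<le> ereal t \<and> ereal t < S (Suc k) \<and> \<phi> (real_of_ereal (S k)) t (X k) \<in> A"
    then show "pdmp_path \<phi> r G \<omega> t \<in> Some ` A" using path by auto
  qed
qed

section \<open>The canonical space with a deterministic starting point\<close>

lemma pdmp_space_eq: "pdmp_space \<mu> = \<mu> \<Otimes>\<^sub>M noise.S"
  by (simp add: pdmp_space_def)

lemma sets_pdmp_space_return: "sets (pdmp_space (return N x)) = sets (N \<Otimes>\<^sub>M noise.S)"
  unfolding pdmp_space_eq by (rule sets_pair_measure_cong) simp_all

text \<open>The starting point is deterministic, so only the section of the event at x carries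
  mass.\<close>

lemma emeasure_pdmp_space_return:
  assumes x: "x \<in> space N" and E: "E \<in> sets (N \<Otimes>\<^sub>M noise.S)"
  shows "emeasure (pdmp_space (return N x)) E = emeasure noise.S (Pair x -` E)"
proof -
  have "E \<in> sets (return N x \<Otimes>\<^sub>M noise.S)"
    using E sets_pdmp_space_return[of N x] by (simp add: pdmp_space_eq)
  then have "emeasure (pdmp_space (return N x)) E = (\<integral>\<^sup>+ y. emeasure noise.S (Pair y -` E) \<partial>return N x)"
    unfolding pdmp_space_eq by (rule noise.P.emeasure_pair_measure_alt)
  also have "\<dots> = emeasure noise.S (Pair x -` E)"
    using x noise.P.measurable_emeasure_Pair[OF E] by (rule nn_integral_return)
  finally show ?thesis .
qed

lemma prob_space_pdmp_space: "x \<in> space N \<Longrightarrow> prob_space (pdmp_space (return N x))"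
proof -
  assume "x \<in> space N"
  then interpret R: prob_space "return N x" by (rule prob_space_return)
  interpret P: pair_prob_space "return N x" noise.S ..
  show ?thesis unfolding pdmp_space_eq by (rule P.prob_space_axioms)
qed

section \<open>Law and non-explosion of the process on the canonical space\<close>

context pdmp begin

lemma pdmp_chain_measurable [measurable]:
  "(\<lambda>\<omega>. pdmp_chain \<psi> \<rho> G \<omega> k) \<in> N \<Otimes>\<^sub>M noise.S \<rightarrow>\<^sub>M Z"
  unfolding pdmp_chain_eq_chain_from by measurable

definition path_event :: "real \<Rightarrow> 'a set \<Rightarrow> ('a \<times> (nat \<Rightarrow> real \<times> real)) set" where
  "path_event t A = {\<omega> \<in> space (N \<Otimes>\<^sub>M noise.S). pdmp_path \<psi> \<rho> G \<omega> t \<in> Some ` A}"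

text \<open>Up to time t the number k of jumps splits the event into the disjoint events of
  \<open>emeasure_chain_at\<close>, whose probabilities are the terms of the series
  \<open>law\<close>.\<close>

lemma path_event:
  assumes A [measurable]: "A \<in> sets N" and x: "x \<in> space N" and t: "0 \<le> t"
  shows "path_event t A \<in> sets (N \<Otimes>\<^sub>M noise.S)"
    and "emeasure (pdmp_space (return N x)) (path_event t A) = law t A 0 x"
proof -
  let ?E = "\<lambda>k. {\<omega> \<in> space (N \<Otimes>\<^sub>M noise.S). fst (pdmp_chain \<psi> \<rho> G \<omega> k) \<le> ereal t
     \<and> ereal t < fst (pdmp_chain \<psi> \<rho> G \<omega> (Suc k))
     \<and> \<psi> (real_of_ereal (fst (pdmp_chain \<psi> \<rho> G \<omega> k))) t (snd (pdmp_chain \<psi> \<rho> G \<omega> k)) \<in> A}"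
  have E: "?E k \<in> sets (N \<Otimes>\<^sub>M noise.S)" for k
  proof -
    have [measurable]: "(\<lambda>\<omega>. fst (pdmp_chain \<psi> \<rho> G \<omega> k)) \<in> N \<Otimes>\<^sub>M noise.S \<rightarrow>\<^sub>M borel"
      "(\<lambda>\<omega>. snd (pdmp_chain \<psi> \<rho> G \<omega> k)) \<in> N \<Otimes>\<^sub>M noise.S \<rightarrow>\<^sub>M N" for k
      using measurable_compose[OF pdmp_chain_measurable measurable_fst] measurable_compose[OF pdmp_chain_measurable measurable_snd] by simp_all
    show ?thesis by measurable
  qed
  have un: "path_event t A = (\<Union>k. ?E k)"
    unfolding path_event_def pdmp_path_mem_iff[OF t] by blast
  then show "path_event t A \<in> sets (N \<Otimes>\<^sub>M noise.S)"
    using E by (simp del: pdmp_chain.simps add: sets.countable_UN)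
  have "?E j \<inter> ?E k = {}" if "j \<noteq> k" for j k
  proof -
    have "\<omega> \<notin> ?E k" if \<omega>: "\<omega> \<in> ?E j" for \<omega>
    proof
      assume \<omega>': "\<omega> \<in> ?E k"
      consider "Suc j \<le> k" | "Suc k \<le> j" using \<open>j \<noteq> k\<close> by linarith
      then show False
        using fst_pdmp_chain_mono[of "Suc j" k \<psi> \<rho> G \<omega>] fst_pdmp_chain_mono[of "Suc k" j \<psi> \<rho> G \<omega>] \<omega> \<omega>'
        by cases (auto simp del: pdmp_chain.simps)
    qed
    then show ?thesis by blast
  qed
  then have dj: "disjoint_family ?E" unfolding disjoint_family_on_def by blast
  have "emeasure (pdmp_space (return N x)) (path_event t A) = (\<Sum>k. emeasure (pdmp_space (return N x)) (?E k))"
    unfolding un using E dj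
    by (intro suminf_emeasure[symmetric]) (auto simp: sets_pdmp_space_return simp del: pdmp_chain.simps)
  also have "\<dots> = law t A 0 x"
    unfolding law_def
  proof (rule arg_cong[where f=suminf], rule ext)
    fix k
    have "Pair x -` ?E k = {\<omega> \<in> space noise.S. fst (chain (0, x) \<omega> k) \<le> ereal t \<and> ereal t < fst (chain (0, x) \<omega> (Suc k))
     \<and> \<psi> (real_of_ereal (fst (chain (0, x) \<omega> k))) t (snd (chain (0, x) \<omega> k)) \<in> A}"
      using x by (auto simp: space_pair_measure pdmp_chain_eq_chain_from simp del: pdmp_chain.simps chain_from.simps)
    then show "emeasure (pdmp_space (return N x)) (?E k) = (jump_op t ^^ k) (stay t A) 0 x"
      by (subst emeasure_pdmp_space_return[OF x E]) (simp only: emeasure_chain_at(2)[OF A x t])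
  qed
  finally show "emeasure (pdmp_space (return N x)) (path_event t A) = law t A 0 x" .
qed

text \<open>By \<open>emeasure_chain_alive\<close> these are the probabilities that the n-th jump
  time is at most t. The events decrease to that of the path being in the cemetery at time t, which
  is null.\<close>

lemma jump_op_power_one_tendsto:
  assumes x: "x \<in> space N" and t: "0 \<le> t"
    and ae: "AE \<omega> in pdmp_space (return N x). pdmp_path \<psi> \<rho> G \<omega> t \<noteq> None"
  shows "(\<lambda>n. (jump_op t ^^ n) (\<lambda>_ _. 1) 0 x) \<longlonglongrightarrow> 0"
proof -
  interpret P: prob_space "pdmp_space (return N x)" using x by (rule prob_space_pdmp_space)
  let ?F = "\<lambda>n. {\<omega> \<in> space (N \<Otimes>\<^sub>M noise.S). fst (pdmp_chain \<psi> \<rho> G \<omega> n) \<le> ereal t}"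
  have F: "?F n \<in> sets (N \<Otimes>\<^sub>M noise.S)" for n by measurable
  note sets = sets_pdmp_space_return[of N x]
  have "(\<lambda>n. emeasure (pdmp_space (return N x)) (?F n)) \<longlonglongrightarrow> emeasure (pdmp_space (return N x)) (\<Inter>n. ?F n)"
  proof (rule Lim_emeasure_decseq)
    show "decseq ?F"
      unfolding decseq_def using fst_pdmp_chain_mono[of _ _ \<psi> \<rho> G] order_trans by blast
    show "range ?F \<subseteq> sets (pdmp_space (return N x))" unfolding sets using F by (rule image_subsetI)
    show "emeasure (pdmp_space (return N x)) (?F n) \<noteq> \<infinity>" for n by (simp add: P.emeasure_finite)
  qed
  moreover have "emeasure (pdmp_space (return N x)) (\<Inter>n. ?F n) = 0"
  proof -
    have "AE \<omega> in pdmp_space (return N x). \<omega> \<notin> (\<Inter>n. ?F n)"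
      using ae by eventually_elim (auto simp: pdmp_path_None_iff)
    moreover have m: "(\<Inter>n. ?F n) \<in> sets (pdmp_space (return N x))"
      unfolding sets using F by (intro sets.countable_INT) auto
    ultimately show ?thesis
      using sets.sets_into_space[OF m] by (subst (asm) AE_iff_measurable[OF m]) auto
  qed
  moreover have "emeasure (pdmp_space (return N x)) (?F n) = (jump_op t ^^ n) (\<lambda>_ _. 1) 0 x" for n
  proof -
    have "Pair x -` ?F n = {\<omega> \<in> space noise.S. fst (chain (0, x) \<omega> n) \<le> ereal t}"
      using x by (auto simp: space_pair_measure pdmp_chain_eq_chain_from)
    then show ?thesis
      by (subst emeasure_pdmp_space_return[OF x F]) (simp only: emeasure_chain_alive[OF x t])
  qed
  ultimately show ?thesis by simp
qed

lemma law_total: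
  assumes x: "x \<in> space N" and t: "0 \<le> t"
    and ae: "AE \<omega> in pdmp_space (return N x). pdmp_path \<psi> \<rho> G \<omega> t \<noteq> None"
  shows "law t (space N) 0 x = 1"
proof -
  interpret P: prob_space "pdmp_space (return N x)" using x by (rule prob_space_pdmp_space)
  note sets = sets_pdmp_space_return[of N x]
  note sp = sets_eq_imp_space_eq[OF sets]
  have "AE \<omega> in pdmp_space (return N x). \<omega> \<in> path_event t (space N)"
    using ae AE_space
  proof eventually_elim
    case (elim \<omega>)
    have X: "snd (pdmp_chain \<psi> \<rho> G \<omega> k) \<in> space N" for k
      using measurable_space[OF pdmp_chain_measurable, of \<omega> k] elim(2) sp by (auto simp: space_pair_measure)
    obtain y where y: "pdmp_path \<psi> \<rho> G \<omega> t = Some y" using elim(1) by auto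
    \<comment> \<open>Membership in the image of \<open>UNIV\<close> produces the jump index k; the
      position then lies in the space because the flow preserves it.\<close>
    then have "pdmp_path \<psi> \<rho> G \<omega> t \<in> Some ` UNIV" by simp
    then have "pdmp_path \<psi> \<rho> G \<omega> t \<in> Some ` space N"
      unfolding pdmp_path_mem_iff[OF t] using X by auto
    then show ?case using elim(2) sp by (simp add: path_event_def)
  qed
  then have "emeasure (pdmp_space (return N x)) (path_event t (space N)) = 1"
    using path_event(1)[OF sets.top x t] by (intro P.emeasure_eq_1_AE) (simp_all add: sets)
  then show ?thesis using path_event(2)[OF sets.top x t] by simp
qed

end

section \<open>Extension to all real times\<close>

text \<open>Clamping time arguments at 0 makes flow, rate and kernel total in time, so that no
  restriction to the half line is needed in the locales above.\<close>

definition flow_ext :: "(real \<Rightarrow> real \<Rightarrow> 'a \<Rightarrow> 'a) \<Rightarrow> real \<Rightarrow> real \<Rightarrow> 'a \<Rightarrow> 'a" where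
  "flow_ext \<phi> s v x = \<phi> (max 0 s) (max (max 0 s) v) x"

text \<open>The outer maximum keeps the rate nonnegative at points outside M as well, as
  \<open>jump_flow\<close> demands for every argument.\<close>

definition rate_ext :: "(real \<Rightarrow> 'a \<Rightarrow> real) \<Rightarrow> real \<Rightarrow> 'a \<Rightarrow> real" where
  "rate_ext r v x = max 0 (r (max 0 v) x)"

lemma max_0_measurable [measurable]: "max 0 \<in> borel \<rightarrow>\<^sub>M half_line"
  by (rule measurable_restrict_space2) auto

lemma differential_flowD:
  assumes "differential_flow M \<phi>"
  shows "(\<lambda>(t, h, x). \<phi> t (t + h) x) \<in> measurable (half_line \<Otimes>\<^sub>M (half_line \<Otimes>\<^sub>M borel_of M)) (borel_of M)"
    and "0 \<le> t \<Longrightarrow> x \<in> M \<Longrightarrow> \<phi> t t x = x"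
    and "0 \<le> t \<Longrightarrow> 0 \<le> h1 \<Longrightarrow> 0 \<le> h2 \<Longrightarrow> x \<in> M \<Longrightarrow>
        \<phi> (t + h1) (t + h1 + h2) (\<phi> t (t + h1) x) = \<phi> t (t + h1 + h2) x"
    and "0 \<le> t \<Longrightarrow> x \<in> M \<Longrightarrow> \<exists>D. continuous_on {0..} D \<and>
        (\<forall>h\<ge>0. ((\<lambda>h. \<phi> t (t + h) x) has_vector_derivative D h) (at h within {0..}))"
    and "0 \<le> t \<Longrightarrow> 0 \<le> h \<Longrightarrow> x \<in> M \<Longrightarrow> \<phi> t (t + h) x \<in> M"
proof -
  note d = assms[unfolded differential_flow_def]
  note d2 = d[THEN conjunct2] note d3 = d2[THEN conjunct2] note d4 = d3[THEN conjunct2]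
  show "(\<lambda>(t, h, x). \<phi> t (t + h) x) \<in> measurable (half_line \<Otimes>\<^sub>M (half_line \<Otimes>\<^sub>M borel_of M)) (borel_of M)"
    by (rule d[THEN conjunct1])
  show "0 \<le> t \<Longrightarrow> x \<in> M \<Longrightarrow> \<phi> t t x = x"
    by (rule d2[THEN conjunct1, rule_format])
  show "0 \<le> t \<Longrightarrow> 0 \<le> h1 \<Longrightarrow> 0 \<le> h2 \<Longrightarrow> x \<in> M \<Longrightarrow>
      \<phi> (t + h1) (t + h1 + h2) (\<phi> t (t + h1) x) = \<phi> t (t + h1 + h2) x"
    by (rule d3[THEN conjunct1, rule_format])
  show "0 \<le> t \<Longrightarrow> x \<in> M \<Longrightarrow> \<exists>D. continuous_on {0..} D \<and>
      (\<forall>h\<ge>0. ((\<lambda>h. \<phi> t (t + h) x) has_vector_derivative D h) (at h within {0..}))"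
    by (rule d4[THEN conjunct1, rule_format])
  assume "0 \<le> t" "0 \<le> h" "x \<in> M"
  then show "\<phi> t (t + h) x \<in> M"
    using d4[THEN conjunct2, rule_format, of t h] by (auto simp: C1_diffeomorphism_def dest: bij_betwE)
qed

text \<open>The nested maximum in \<open>flow_ext\<close> keeps the target time at or after the
  source time, where \<phi> is constrained. Clamping preserves the order of times, hence the flow
  property.\<close>

lemma measurable_flow_ext:
  assumes \<phi>: "differential_flow M \<phi>"
  shows "measurable_flow (borel_of M) (flow_ext \<phi>)"
proof
  let ?N = "borel_of M"
  have sp: "space ?N = M" by (simp add: space_restrict_space)
  note \<phi>m = differential_flowD(1)[OF \<phi>] and id = differential_flowD(2)[OF \<phi>] and comp = differential_flowD(3)[OF \<phi>]
  have a: "(\<lambda>p. max 0 (fst p)) \<in> borel \<Otimes>\<^sub>M (borel \<Otimes>\<^sub>M ?N) \<rightarrow>\<^sub>M half_line"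
    by (rule measurable_restrict_space2) auto
  have b: "(\<lambda>p. max (max 0 (fst p)) (fst (snd p)) - max 0 (fst p)) \<in> borel \<Otimes>\<^sub>M (borel \<Otimes>\<^sub>M ?N) \<rightarrow>\<^sub>M half_line"
    by (rule measurable_restrict_space2) auto
  have "(\<lambda>p. (max 0 (fst p), max (max 0 (fst p)) (fst (snd p)) - max 0 (fst p), snd (snd p)))
      \<in> borel \<Otimes>\<^sub>M (borel \<Otimes>\<^sub>M ?N) \<rightarrow>\<^sub>M half_line \<Otimes>\<^sub>M (half_line \<Otimes>\<^sub>M ?N)"
    by (intro measurable_Pair a b) measurable
  from measurable_compose[OF this \<phi>m]
  show "(\<lambda>(s, v, x). flow_ext \<phi> s v x) \<in> borel \<Otimes>\<^sub>M (borel \<Otimes>\<^sub>M ?N) \<rightarrow>\<^sub>M ?N"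
    by (simp add: flow_ext_def split_beta')
  show "flow_ext \<phi> s s x = x" if "x \<in> space ?N" for s x
  proof -
    have "max (max 0 s) s = max 0 s" by simp
    then show ?thesis using that id[of "max 0 s" x] sp unfolding flow_ext_def by simp
  qed
  fix x and a b c :: real assume "x \<in> space ?N" "a \<le> b" "b \<le> c"
  moreover from this have "max (max 0 a) b = max 0 b" "max (max 0 b) c = max 0 c" "max (max 0 a) c = max 0 c"
    "a \<le> max 0 b" "b \<le> max 0 c"
    by (auto simp: max_def)
  ultimately show "flow_ext \<phi> b c (flow_ext \<phi> a b x) = flow_ext \<phi> a c x"
    using comp[of "max 0 a" "max 0 b - max 0 a" "max 0 c - max 0 b" x] sp
    unfolding flow_ext_def by simp
qed

text \<open>A flow line is continuous, being differentiable in h, so over a bounded time interval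
  its graph is a compact subset of [0, infinity) x M, on which a jump rate is bounded.\<close>

lemma rate_ext_bounded:
  assumes \<phi>: "differential_flow M \<phi>" and r: "jump_rate M r" and x: "x \<in> M"
  shows "\<exists>B. \<forall>v\<in>{a..b}. rate_ext r v (flow_ext \<phi> a v x) \<le> B"
proof -
  let ?a = "max 0 a" and ?b = "max 0 b"
  obtain D where "\<forall>h\<ge>0. ((\<lambda>h. \<phi> ?a (?a + h) x) has_vector_derivative D h) (at h within {0..})"
    using differential_flowD(4)[OF \<phi> max.cobounded1[of 0 a] x] by blast
  then have "continuous_on {0..} (\<lambda>h. \<phi> ?a (?a + h) x)"
    unfolding continuous_on_eq_continuous_within by (auto intro: has_vector_derivative_continuous)
  then have "continuous_on {0..?b} (\<lambda>h. \<phi> ?a (?a + h) x)"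
    by (rule continuous_on_subset) auto
  then have "continuous_on {0..?b} (\<lambda>h. (?a + h, \<phi> ?a (?a + h) x))"
    by (intro continuous_intros)
  then have K: "compact ((\<lambda>h. (?a + h, \<phi> ?a (?a + h) x)) ` {0..?b})" (is "compact ?K")
    by (rule compact_continuous_image) auto
  have "\<phi> ?a (?a + h) x \<in> M" if "0 \<le> h" for h
    using differential_flowD(5)[OF \<phi> max.cobounded1[of 0 a] that x] .
  then have "?K \<subseteq> {0..} \<times> M" by auto
  with K r have "bounded ((\<lambda>(t, x). r t x) ` ?K)" unfolding jump_rate_def by blast
  then obtain B where B: "\<And>z. z \<in> (\<lambda>(t, x). r t x) ` ?K \<Longrightarrow> norm z \<le> B" unfolding bounded_iff by blast
  have "rate_ext r v (flow_ext \<phi> a v x) \<le> B" if v: "v \<in> {a..b}" for v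
  proof -
    define h where "h = max 0 v - ?a"
    have h: "h \<in> {0..?b}" "max 0 v = ?a + h" "max ?a v = ?a + h" using v by (auto simp: h_def max_def)
    then have "norm (r (?a + h) (\<phi> ?a (?a + h) x)) \<le> B" by (intro B) force
    then show ?thesis unfolding rate_ext_def flow_ext_def h by (auto simp: abs_le_iff)
  qed
  then show ?thesis by blast
qed

lemma jump_flow_ext:
  assumes "pdmp_characteristics M \<phi> r Q"
  shows "jump_flow (borel_of M) (flow_ext \<phi>) (rate_ext r) (\<lambda>v. Q (max 0 v))"
proof -
  have \<phi>: "differential_flow M \<phi>" and r: "jump_rate M r" and Q: "markov_kernel M Q"
    using assms by (auto simp: pdmp_characteristics_def)
  let ?N = "borel_of M"
  have sp: "space ?N = M" by (simp add: space_restrict_space)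
  interpret measurable_flow ?N "flow_ext \<phi>" by (rule measurable_flow_ext[OF \<phi>])
  have m: "(\<lambda>p. (max 0 (fst p), snd p)) \<in> borel \<Otimes>\<^sub>M ?N \<rightarrow>\<^sub>M half_line \<Otimes>\<^sub>M ?N" by measurable
  show ?thesis
  proof
    have "(\<lambda>(t, x). r t x) \<in> borel_measurable (half_line \<Otimes>\<^sub>M ?N)" using r by (simp add: jump_rate_def)
    from measurable_compose[OF m this]
    have "(\<lambda>p. r (max 0 (fst p)) (snd p)) \<in> borel_measurable (borel \<Otimes>\<^sub>M ?N)" by simp
    then show "(\<lambda>(v, x). rate_ext r v x) \<in> borel_measurable (borel \<Otimes>\<^sub>M ?N)"
      unfolding rate_ext_def split_beta' by measurable
    show "0 \<le> rate_ext r v x" for v x by (simp add: rate_ext_def)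
    show "\<exists>B. \<forall>v\<in>{a..b}. rate_ext r v (flow_ext \<phi> a v x) \<le> B" if "x \<in> space ?N" for x a b
      using rate_ext_bounded[OF \<phi> r, of x a b] that sp by simp
    show "(\<lambda>(v, x). Q (max 0 v) x) \<in> borel \<Otimes>\<^sub>M ?N \<rightarrow>\<^sub>M prob_algebra ?N"
    proof (rule measurable_prob_algebraI)
      have Qp: "Q (max 0 v) x \<in> space (prob_algebra ?N)" if "x \<in> M" for v x
        using Q that unfolding markov_kernel_def by simp
      then show "prob_space ((\<lambda>(v, x). Q (max 0 v) x) p)" if "p \<in> space (borel \<Otimes>\<^sub>M ?N)" for p :: "real \<times> 'a"
        using that by (auto simp: space_pair_measure sp space_prob_algebra)
      show "(\<lambda>(v, x). Q (max 0 v) x) \<in> borel \<Otimes>\<^sub>M ?N \<rightarrow>\<^sub>M subprob_algebra ?N"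
      proof (rule measurable_subprob_algebra)
        fix p :: "real \<times> 'a" assume p: "p \<in> space (borel \<Otimes>\<^sub>M ?N)"
        then show "subprob_space ((\<lambda>(v, x). Q (max 0 v) x) p)" "sets ((\<lambda>(v, x). Q (max 0 v) x) p) = sets ?N"
          using Qp by (auto simp: space_pair_measure sp space_prob_algebra prob_space_imp_subprob_space)
      next
        fix A assume A: "A \<in> sets ?N"
        then have "(\<lambda>(t, x). measure (Q t x) A) \<in> borel_measurable (half_line \<Otimes>\<^sub>M ?N)"
          using Q by (simp add: markov_kernel_def)
        from measurable_compose[OF m this]
        have "(\<lambda>p. ennreal (measure (Q (max 0 (fst p)) (snd p)) A)) \<in> borel_measurable (borel \<Otimes>\<^sub>M ?N)" by simp
        also have "?this \<longleftrightarrow> (\<lambda>p. emeasure ((\<lambda>(v, x). Q (max 0 v) x) p) A) \<in> borel_measurable (borel \<Otimes>\<^sub>M ?N)"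
        proof (rule measurable_cong)
          fix p :: "real \<times> 'a" assume "p \<in> space (borel \<Otimes>\<^sub>M ?N)"
          then interpret prob_space "Q (max 0 (fst p)) (snd p)"
            using Qp by (auto simp: space_pair_measure sp space_prob_algebra)
          show "ennreal (measure (Q (max 0 (fst p)) (snd p)) A) = emeasure ((\<lambda>(v, x). Q (max 0 v) x) p) A"
            by (simp add: split_beta' emeasure_eq_measure)
        qed
        finally show "(\<lambda>p. emeasure ((\<lambda>(v, x). Q (max 0 v) x) p) A) \<in> borel_measurable (borel \<Otimes>\<^sub>M ?N)" .
      qed
    qed
  qed
qed

lemma pdmp_ext:
  assumes c: "pdmp_characteristics M \<phi> r Q" and G: "represents_kernel M Q G"
  shows "pdmp (borel_of M) (flow_ext \<phi>) (rate_ext r) (\<lambda>v. Q (max 0 v)) (\<lambda>v. G (max 0 v))"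
proof -
  let ?N = "borel_of M"
  have sp: "space ?N = M" by (simp add: space_restrict_space)
  interpret jump_flow ?N "flow_ext \<phi>" "rate_ext r" "\<lambda>v. Q (max 0 v)" by (rule jump_flow_ext[OF c])
  show ?thesis
  proof
    have m: "(\<lambda>p. (max 0 (fst p), snd p)) \<in> borel \<Otimes>\<^sub>M (?N \<Otimes>\<^sub>M uniform01) \<rightarrow>\<^sub>M half_line \<Otimes>\<^sub>M (?N \<Otimes>\<^sub>M uniform01)"
      by measurable
    have "(\<lambda>(t, x, u). G t x u) \<in> measurable (half_line \<Otimes>\<^sub>M (?N \<Otimes>\<^sub>M uniform01)) ?N"
      using G by (simp add: represents_kernel_def)
    from measurable_compose[OF m this]
    show "(\<lambda>(v, x, u). G (max 0 v) x u) \<in> borel \<Otimes>\<^sub>M (?N \<Otimes>\<^sub>M uniform01) \<rightarrow>\<^sub>M ?N"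
      by (simp add: split_beta')
    show "Q (max 0 v) x = distr uniform01 ?N (G (max 0 v) x)" if "x \<in> space ?N" for v x
      using G that sp by (simp add: represents_kernel_def)
  qed
qed

lemma next_jump_ext:
  assumes r: "jump_rate M r" and \<phi>: "differential_flow M \<phi>" and s: "0 \<le> s" and x: "x \<in> M"
  shows "next_jump \<phi> r s x e = next_jump (flow_ext \<phi>) (rate_ext r) s x e"
proof -
  have "(LINT v:{s..t}|lborel. r v (\<phi> s v x)) = (LINT v:{s..t}|lborel. rate_ext r v (flow_ext \<phi> s v x))" for t
  proof (rule set_lebesgue_integral_cong)
    show "\<forall>v. v \<in> {s..t} \<longrightarrow> r v (\<phi> s v x) = rate_ext r v (flow_ext \<phi> s v x)"
    proof safe
      fix v assume v: "v \<in> {s..t}"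
      have "\<phi> s v x \<in> M" using differential_flowD(5)[OF \<phi> s, of "v - s" x] v x by simp
      then have "0 \<le> r v (\<phi> s v x)" using r s v by (auto simp: jump_rate_def)
      then show "r v (\<phi> s v x) = rate_ext r v (flow_ext \<phi> s v x)"
        using s v by (simp add: rate_ext_def flow_ext_def)
    qed
  qed simp
  then show ?thesis by (simp add: next_jump_def)
qed

text \<open>Jump times are nonnegative and nondecreasing and positions stay in M, so along the chain
  none of the clamps has any effect.\<close>

lemma pdmp_chain_ext:
  assumes c: "pdmp_characteristics M \<phi> r Q" and G: "represents_kernel M Q G"
    and \<omega>: "\<omega> \<in> space (borel_of M \<Otimes>\<^sub>M noise.S)"
  shows "pdmp_chain \<phi> r G \<omega> k = pdmp_chain (flow_ext \<phi>) (rate_ext r) (\<lambda>v. G (max 0 v)) \<omega> k"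
proof (induction k)
  case (Suc k)
  interpret pdmp "borel_of M" "flow_ext \<phi>" "rate_ext r" "\<lambda>v. Q (max 0 v)" "\<lambda>v. G (max 0 v)"
    by (rule pdmp_ext[OF c G])
  let ?z = "pdmp_chain (flow_ext \<phi>) (rate_ext r) (\<lambda>v. G (max 0 v)) \<omega> k"
  have x: "snd ?z \<in> M"
    using measurable_space[OF pdmp_chain_measurable \<omega>, of k] by (auto simp: space_pair_measure space_restrict_space)
  have S: "0 \<le> fst ?z" by (rule fst_pdmp_chain_nonneg)
  then have s: "0 \<le> real_of_ereal (fst ?z)" by (rule real_of_ereal_pos)
  have r: "jump_rate M r" and \<phi>: "differential_flow M \<phi>" using c by (auto simp: pdmp_characteristics_def)
  note nj = next_jump_ext[OF r \<phi> s x]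
  let ?T = "next_jump (flow_ext \<phi>) (rate_ext r) (real_of_ereal (fst ?z)) (snd ?z) (fst (snd \<omega> k))"
  have T: "ereal (real_of_ereal (fst ?z)) \<le> ?T"
    unfolding next_jump_def by (rule Inf_greatest) auto
  then have t: "real_of_ereal (fst ?z) \<le> real_of_ereal ?T" if "?T \<noteq> \<infinity>"
    using that by (cases ?T) auto
  show ?case
    unfolding pdmp_chain_Suc Suc chain_step_def nj
    using t s by (auto simp: flow_ext_def max_def)
qed simp

lemma
  assumes c: "pdmp_characteristics M \<phi> r Q" and G: "represents_kernel M Q G"
    and \<omega>: "\<omega> \<in> space (borel_of M \<Otimes>\<^sub>M noise.S)"
  shows pdmp_path_ext_None: "pdmp_path \<phi> r G \<omega> t = None \<longleftrightarrow>
      pdmp_path (flow_ext \<phi>) (rate_ext r) (\<lambda>v. G (max 0 v)) \<omega> t = None"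
    and pdmp_path_ext_mem: "0 \<le> t \<Longrightarrow> pdmp_path \<phi> r G \<omega> t \<in> Some ` A \<longleftrightarrow>
      pdmp_path (flow_ext \<phi>) (rate_ext r) (\<lambda>v. G (max 0 v)) \<omega> t \<in> Some ` A"
proof -
  note e = pdmp_chain_ext[OF c G \<omega>]
  show "pdmp_path \<phi> r G \<omega> t = None \<longleftrightarrow> pdmp_path (flow_ext \<phi>) (rate_ext r) (\<lambda>v. G (max 0 v)) \<omega> t = None"
    unfolding pdmp_path_None_iff e ..
  assume t: "0 \<le> t"
  have "\<phi> (real_of_ereal S) t x = flow_ext \<phi> (real_of_ereal S) t x" if "0 \<le> S" "S \<le> ereal t" for S x
    using that t by (cases S) (auto simp: flow_ext_def)
  then show "pdmp_path \<phi> r G \<omega> t \<in> Some ` A \<longleftrightarrow>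
      pdmp_path (flow_ext \<phi>) (rate_ext r) (\<lambda>v. G (max 0 v)) \<omega> t \<in> Some ` A"
    unfolding pdmp_path_mem_iff[OF t] e
    using fst_pdmp_chain_nonneg by (metis (no_types, lifting))
qed

text \<open>Non-explosion enters twice: it makes the law a probability measure, and it lets the
  probability of n jumps up to t tend to 0.\<close>

lemma pdmp_semigroup_eq_law:
  assumes c: "pdmp_characteristics M \<phi> r Q" and ne: "non_explosive M \<phi> r Q"
    and P: "is_pdmp_semigroup M \<phi> r Q P" and t: "0 \<le> t" and x: "x \<in> M"
  defines "N \<equiv> borel_of M"
    and "u \<equiv> jump_flow.law (flow_ext \<phi>) (rate_ext r) (\<lambda>v. Q (max 0 v))"
    and "l \<equiv> jump_flow.jump_op (flow_ext \<phi>) (rate_ext r) (\<lambda>v. Q (max 0 v))"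
  shows "sets (P 0 t x) = sets N" "prob_space (P 0 t x)"
    "\<And>A. A \<in> sets N \<Longrightarrow> measure (P 0 t x) A = enn2real (u t A 0 x)"
    "(\<lambda>n. (l t ^^ n) (\<lambda>_ _. 1) 0 x) \<longlonglongrightarrow> 0"
proof -
  have sp: "space N = M" by (simp add: N_def space_restrict_space)
  \<comment> \<open>The instance s = 0 of the definition, in which the time shifts
    disappear.\<close>
  note P0 = P[unfolded is_pdmp_semigroup_def, THEN spec, THEN mp, OF order.refl, THEN spec, THEN mp, OF t, THEN bspec, OF x,
      unfolded add_0 diff_0_right, folded N_def]
  have sets: "sets (P 0 t x) = sets N" by (rule P0[THEN conjunct1])
  from P0[THEN conjunct2] obtain G where G: "represents_kernel M Q G"
    and em: "\<forall>A\<in>sets N. emeasure (P 0 t x) A = emeasure (pdmp_space (return N x))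
      {\<omega> \<in> space (pdmp_space (return N x)). pdmp_path \<phi> r G \<omega> t \<in> Some ` A}"
    by (elim exE conjE)
  interpret pdmp N "flow_ext \<phi>" "rate_ext r" "\<lambda>v. Q (max 0 v)" "\<lambda>v. G (max 0 v)"
    unfolding N_def by (rule pdmp_ext[OF c G])
  have xN: "x \<in> space N" using x sp by simp
  have spP: "space (pdmp_space (return N x)) = space (borel_of M \<Otimes>\<^sub>M noise.S)"
    using sets_eq_imp_space_eq[OF sets_pdmp_space_return[of N x]] by (simp add: N_def)
  have "return N x \<in> space (prob_algebra (borel_of M))"
    using xN by (simp add: space_prob_algebra prob_space_return N_def)
  then have "AE \<omega> in pdmp_space (return N x). Inf {ereal t | t. 0 \<le> t \<and> pdmp_path \<phi> r G \<omega> t = None} = \<infinity>"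
    using ne G unfolding non_explosive_def by blast
  then have ae: "AE \<omega> in pdmp_space (return N x). pdmp_path (flow_ext \<phi>) (rate_ext r) (\<lambda>v. G (max 0 v)) \<omega> t \<noteq> None"
    using AE_space
  proof eventually_elim
    case (elim \<omega>)
    \<comment> \<open>Being in the cemetery at t would place t in a set whose infimum is
      infinite.\<close>
    have alive: "pdmp_path \<phi> r G \<omega> t \<noteq> None"
    proof
      assume "pdmp_path \<phi> r G \<omega> t = None"
      then have "Inf {ereal t | t. 0 \<le> t \<and> pdmp_path \<phi> r G \<omega> t = None} \<le> ereal t"
        using t by (intro Inf_lower) auto
      then show False using elim(1) by simp
    qed
    have \<omega>: "\<omega> \<in> space (borel_of M \<Otimes>\<^sub>M noise.S)" using elim(2) unfolding spP .
    show ?case using alive unfolding pdmp_path_ext_None[OF c G \<omega>] .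
  qed
  have eU: "emeasure (P 0 t x) A = u t A 0 x" if A: "A \<in> sets N" for A
  proof -
    have "{\<omega> \<in> space (pdmp_space (return N x)). pdmp_path \<phi> r G \<omega> t \<in> Some ` A} = path_event t A"
      unfolding path_event_def spP N_def[symmetric]
      using pdmp_path_ext_mem[OF c G _ t, of _ A] by (auto simp: N_def)
    then show ?thesis unfolding em[rule_format, OF A] u_def using path_event(2)[OF A xN t] by simp
  qed
  show "sets (P 0 t x) = sets N" by (rule sets)
  show "prob_space (P 0 t x)"
    using eU[OF sets.top] law_total[OF xN t ae] sets_eq_imp_space_eq[OF sets]
    by (intro prob_spaceI) (simp add: u_def)
  show "measure (P 0 t x) A = enn2real (u t A 0 x)" if "A \<in> sets N" for A
    unfolding measure_def eU[OF that] ..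
  show "(\<lambda>n. (l t ^^ n) (\<lambda>_ _. 1) 0 x) \<longlonglongrightarrow> 0"
    unfolding l_def by (rule jump_op_power_one_tendsto[OF xN t ae])
qed

text \<open>For r2 \<le> r1 the difference is r2 (q1 - q2) + (r1 - r2) (q1 - d), where q1 - d has
  modulus at most 1; the other case is symmetric. With d the value of an indicator, this reduces the
  first form of the hypothesis to the second.\<close>

lemma generator_gap_le:
  fixes r1 r2 q1 q2 d :: real
  assumes "0 \<le> r1" "0 \<le> r2" "0 \<le> q1" "q1 \<le> 1" "0 \<le> q2" "q2 \<le> 1" "0 \<le> d" "d \<le> 1"
  shows "\<bar>r1 * (q1 - d) - r2 * (q2 - d)\<bar> \<le> min r1 r2 * \<bar>q1 - q2\<bar> + \<bar>r1 - r2\<bar>"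
proof -
  have main: "\<bar>a * (p - d) - b * (q - d)\<bar> \<le> b * \<bar>p - q\<bar> + (a - b)"
    if "b \<le> a" "0 \<le> b" "0 \<le> p" "p \<le> 1" for a b p q :: real
  proof -
    have "a * (p - d) - b * (q - d) = b * (p - q) + (a - b) * (p - d)" by (simp add: algebra_simps)
    also have "\<bar>\<dots>\<bar> \<le> \<bar>b * (p - q)\<bar> + \<bar>(a - b) * (p - d)\<bar>" by (rule abs_triangle_ineq)
    also have "\<bar>(a - b) * (p - d)\<bar> \<le> (a - b) * 1"
      unfolding abs_mult using that assms(7,8) by (intro mult_mono) auto
    finally show ?thesis using that by (simp add: abs_mult)
  qed
  show ?thesis
  proof (cases "r2 \<le> r1")
    case True
    then show ?thesis using main[of r2 r1 q1 q2] assms by simp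
  next
    case False
    then show ?thesis using main[of r1 r2 q2 q1] assms by (simp add: abs_minus_commute)
  qed
qed

theorem theorem11:
  fixes M :: "'a::euclidean_space set"
    and \<phi> :: "real \<Rightarrow> real \<Rightarrow> 'a \<Rightarrow> 'a"
    and r1 r2 :: "real \<Rightarrow> 'a \<Rightarrow> real"
    and Q1 Q2 :: "real \<Rightarrow> 'a \<Rightarrow> 'a measure"
    and P1 P2 :: "real \<Rightarrow> real \<Rightarrow> 'a \<Rightarrow> 'a measure"
    and g :: "real \<Rightarrow> real"
  assumes "closed M" and "smooth_submanifold M"
    and "pdmp_characteristics M \<phi> r1 Q1" and "pdmp_characteristics M \<phi> r2 Q2"
    and "non_explosive M \<phi> r1 Q1" and "non_explosive M \<phi> r2 Q2"
    and "is_pdmp_semigroup M \<phi> r1 Q1 P1" and "is_pdmp_semigroup M \<phi> r2 Q2 P2"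
    and "g \<in> borel_measurable half_line" and "\<And>t. 0 \<le> t \<Longrightarrow> 0 \<le> g t"
    and "(\<forall>t\<ge>0.
            (SUP (x, A)\<in>M \<times> sets (borel_of M).
               ennreal (min (r1 t x) (r2 t x) * \<bar>measure (Q1 t x) A - measure (Q2 t x) A\<bar>))
            + (SUP x\<in>M. ennreal \<bar>r1 t x - r2 t x\<bar>)
            \<le> ennreal (g t))
       \<or> (\<forall>t\<ge>0.
            (SUP (x, A)\<in>M \<times> sets (borel_of M).
               ennreal \<bar>r1 t x * (measure (Q1 t x) A - indicator A x)
                      - r2 t x * (measure (Q2 t x) A - indicator A x)\<bar>)
            \<le> ennreal (g t))"
  shows "\<forall>t\<ge>0. \<forall>x\<in>M.
           tv_norm_diff (P1 0 t x) (P2 0 t x)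
           \<le> 2 * (1 - exp_minus (\<integral>\<^sup>+ s\<in>{0..t}. ennreal (g s) \<partial>lborel))"
proof (intro allI impI ballI)
  fix t :: real and x assume t: "0 \<le> t" and x: "x \<in> M"
  let ?N = "borel_of M"
  let ?Q1 = "\<lambda>v. Q1 (max 0 v)" and ?Q2 = "\<lambda>v. Q2 (max 0 v)"
  let ?I = "\<integral>\<^sup>+ s\<in>{0..t}. ennreal (g s) \<partial>lborel"
  have sp: "space ?N = M" by (simp add: space_restrict_space)
  note P1 = pdmp_semigroup_eq_law[OF assms(3) assms(5) assms(7) t x]
  note P2 = pdmp_semigroup_eq_law[OF assms(4) assms(6) assms(8) t x]
  have sets: "sets (P2 0 t x) = sets (P1 0 t x)" using P1(1) P2(1) by simp
  have spP: "space (P1 0 t x) = M" using sets_eq_imp_space_eq[OF P1(1)] sp by simp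
  \<comment> \<open>The two alternatives meet in this bound, the second one directly and the first
    one through \<open>generator_gap_le\<close>.\<close>
  have gap: "\<bar>r1 v y * (measure (Q1 v y) A - indicator A y) - r2 v y * (measure (Q2 v y) A - indicator A y)\<bar> \<le> g v"
    if v: "0 \<le> v" and y: "y \<in> M" and A: "A \<in> sets ?N" for v y A
  proof -
    have yA: "(y, A) \<in> M \<times> sets ?N" using y A by simp
    show ?thesis
      using assms(11)
    proof
      assume "\<forall>t\<ge>0. (SUP (x, A)\<in>M \<times> sets ?N.
               ennreal (min (r1 t x) (r2 t x) * \<bar>measure (Q1 t x) A - measure (Q2 t x) A\<bar>))
            + (SUP x\<in>M. ennreal \<bar>r1 t x - r2 t x\<bar>) \<le> ennreal (g t)"
      note * = this[rule_format, OF v]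
      have r: "0 \<le> r1 v y" "0 \<le> r2 v y"
        using assms(3,4) v y by (auto simp: pdmp_characteristics_def jump_rate_def)
      have "prob_space (Q1 v y)" "prob_space (Q2 v y)"
        using assms(3,4) v y by (auto simp: pdmp_characteristics_def markov_kernel_def space_prob_algebra)
      then have q: "measure (Q1 v y) A \<le> 1" "measure (Q2 v y) A \<le> 1"
        by (auto intro: prob_space.prob_le_1)
      have "ennreal (min (r1 v y) (r2 v y) * \<bar>measure (Q1 v y) A - measure (Q2 v y) A\<bar> + \<bar>r1 v y - r2 v y\<bar>)
        = ennreal (min (r1 v y) (r2 v y) * \<bar>measure (Q1 v y) A - measure (Q2 v y) A\<bar>) + ennreal \<bar>r1 v y - r2 v y\<bar>"
        using r by (intro ennreal_plus) auto
      also have "\<dots> \<le> ennreal (g v)"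
        using * SUP_upper[OF yA, of "\<lambda>(x, A). ennreal (min (r1 v x) (r2 v x) * \<bar>measure (Q1 v x) A - measure (Q2 v x) A\<bar>)"]
          SUP_upper[OF y, of "\<lambda>x. ennreal \<bar>r1 v x - r2 v x\<bar>"]
        unfolding prod.case by (meson add_mono order_trans)
      finally have "min (r1 v y) (r2 v y) * \<bar>measure (Q1 v y) A - measure (Q2 v y) A\<bar> + \<bar>r1 v y - r2 v y\<bar> \<le> g v"
        using assms(10)[OF v] by (simp add: ennreal_le_iff)
      moreover have "\<bar>r1 v y * (measure (Q1 v y) A - indicator A y) - r2 v y * (measure (Q2 v y) A - indicator A y)\<bar>
        \<le> min (r1 v y) (r2 v y) * \<bar>measure (Q1 v y) A - measure (Q2 v y) A\<bar> + \<bar>r1 v y - r2 v y\<bar>"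
        by (rule generator_gap_le) (use r q in \<open>auto split: split_indicator\<close>)
      ultimately show ?thesis by linarith
    next
      assume "\<forall>t\<ge>0. (SUP (x, A)\<in>M \<times> sets ?N.
               ennreal \<bar>r1 t x * (measure (Q1 t x) A - indicator A x)
                      - r2 t x * (measure (Q2 t x) A - indicator A x)\<bar>) \<le> ennreal (g t)"
      note * = this[rule_format, OF v]
      have "ennreal \<bar>r1 v y * (measure (Q1 v y) A - indicator A y) - r2 v y * (measure (Q2 v y) A - indicator A y)\<bar> \<le> ennreal (g v)"
        using order_trans[OF SUP_upper[OF yA] *] by simp
      then show ?thesis using assms(10)[OF v] by (simp add: ennreal_le_iff)
    qed
  qed
  show "tv_norm_diff (P1 0 t x) (P2 0 t x) \<le> 2 * (1 - exp_minus ?I)"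
  proof (rule tv_norm_diff_le[OF P1(2) P2(2) sets])
    fix A assume "A \<in> sets (P1 0 t x)"
    then have A: "A \<in> sets ?N" using P1(1) by simp
    show "exp_minus ?I \<le> measure (P1 0 t x) A + measure (P2 0 t x) (space (P1 0 t x) - A)"
    \<comment> \<open>If the integral of g is infinite, \<open>exp_minus\<close> is 0 and the bound
      is trivial; otherwise g is integrable on {0..t}.\<close>
    proof (cases "?I = \<infinity>")
      case False
      \<comment> \<open>A hazard rate must be measurable on the whole line and integrable up to
        every b, while g is known to be measurable on the half-line and integrable up to t; hence
        the cut-off.\<close>
      define g' where "g' v = indicator {0..t} v * g v" for v
      have g'_nonneg: "0 \<le> g' v" for v using assms(10)[of v] by (auto simp: g'_def split: split_indicator)
      have g0: "(\<lambda>v. g v * indicator {0..} v) \<in> borel_measurable borel"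
        using assms(9) by (simp add: borel_measurable_restrict_space_iff mult.commute)
      have "(\<lambda>v. indicator {0..t} v * (g v * indicator {0..} v)) \<in> borel_measurable borel"
        by (rule borel_measurable_times[OF borel_measurable_indicator g0]) simp
      also have "(\<lambda>v. indicator {0..t} v * (g v * indicator {0..} v)) = g'"
        by (auto simp: g'_def split: split_indicator)
      finally have g'_m [measurable]: "g' \<in> borel_measurable borel" .
      have I: "(\<integral>\<^sup>+ v. ennreal (g' v) \<partial>lborel) = ?I"
        by (intro nn_integral_cong) (auto simp: g'_def split: split_indicator)
      have g'_int: "integrable lborel g'"
        using False g'_nonneg I by (intro integrableI_nonneg) (auto simp: top.not_eq_extremum)
      interpret J1: jump_flow ?N "flow_ext \<phi>" "rate_ext r1" ?Q1 by (rule jump_flow_ext[OF assms(3)])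
      interpret J2: jump_flow ?N "flow_ext \<phi>" "rate_ext r2" ?Q2 by (rule jump_flow_ext[OF assms(4)])
      interpret J: jump_flow_pair ?N "flow_ext \<phi>" "rate_ext r1" ?Q1 "rate_ext r2" ?Q2 g' 0 t
      proof
        show "set_integrable lborel {0..b} g'" for b
          unfolding set_integrable_def using g'_int by (rule integrable_mult_indicator[rotated]) simp
        fix v y A assume v: "0 \<le> v" "v \<le> t" and "y \<in> space ?N" "A \<in> sets ?N"
        then have y: "y \<in> M" and A: "A \<in> sets ?N" using sp by auto
        have "0 \<le> r1 v y" "0 \<le> r2 v y"
          using assms(3,4) v y by (auto simp: pdmp_characteristics_def jump_rate_def)
        then show "rate_ext r2 v y * (measure (?Q2 v y) A - indicator A y) - rate_ext r1 v y * (measure (?Q1 v y) A - indicator A y) \<le> g' v"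
          using gap[OF v(1) y A] v by (simp add: rate_ext_def g'_def abs_le_iff)
      qed (auto simp: g'_nonneg t)
      have "J.G.hazard t = (LINT v|lborel. g' v)"
        unfolding J.G.hazard_def set_lebesgue_integral_def
        by (intro Bochner_Integration.integral_cong) (auto simp: g'_def split: split_indicator)
      also have "\<dots> = enn2real ?I"
        using g'_nonneg by (subst integral_eq_nn_integral) (auto simp: I)
      finally have "exp_minus ?I = exp (- J.G.hazard t)" using False by (simp add: exp_minus_def)
      also have "\<dots> \<le> enn2real (J1.law t A 0 x) + enn2real (J2.law t (space ?N - A) 0 x)"
        using A x sp P1(4) by (intro J.law_sum_ge) auto
      also have "\<dots> = measure (P1 0 t x) A + measure (P2 0 t x) (space (P1 0 t x) - A)"
        using P1(3)[OF A] P2(3)[OF sets.compl_sets[OF A]] by (simp add: spP sp)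
      finally show ?thesis .
    qed (simp add: exp_minus_def)
  qed
qed

end
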